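(* Let $d=(d_1,\dots,d_t)$ be a dimension vector, $l\ge 0$ with $l<t$, and $x\in\mathfrak p_u^{(l)}(d)$. Then the codimension of the orbit $P(d)\cdot x$ in $\mathfrak p_u^{(l)}(d)$ equals $\dim_k\mathrm{Ext}^1_{\mathcal A_{t,l}}(M(x),M(x))$. In particular, $P(d)\cdot x$ is dense in $\mathfrak p_u^{(l)}(d)$ if and only if $\mathrm{Ext}^1_{\mathcal A_{t,l}}(M(x),M(x))=0$.
   Context: Let $k$ be an algebraically closed field. A dimension vector is $d=(d_1,\dots,d_t)\in\mathbb Z_{\ge0}^t$; put $(\Sigma d)_i=d_1+\dots+d_i$ and $n=(\Sigma d)_t$. The standard flag is $0=V_0\subseteq V_1\subseteq\dots\subseteq V_t=k^n$ with $V_i=k^{(\Sigma d)_i}$ (spanned by the first $(\Sigma d)_i$ standard basis vectors). $P(d)\subseteq\mathrm{GL}_n(k)$ is the stabilizer of this flag, acting by conjugation on $\mathfrak p_u^{(l)}(d)=\{f\in\mathrm{End}(k^n): f(V_i)\subseteq V_{i-l-1}\text{ for all } i\}$ (with $V_j=0$ for $j\le 0$). The algebra $\mathcal A_{t,l}$ is the quotient of the path algebra over $k$ of the quiver with vertices $1,\dots,t$, arrows $\alpha_i:i\to i+1$ ($1\le i\le t-1$) and $\beta_j:j+l+1\to j$ ($1\le j\le t-l-1$), by the relations $\beta_1\alpha_{l+1}=0$ and $\beta_{i+1}\alpha_{i+l+1}=\alpha_i\beta_i$ for $1\le i\le t-l-2$ (compositions of linear maps, right to left); modules are identified with representations satisfying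 these relations. For $x\in\mathfrak p_u^{(l)}(d)$, $M(x)$ is the $\mathcal A_{t,l}$-module with $M(x)_i=V_i$, $\alpha_i$ the inclusion $V_i\hookrightarrow V_{i+1}$, and $\beta_j$ the restriction of $x$ to $V_{j+l+1}$, viewed as a map $V_{j+l+1}\to V_j$. *)

theory Defs
  imports Main "HOL-Library.Function_Algebras" "HOL-Library.Extended_Nat"
    "HOL-Computational_Algebra.Polynomial"
begin

definition fscale :: "'k::field \<Rightarrow> ('a \<Rightarrow> 'k) \<Rightarrow> ('a \<Rightarrow> 'k)" where
  "fscale c f = (\<lambda>x. c * f x)"

interpretation fvs: vector_space "fscale :: 'k::field \<Rightarrow> ('a \<Rightarrow> 'k) \<Rightarrow> ('a \<Rightarrow> 'k)"
  by unfold_locales (auto simp: fscale_def algebra_simps)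

text \<open>Matrices: functions on index pairs (row, column); a matrix of size
  p x q has all entries outside [0,p) x [0,q) equal to zero.\<close>

type_synonym 'k mat = "nat \<times> nat \<Rightarrow> 'k"

definition is_mat :: "nat \<Rightarrow> nat \<Rightarrow> 'k::zero mat \<Rightarrow> bool" where
  "is_mat p q A \<longleftrightarrow> (\<forall>i j. (p \<le> i \<or> q \<le> j) \<longrightarrow> A (i, j) = 0)"

definition mmul :: "nat \<Rightarrow> 'k::comm_ring_1 mat \<Rightarrow> 'k mat \<Rightarrow> 'k mat" where
  "mmul r A B = (\<lambda>(i, j). \<Sum>s<r. A (i, s) * B (s, j))"

definition mvec :: "nat \<Rightarrow> 'k::comm_ring_1 mat \<Rightarrow> (nat \<Rightarrow> 'k) \<Rightarrow> (nat \<Rightarrow> 'k)" where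
  "mvec n A v = (\<lambda>i. \<Sum>s<n. A (i, s) * v s)"

definition idm :: "nat \<Rightarrow> 'k::comm_ring_1 mat" where
  "idm n = (\<lambda>(i, j). if i = j \<and> i < n then 1 else 0)"

definition Sig :: "nat list \<Rightarrow> nat \<Rightarrow> nat" where
  "Sig d i = sum_list (take i d)"

definition ntot :: "nat list \<Rightarrow> nat" where
  "ntot d = sum_list d"

text \<open>V_i = span of the first (Sigma d)_i standard basis vectors of k^n
  (V_0 = 0).  Nat subtraction makes V_j = 0 for j <= 0.\<close>
definition flagV :: "nat list \<Rightarrow> nat \<Rightarrow> (nat \<Rightarrow> 'k::zero) set" where
  "flagV d i = {v. \<forall>r. Sig d i \<le> r \<longrightarrow> v r = 0}"

definition pu :: "nat list \<Rightarrow> nat \<Rightarrow> 'k::comm_ring_1 mat set" where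
  "pu d l = {f. is_mat (ntot d) (ntot d) f \<and>
     (\<forall>i\<le>length d. \<forall>v\<in>flagV d i. mvec (ntot d) f v \<in> flagV d (i - l - 1))}"

definition invertible_mat :: "nat \<Rightarrow> 'k::comm_ring_1 mat \<Rightarrow> bool" where
  "invertible_mat n g \<longleftrightarrow> is_mat n n g \<and>
     (\<exists>h. is_mat n n h \<and> mmul n g h = idm n \<and> mmul n h g = idm n)"

definition Pgrp :: "nat list \<Rightarrow> 'k::comm_ring_1 mat set" where
  "Pgrp d = {g. invertible_mat (ntot d) g \<and>
     (\<forall>i\<le>length d. \<forall>v\<in>flagV d i. mvec (ntot d) g v \<in> flagV d i)}"

definition orbit :: "nat list \<Rightarrow> 'k::comm_ring_1 mat \<Rightarrow> 'k mat set" where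
  "orbit d x = {mmul (ntot d) (mmul (ntot d) g x) h | g h.
     g \<in> Pgrp d \<and> is_mat (ntot d) (ntot d) h \<and> mmul (ntot d) g h = idm (ntot d)}"

inductive_set polyfun :: "(('a \<Rightarrow> 'k::comm_ring_1) \<Rightarrow> 'k) set" where
  pf_const: "(\<lambda>v. c) \<in> polyfun"
| pf_coord: "(\<lambda>v. v a) \<in> polyfun"
| pf_add: "p \<in> polyfun \<Longrightarrow> q \<in> polyfun \<Longrightarrow> (\<lambda>v. p v + q v) \<in> polyfun"
| pf_mult: "p \<in> polyfun \<Longrightarrow> q \<in> polyfun \<Longrightarrow> (\<lambda>v. p v * q v) \<in> polyfun"

definition zclosed :: "('a \<Rightarrow> 'k::comm_ring_1) set \<Rightarrow> bool" where
  "zclosed C \<longleftrightarrow> (\<exists>F \<subseteq> polyfun. C = {v. \<forall>p\<in>F. p v = 0})"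

definition zclosure :: "('a \<Rightarrow> 'k::comm_ring_1) set \<Rightarrow> ('a \<Rightarrow> 'k) set" where
  "zclosure S = \<Inter>{C. zclosed C \<and> S \<subseteq> C}"

definition zirreducible :: "('a \<Rightarrow> 'k::comm_ring_1) set \<Rightarrow> bool" where
  "zirreducible Z \<longleftrightarrow> zclosed Z \<and> Z \<noteq> {} \<and>
     (\<forall>C1 C2. zclosed C1 \<and> zclosed C2 \<and> Z \<subseteq> C1 \<union> C2 \<longrightarrow> Z \<subseteq> C1 \<or> Z \<subseteq> C2)"

definition zdim :: "('a \<Rightarrow> 'k::comm_ring_1) set \<Rightarrow> enat" where
  "zdim S = Sup {enat m | m. \<exists>Z :: nat \<Rightarrow> ('a \<Rightarrow> 'k) set.
      (\<forall>i\<le>m. zirreducible (Z i)) \<and> (\<forall>i<m. Z i \<subset> Z (Suc i)) \<and> Z m \<subseteq> zclosure S}"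

datatype arrow = Alpha nat | Beta nat

definition src :: "nat \<Rightarrow> arrow \<Rightarrow> nat" where
  "src l a = (case a of Alpha i \<Rightarrow> i | Beta j \<Rightarrow> j + l + 1)"

definition tgt :: "nat \<Rightarrow> arrow \<Rightarrow> nat" where
  "tgt l a = (case a of Alpha i \<Rightarrow> i + 1 | Beta j \<Rightarrow> j)"

definition valid_arrow :: "nat \<Rightarrow> nat \<Rightarrow> arrow \<Rightarrow> bool" where
  "valid_arrow t l a = (case a of Alpha i \<Rightarrow> 1 \<le> i \<and> i + 1 \<le> t
                                 | Beta j \<Rightarrow> 1 \<le> j \<and> j + l + 1 \<le> t)"

text \<open>A representation: dimension at each vertex and a matrix for each arrow
  (of size dim(tgt a) x dim(src a)).\<close>
type_synonym 'k rep = "(nat \<Rightarrow> nat) \<times> (arrow \<Rightarrow> 'k mat)"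

definition rel_ok :: "nat \<Rightarrow> nat \<Rightarrow> 'k::comm_ring_1 rep \<Rightarrow> bool" where
  "rel_ok t l R = (let (dm, A) = R in
     (l + 2 \<le> t \<longrightarrow> mmul (dm (l + 2)) (A (Beta 1)) (A (Alpha (l + 1))) = (\<lambda>_. 0)) \<and>
     (\<forall>i. 1 \<le> i \<and> i + l + 2 \<le> t \<longrightarrow>
        mmul (dm (i + l + 2)) (A (Beta (i + 1))) (A (Alpha (i + l + 1)))
          = mmul (dm (i + 1)) (A (Alpha i)) (A (Beta i))))"

definition is_rep :: "nat \<Rightarrow> nat \<Rightarrow> 'k::comm_ring_1 rep \<Rightarrow> bool" where
  "is_rep t l R = (let (dm, A) = R in
     (\<forall>a. if valid_arrow t l a then is_mat (dm (tgt l a)) (dm (src l a)) (A a)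
          else A a = (\<lambda>_. 0)) \<and> rel_ok t l R)"

text \<open>The module M(x): M_i = V_i, alpha_i the inclusion, beta_j = x restricted.\<close>
definition Mx :: "nat list \<Rightarrow> nat \<Rightarrow> 'k::comm_ring_1 mat \<Rightarrow> 'k rep" where
  "Mx d l x = (Sig d, \<lambda>a. if valid_arrow (length d) l a then
      (case a of
         Alpha i \<Rightarrow> (\<lambda>(r, c). if r = c \<and> c < Sig d i then 1 else 0)
       | Beta j \<Rightarrow> (\<lambda>(r, c). if r < Sig d j \<and> c < Sig d (j + l + 1) then x (r, c) else 0))
      else (\<lambda>_. 0))"

text \<open>Given representations M, N and a family H of matrices H_a : M_{src a} -> N_{tgt a},
  the representation E(H) with E_i = N_i (+) M_i and E_a = [[N_a, H_a], [0, M_a]];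
  it is an extension 0 -> N -> E(H) -> M -> 0 of A_{t,l}-modules exactly when E(H)
  satisfies the relations.\<close>
definition ext_rep :: "nat \<Rightarrow> 'k::comm_ring_1 rep \<Rightarrow> 'k rep \<Rightarrow> (arrow \<Rightarrow> 'k mat) \<Rightarrow> 'k rep" where
  "ext_rep l M N H = (let (dM, AM) = M; (dN, AN) = N in
     (\<lambda>i. dN i + dM i,
      \<lambda>a. (\<lambda>(r, c). if r < dN (tgt l a) then
                      (if c < dN (src l a) then AN a (r, c) else H a (r, c - dN (src l a)))
                    else (if c < dN (src l a) then 0
                          else AM a (r - dN (tgt l a), c - dN (src l a))))))"

definition ext_cocycles :: "nat \<Rightarrow> nat \<Rightarrow> 'k::comm_ring_1 rep \<Rightarrow> 'k rep \<Rightarrow> (arrow \<times> nat \<times> nat \<Rightarrow> 'k) set" where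
  "ext_cocycles t l M N = {Hc. let H = (\<lambda>a (r, c). Hc (a, r, c)) in
     (\<forall>a. if valid_arrow t l a then is_mat (fst N (tgt l a)) (fst M (src l a)) (H a)
          else H a = (\<lambda>_. 0)) \<and> rel_ok t l (ext_rep l M N H)}"

text \<open>Coboundaries: cocycles of split extensions, H_a = N_a phi_{src a} - phi_{tgt a} M_a
  for a family of matrices phi_i : M_i -> N_i.\<close>
definition ext_coboundaries :: "nat \<Rightarrow> nat \<Rightarrow> 'k::comm_ring_1 rep \<Rightarrow> 'k rep \<Rightarrow> (arrow \<times> nat \<times> nat \<Rightarrow> 'k) set" where
  "ext_coboundaries t l M N = {Hc | Hc phi. (\<forall>i. is_mat (fst N i) (fst M i) (phi i)) \<and>
     (\<forall>a r c. Hc (a, r, c) = (if valid_arrow t l a then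
        mmul (fst N (src l a)) (snd N a) (phi (src l a)) (r, c)
        - mmul (fst M (tgt l a)) (phi (tgt l a)) (snd M a) (r, c) else 0))}"

definition ext1_dim :: "nat \<Rightarrow> nat \<Rightarrow> 'k::field rep \<Rightarrow> 'k rep \<Rightarrow> nat" where
  "ext1_dim t l M N = fvs.dim (ext_cocycles t l M N) - fvs.dim (ext_coboundaries t l M N)"

definition alg_closed :: "'k::field itself \<Rightarrow> bool" where
  "alg_closed _ \<longleftrightarrow> (\<forall>p :: 'k poly. 0 < degree p \<longrightarrow> (\<exists>z. poly p z = 0))"

end

theory Submission
  imports "Jordan_Normal_Form.Determinant" Defs
begin

text \<open>Let \<open>T = {a x - x a | a \<in> \<pp>}\<close> be the tangent space of the orbit at \<open>x\<close>, where \<open>\<pp>\<close> consists of all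
  matrices preserving the flag. Both sides equal \<open>dim \<pp>\<^sub>u - dim T\<close>.

  Choose \<open>a\<^sub>1, \<dots>, a\<^sub>r\<close> whose images \<open>a\<^sub>k x - x a\<^sub>k\<close> form a basis of \<open>T\<close> that is dual to \<open>r\<close> matrix entries. Since
  \<open>a x = y a\<close> is linear in \<open>a\<close>, Cramer's rule recovers \<open>s\<close> from \<open>y = a x a\<^sup>-\<^sup>1\<close> with \<open>a = 1 + \<Sum> s\<^sub>k a\<^sub>k\<close>, so the orbit is
  birational to affine \<open>r\<close>-space. Such a set has dimension \<open>r\<close>: images of a coordinate flag give a chain of length \<open>r\<close>,
  and a chain of length \<open>m\<close> gives \<open>m\<close> algebraically independent functions, whence \<open>m \<le> r\<close> by counting monomials.

  On the other side, every cocycle is cohomologous to one that vanishes on all \<open>\<alpha>\<^sub>i\<close>; such cocycles are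
  the elements of \<open>\<pp>\<^sub>u\<close>, and the coboundaries among them are the elements of \<open>T\<close>.\<close>

section \<open>Zariski closed sets and algebraic independence\<close>

text \<open>Dimension is defined through chains of irreducible closed sets, so both bounds for the
  orbit are statements about chains; \<open>zprime\<close> replaces irreducibility for sets that
  need not be closed, such as orbits and images of rational maps. Conjugation by all of P(d) has
  cosets of the stabiliser as fibres. Restricting to the affine slice 1 + span(a_k), whose
  directions map to a basis of T, makes the parametrisation generically injective. No separability
  question arises in positive characteristic: the conjugating elements solve a linear system whose
  matrix at x is the identity. That a general orbit point is reached from the slice is linear
  algebra as well: the solution of r of the equations already solves the remaining ones.

  One set K of matrix positions links the two sides. The entries in K are coordinates on T, so |K| =
  dim T, while the matrices of p_u vanishing on K form a complement of T, which maps isomorphically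
  onto Ext^1. Codimension and Ext dimension are both the number of free positions of p_u outside
  K.\<close>

lemma infinite_if_alg_closed:
  assumes "alg_closed TYPE('k::field)"
  shows "infinite (UNIV :: 'k set)"
proof
  assume fin: "finite (UNIV :: 'k set)"
  \<comment> \<open>Over a finite field this product vanishes everywhere, so adding 1 gives a
    nonconstant polynomial without a root.\<close>
  define p :: "'k poly" where "p = (\<Prod>a\<in>UNIV. [:-a, 1:])"
  have "degree p = (\<Sum>a\<in>(UNIV::'k set). degree [:-a, 1:])"
    unfolding p_def by (rule degree_prod_eq_sum_degree) simp
  then have "degree p = card (UNIV :: 'k set)" by simp
  then have "0 < degree p" using fin by (simp add: card_gt_0_iff)
  then have "0 < degree (p + 1)" by (simp add: degree_add_eq_left)
  then obtain z where "poly (p + 1) z = 0" using assms unfolding alg_closed_def by blast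
  moreover have "poly p z = 0"
    unfolding p_def poly_prod by (rule prod_zero[OF fin]) (auto intro: bexI[of _ z])
  ultimately show False by simp
qed

lemma sum_fun_eval: "(\<Sum>i\<in>S. f i) x = (\<Sum>i\<in>S. f i x)"
  for f :: "'i \<Rightarrow> 'a \<Rightarrow> 'b::comm_monoid_add"
  by (induction S rule: infinite_finite_induct) auto

text \<open>A coordinate subspace. Vectors and matrices are functions on infinite index types, so
  the finite-dimensional spaces of the theorem appear as functions supported on a finite
  set.\<close>

definition csupp :: "'a set \<Rightarrow> ('a \<Rightarrow> 'k::zero) set" where
  "csupp I = {f. \<forall>a. a \<notin> I \<longrightarrow> f a = 0}"

lemma csupp_mono: "A \<subseteq> B \<Longrightarrow> csupp A \<subseteq> csupp B"
  by (auto simp: csupp_def)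

section \<open>Polynomial functions: closure properties, restriction to lines, substitution of
  fractions\<close>

lemma polyfun_sum:
  "(\<And>i. i \<in> S \<Longrightarrow> p i \<in> polyfun) \<Longrightarrow> (\<lambda>v. \<Sum>i\<in>S. p i v) \<in> polyfun"
  by (induction S rule: infinite_finite_induct) (auto intro: polyfun.intros)

lemma polyfun_prod:
  "(\<And>i. i \<in> S \<Longrightarrow> p i \<in> polyfun) \<Longrightarrow> (\<lambda>v. \<Prod>i\<in>S. p i v) \<in> polyfun"
  by (induction S rule: infinite_finite_induct) (auto intro: polyfun.intros)

lemma polyfun_power: "p \<in> polyfun \<Longrightarrow> (\<lambda>v. p v ^ n) \<in> polyfun"
  by (induction n) (auto intro: polyfun.intros)

lemma polyfun_diff:
  assumes "p \<in> polyfun" "q \<in> polyfun"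
  shows "(\<lambda>v. p v - q v) \<in> polyfun"
proof -
  have "(\<lambda>v. p v + (-1) * q v) \<in> polyfun"
    by (intro polyfun.intros assms)
  then show ?thesis by simp
qed

lemmas polyfun_intros = polyfun.intros polyfun_sum polyfun_prod polyfun_power polyfun_diff

text \<open>Members of \<open>polyfun\<close> are functions, not formal expressions; on a line they
  become univariate polynomials, whose finitely many roots can be avoided over an infinite
  field.\<close>

lemma polyfun_on_line:
  fixes p :: "('a \<Rightarrow> 'k::comm_ring_1) \<Rightarrow> 'k"
  assumes "p \<in> polyfun"
  shows "\<exists>P. \<forall>\<tau>. p (\<lambda>a. u a + \<tau> * w a) = poly P \<tau>"
  using assms
proof induction
  case (pf_const c)
  show ?case by (rule exI[of _ "[:c:]"]) simp
next
  case (pf_coord a)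
  show ?case by (rule exI[of _ "[:u a, w a:]"]) simp
next
  case (pf_add p q)
  then obtain P Q where "\<forall>\<tau>. p (\<lambda>a. u a + \<tau> * w a) = poly P \<tau>"
    "\<forall>\<tau>. q (\<lambda>a. u a + \<tau> * w a) = poly Q \<tau>" by blast
  then show ?case by (intro exI[of _ "P + Q"]) simp
next
  case (pf_mult p q)
  then obtain P Q where "\<forall>\<tau>. p (\<lambda>a. u a + \<tau> * w a) = poly P \<tau>"
    "\<forall>\<tau>. q (\<lambda>a. u a + \<tau> * w a) = poly Q \<tau>" by blast
  then show ?case by (intro exI[of _ "P * Q"]) simp
qed

text \<open>Pullback along the rational map with components \<open>P a / q\<close>; the exponent
  \<open>N\<close> clears all denominators. Zeros of \<open>q\<close>, where division returns 0, are
  left out.\<close>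

lemma polyfun_clear_denominators:
  fixes p :: "('a \<Rightarrow> 'k::field) \<Rightarrow> 'k"
  assumes "p \<in> polyfun" and q: "q \<in> polyfun" and P: "\<And>a. P a \<in> polyfun"
  shows "\<exists>N. \<exists>p'\<in>polyfun. \<forall>s. q s \<noteq> 0 \<longrightarrow> p' s = q s ^ N * p (\<lambda>a. P a s / q s)"
  using assms(1)
proof induction
  case (pf_const c)
  show ?case
    by (rule exI[of _ 0], rule bexI[of _ "\<lambda>s. c"]) (auto intro: polyfun_intros)
next
  case (pf_coord a)
  show ?case
    by (rule exI[of _ 1], rule bexI[of _ "P a"]) (auto intro: P)
next
  case (pf_add p1 p2)
  obtain N1 r1 where r1: "r1 \<in> polyfun"
    "\<forall>s. q s \<noteq> 0 \<longrightarrow> r1 s = q s ^ N1 * p1 (\<lambda>a. P a s / q s)"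
    using pf_add.IH(1) by (elim exE bexE) (rule that)
  obtain N2 r2 where r2: "r2 \<in> polyfun"
    "\<forall>s. q s \<noteq> 0 \<longrightarrow> r2 s = q s ^ N2 * p2 (\<lambda>a. P a s / q s)"
    using pf_add.IH(2) by (elim exE bexE) (rule that)
  show ?case
    by (rule exI[of _ "N1 + N2"], rule bexI[of _ "\<lambda>s. q s ^ N2 * r1 s + q s ^ N1 * r2 s"])
      (auto intro!: polyfun_intros r1 r2 q simp: r1 r2 power_add algebra_simps)
next
  case (pf_mult p1 p2)
  obtain N1 r1 where r1: "r1 \<in> polyfun"
    "\<forall>s. q s \<noteq> 0 \<longrightarrow> r1 s = q s ^ N1 * p1 (\<lambda>a. P a s / q s)"
    using pf_mult.IH(1) by (elim exE bexE) (rule that)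
  obtain N2 r2 where r2: "r2 \<in> polyfun"
    "\<forall>s. q s \<noteq> 0 \<longrightarrow> r2 s = q s ^ N2 * p2 (\<lambda>a. P a s / q s)"
    using pf_mult.IH(2) by (elim exE bexE) (rule that)
  show ?case
    by (rule exI[of _ "N1 + N2"], rule bexI[of _ "\<lambda>s. r1 s * r2 s"])
      (auto intro!: polyfun_intros r1 r2 simp: r1 r2 power_add algebra_simps)
qed

text \<open>The vanishing ideal of \<open>S\<close> is prime, which amounts to irreducibility of the
  closure. Since \<open>S\<close> need not be closed, the property passes to open subsets and to
  rational images.\<close>

definition zprime :: "('a \<Rightarrow> 'k::comm_ring_1) set \<Rightarrow> bool" where
  "zprime S \<longleftrightarrow> S \<noteq> {} \<and> (\<forall>p\<in>polyfun. \<forall>q\<in>polyfun.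
     (\<forall>v\<in>S. p v * q v = 0) \<longrightarrow> (\<forall>v\<in>S. p v = 0) \<or> (\<forall>v\<in>S. q v = 0))"

lemma zprime_cases:
  assumes "zprime S" "p \<in> polyfun" "q \<in> polyfun" "\<And>v. v \<in> S \<Longrightarrow> p v * q v = 0"
  shows "(\<forall>v\<in>S. p v = 0) \<or> (\<forall>v\<in>S. q v = 0)"
  using assms unfolding zprime_def by simp

text \<open>The cancellation form: a factor that is nonzero at one point of \<open>S\<close> can be
  removed on all of \<open>S\<close>.\<close>

lemma zprimeD:
  assumes "zprime S" "p \<in> polyfun" "q \<in> polyfun" "\<And>v. v \<in> S \<Longrightarrow> p v * q v = 0"
    and "u \<in> S" "q u \<noteq> 0" "v \<in> S"
  shows "p v = 0"
  using zprime_cases[OF assms(1-4)] assms(5-7) by blast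

text \<open>A point where \<open>p\<close> is nonzero and one where \<open>q\<close> is nonzero are
  joined by a line inside \<open>L\<close>. On it both restrict to nonzero univariate polynomials,
  so their product is nonzero somewhere.\<close>

lemma zprime_if_lines:
  fixes L :: "('a \<Rightarrow> 'k::field) set"
  assumes inf: "infinite (UNIV :: 'k set)" and "L \<noteq> {}"
    and line: "\<And>u v \<tau>. u \<in> L \<Longrightarrow> v \<in> L \<Longrightarrow> (\<lambda>a. u a + \<tau> * (v a - u a)) \<in> L"
  shows "zprime L"
  unfolding zprime_def
proof (intro conjI ballI impI)
  fix p q :: "('a \<Rightarrow> 'k) \<Rightarrow> 'k"
  assume pq: "p \<in> polyfun" "q \<in> polyfun" and z: "\<forall>v\<in>L. p v * q v = 0"
  show "(\<forall>v\<in>L. p v = 0) \<or> (\<forall>v\<in>L. q v = 0)"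
  proof (rule ccontr)
    assume "\<not> ?thesis"
    then obtain u v where uv: "u \<in> L" "v \<in> L" "p u \<noteq> 0" "q v \<noteq> 0" by blast
    obtain P where P: "\<And>\<tau>. p (\<lambda>a. u a + \<tau> * (v a - u a)) = poly P \<tau>"
      using polyfun_on_line[OF pq(1), of u "\<lambda>a. v a - u a"] by auto
    obtain Q where Q: "\<And>\<tau>. q (\<lambda>a. u a + \<tau> * (v a - u a)) = poly Q \<tau>"
      using polyfun_on_line[OF pq(2), of u "\<lambda>a. v a - u a"] by auto
    have "P \<noteq> 0" using P[of 0] uv by auto
    moreover have "Q \<noteq> 0" using Q[of 1] uv by auto
    ultimately have "finite {\<tau>. poly (P * Q) \<tau> = 0}" by (intro poly_roots_finite) simp
    then obtain \<tau> where "poly (P * Q) \<tau> \<noteq> 0"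
      using inf by (metis (mono_tags, lifting) UNIV_eq_I mem_Collect_eq)
    then show False using z line[OF uv(1,2), of \<tau>] P[of \<tau>] Q[of \<tau>] by fastforce
  qed
qed fact

lemma zprime_csupp:
  assumes "infinite (UNIV :: 'k::field set)"
  shows "zprime (csupp B :: ('a \<Rightarrow> 'k) set)"
  by (rule zprime_if_lines[OF assms]) (auto simp: csupp_def)

text \<open>Multiplying both factors by \<open>q\<close> makes their product vanish on the whole of
  \<open>S\<close>; where \<open>q\<close> is nonzero it can be divided out again.\<close>

lemma zprime_open:
  fixes S :: "('a \<Rightarrow> 'k::field) set"
  assumes S: "zprime S" and q: "q \<in> polyfun" and "u \<in> S" "q u \<noteq> 0"
  shows "zprime {s \<in> S. q s \<noteq> 0}"
  unfolding zprime_def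
proof (intro conjI ballI impI)
  fix f g :: "('a \<Rightarrow> 'k) \<Rightarrow> 'k"
  assume fg: "f \<in> polyfun" "g \<in> polyfun" and z: "\<forall>v\<in>{s \<in> S. q s \<noteq> 0}. f v * g v = 0"
  have "(\<forall>v\<in>S. f v * q v = 0) \<or> (\<forall>v\<in>S. g v * q v = 0)"
    using z by (intro zprime_cases[OF S] polyfun_intros fg q) auto
  then show "(\<forall>v\<in>{s \<in> S. q s \<noteq> 0}. f v = 0) \<or> (\<forall>v\<in>{s \<in> S. q s \<noteq> 0}. g v = 0)" by auto
qed (use assms in auto)

text \<open>Pulling back and clearing denominators changes the two factors only by powers of
  \<open>q\<close>, which has no zero on \<open>S\<close>.\<close>

lemma zprime_rational_image:
  fixes S :: "('b \<Rightarrow> 'k::field) set" and P :: "'a \<Rightarrow> ('b \<Rightarrow> 'k) \<Rightarrow> 'k"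
  assumes S: "zprime S" and q: "q \<in> polyfun" "\<And>s. s \<in> S \<Longrightarrow> q s \<noteq> 0"
    and P: "\<And>a. P a \<in> polyfun"
  shows "zprime ((\<lambda>s a. P a s / q s) ` S)"
  unfolding zprime_def
proof (intro conjI ballI impI)
  fix f g :: "('a \<Rightarrow> 'k) \<Rightarrow> 'k"
  assume fg: "f \<in> polyfun" "g \<in> polyfun"
    and z: "\<forall>v\<in>(\<lambda>s a. P a s / q s) ` S. f v * g v = 0"
  obtain N f' where f': "f' \<in> polyfun" "\<forall>s. q s \<noteq> 0 \<longrightarrow> f' s = q s ^ N * f (\<lambda>a. P a s / q s)"
    using polyfun_clear_denominators[where P = P, OF fg(1) q(1) P] by (elim exE bexE) (rule that)
  obtain M g' where g': "g' \<in> polyfun" "\<forall>s. q s \<noteq> 0 \<longrightarrow> g' s = q s ^ M * g (\<lambda>a. P a s / q s)"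
    using polyfun_clear_denominators[where P = P, OF fg(2) q(1) P] by (elim exE bexE) (rule that)
  have "(\<forall>s\<in>S. f' s = 0) \<or> (\<forall>s\<in>S. g' s = 0)"
    using z f'(2) g'(2) q(2) by (intro zprime_cases[OF S] f'(1) g'(1)) auto
  then show "(\<forall>v\<in>(\<lambda>s a. P a s / q s) ` S. f v = 0) \<or> (\<forall>v\<in>(\<lambda>s a. P a s / q s) ` S. g v = 0)"
    using q(2) f'(2) g'(2) by auto
qed (use S in \<open>auto simp: zprime_def\<close>)

section \<open>Zariski closure and irreducibility\<close>

lemma zclosedI: "F \<subseteq> polyfun \<Longrightarrow> C = {v. \<forall>p\<in>F. p v = 0} \<Longrightarrow> zclosed C"
  unfolding zclosed_def by (intro exI conjI)

lemma zclosure_iff: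
  "v \<in> zclosure S \<longleftrightarrow> (\<forall>p\<in>polyfun. (\<forall>s\<in>S. p s = 0) \<longrightarrow> p v = 0)"
proof
  assume v: "v \<in> zclosure S"
  show "\<forall>p\<in>polyfun. (\<forall>s\<in>S. p s = 0) \<longrightarrow> p v = 0"
  proof (intro ballI impI)
    fix p :: "('a \<Rightarrow> 'b) \<Rightarrow> 'b" assume p: "p \<in> polyfun" "\<forall>s\<in>S. p s = 0"
    then have "zclosed {v. \<forall>r\<in>{p}. r v = 0}" "S \<subseteq> {v. \<forall>r\<in>{p}. r v = 0}"
      unfolding zclosed_def by (blast, auto)
    with v have "v \<in> {v. \<forall>r\<in>{p}. r v = 0}" unfolding zclosure_def by blast
    then show "p v = 0" by simp
  qed
next
  assume *: "\<forall>p\<in>polyfun. (\<forall>s\<in>S. p s = 0) \<longrightarrow> p v = 0"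
  show "v \<in> zclosure S"
    unfolding zclosure_def
  proof (rule InterI)
    fix C assume "C \<in> {C. zclosed C \<and> S \<subseteq> C}"
    then obtain F where "F \<subseteq> polyfun" "C = {v. \<forall>p\<in>F. p v = 0}" "S \<subseteq> C"
      unfolding zclosed_def by blast
    then show "v \<in> C" using * by blast
  qed
qed

lemma zclosed_zclosure: "zclosed (zclosure S)"
  by (rule zclosedI[of "{p \<in> polyfun. \<forall>s\<in>S. p s = 0}"]) (auto simp: zclosure_iff)

lemma zclosure_superset: "S \<subseteq> zclosure S"
  by (auto simp: zclosure_iff)

lemma zclosure_minimal: "zclosed C \<Longrightarrow> S \<subseteq> C \<Longrightarrow> zclosure S \<subseteq> C"
  unfolding zclosure_def by blast

lemma zclosure_subset_iff: "zclosure S \<subseteq> zclosure T \<longleftrightarrow> S \<subseteq> zclosure T"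
  using zclosure_superset zclosure_minimal zclosed_zclosure by blast

lemma zclosed_csupp: "zclosed (csupp I :: ('a \<Rightarrow> 'k::comm_ring_1) set)"
  by (rule zclosedI[of "(\<lambda>a v. v a) ` (- I)"]) (auto simp: csupp_def intro: polyfun_intros)

lemma zirreducible_zclosure:
  fixes S :: "('a \<Rightarrow> 'k::idom) set"
  assumes "zprime S" shows "zirreducible (zclosure S)"
  unfolding zirreducible_def
proof (intro conjI allI impI)
  show "zclosed (zclosure S)" by (rule zclosed_zclosure)
  show "zclosure S \<noteq> {}" using assms zclosure_superset[of S] by (auto simp: zprime_def)
next
  fix C1 C2 :: "('a \<Rightarrow> 'k) set"
  assume C: "zclosed C1 \<and> zclosed C2 \<and> zclosure S \<subseteq> C1 \<union> C2"
  then obtain F1 F2 where F: "F1 \<subseteq> polyfun" "C1 = {v. \<forall>p\<in>F1. p v = 0}"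
      "F2 \<subseteq> polyfun" "C2 = {v. \<forall>p\<in>F2. p v = 0}"
    unfolding zclosed_def by blast
  have "S \<subseteq> C1 \<or> S \<subseteq> C2"
  proof (rule ccontr)
    assume "\<not> ?thesis"
    then obtain p u q v where pq: "p \<in> F1" "u \<in> S" "p u \<noteq> 0" "q \<in> F2" "v \<in> S" "q v \<noteq> 0"
      using F by blast
    have "\<And>w. w \<in> S \<Longrightarrow> p w * q w = 0"
      using C zclosure_superset[of S] F pq by fastforce
    then have "p u = 0"
      using zprimeD[OF assms, of p q v u] pq F by blast
    then show False using pq by simp
  qed
  then show "zclosure S \<subseteq> C1 \<or> zclosure S \<subseteq> C2"
    using C zclosure_minimal by blast
qed

lemma zirreducible_zprime:
  fixes Z :: "('a \<Rightarrow> 'k::idom) set"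
  assumes "zirreducible Z" shows "zprime Z"
  unfolding zprime_def
proof (intro conjI ballI impI)
  show "Z \<noteq> {}" using assms by (simp add: zirreducible_def)
  fix p q :: "('a \<Rightarrow> 'k) \<Rightarrow> 'k"
  assume pq: "p \<in> polyfun" "q \<in> polyfun" and z: "\<forall>v\<in>Z. p v * q v = 0"
  have "zclosed {v. \<forall>r\<in>{p}. r v = 0}" "zclosed {v. \<forall>r\<in>{q}. r v = 0}"
    unfolding zclosed_def using pq by blast+
  moreover have "Z \<subseteq> {v. \<forall>r\<in>{p}. r v = 0} \<union> {v. \<forall>r\<in>{q}. r v = 0}" using z by auto
  ultimately have "Z \<subseteq> {v. \<forall>r\<in>{p}. r v = 0} \<or> Z \<subseteq> {v. \<forall>r\<in>{q}. r v = 0}"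
    using assms unfolding zirreducible_def by blast
  then show "(\<forall>v\<in>Z. p v = 0) \<or> (\<forall>v\<in>Z. q v = 0)" by auto
qed

text \<open>Algebraic independence of the restrictions of \<open>f 0, ..., f (m - 1)\<close> to
  \<open>Z\<close>. Relations are written out with all exponents below an arbitrary
  \<open>D\<close>; extensional exponent functions ensure that there are exactly D^m of
  them.\<close>

definition alg_indep_on :: "('a \<Rightarrow> 'k::comm_ring_1) set \<Rightarrow> (nat \<Rightarrow> ('a \<Rightarrow> 'k) \<Rightarrow> 'k) \<Rightarrow> nat \<Rightarrow> bool" where
  "alg_indep_on Z f m \<longleftrightarrow> (\<forall>D c.
     (\<forall>v\<in>Z. (\<Sum>e\<in>PiE {..<m} (\<lambda>_. {..<D::nat}). c e * (\<Prod>i<m. f i v ^ e i)) = 0) \<longrightarrow>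
     (\<forall>e\<in>PiE {..<m} (\<lambda>_. {..<D}). c e = 0))"

text \<open>In a polynomial relation between the \<open>f i\<close> and \<open>g\<close>, a power of \<open>g\<close> can be cancelled on \<open>Z'\<close>,
  after which the restriction to \<open>Z\<close> is a relation between the \<open>f i\<close> alone.\<close>

lemma alg_indep_on_extend:
  fixes Z Z' :: "('a \<Rightarrow> 'k::idom) set"
  assumes indep: "alg_indep_on Z f m" and prime: "zprime Z'" and sub: "Z \<subseteq> Z'"
    and f: "\<And>i. f i \<in> polyfun" and g: "g \<in> polyfun" "\<And>v. v \<in> Z \<Longrightarrow> g v = 0"
    and u: "u \<in> Z'" "g u \<noteq> 0"
  shows "alg_indep_on Z' (f(m := g)) (Suc m)"
  unfolding alg_indep_on_def
proof (intro allI impI)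
  fix D :: nat and c :: "(nat \<Rightarrow> nat) \<Rightarrow> 'k"
  let ?E = "PiE {..<m} (\<lambda>_. {..<D})" and ?E' = "PiE {..<Suc m} (\<lambda>_. {..<D})"
  assume rel: "\<forall>v\<in>Z'. (\<Sum>e\<in>?E'. c e * (\<Prod>i<Suc m. (f(m := g)) i v ^ e i)) = 0"
  have E': "?E' = (\<lambda>(y, e). e(m := y)) ` ({..<D} \<times> ?E)"
    unfolding lessThan_Suc by (rule PiE_insert_eq)
  have inj: "inj_on (\<lambda>(y, e). e(m := y)) ({..<D} \<times> ?E)"
    by (rule inj_combinator) simp
  \<comment> \<open>The coefficient of \<open>g ^ j\<close> when the relation is read as a
    polynomial in \<open>g\<close>.\<close>
  define A where "A j v = (\<Sum>e\<in>?E. c (e(m := j)) * (\<Prod>i<m. f i v ^ e i))" for j v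
  have A: "A j \<in> polyfun" for j
    unfolding A_def by (auto intro!: polyfun_intros f)
  have rel': "(\<Sum>j<D. A j v * g v ^ j) = 0" if "v \<in> Z'" for v
  proof -
    have "0 = (\<Sum>e\<in>?E'. c e * (\<Prod>i<Suc m. (f(m := g)) i v ^ e i))" using rel that by simp
    also have "\<dots> = (\<Sum>(j, e)\<in>{..<D} \<times> ?E. c (e(m := j)) * (\<Prod>i<Suc m. (f(m := g)) i v ^ (e(m := j)) i))"
      unfolding E' by (subst sum.reindex[OF inj]) (simp add: case_prod_unfold)
    also have "\<dots> = (\<Sum>j<D. \<Sum>e\<in>?E. c (e(m := j)) * (\<Prod>i<Suc m. (f(m := g)) i v ^ (e(m := j)) i))"
      by (simp add: sum.cartesian_product)
    also have "\<dots> = (\<Sum>j<D. A j v * g v ^ j)"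
      by (simp add: A_def sum_distrib_left sum_distrib_right mult.assoc)
    finally show ?thesis by simp
  qed
  have zero: "\<forall>e\<in>?E. c (e(m := j)) = 0" if "j < D" for j
    using that
  proof (induction j rule: less_induct)
    case (less j)
    \<comment> \<open>With the coefficients below \<open>j\<close> already zero, \<open>Q\<close> is
      the relation divided by \<open>g ^ j\<close>.\<close>
    define Q where "Q v = (\<Sum>i<D - j. A (j + i) v * g v ^ i)" for v
    have Q: "Q \<in> polyfun" unfolding Q_def by (auto intro!: polyfun_intros A g)
    have "Q v * g v ^ j = 0" if v: "v \<in> Z'" for v
    proof -
      have "(\<Sum>i<D. A i v * g v ^ i) = (\<Sum>i<j. A i v * g v ^ i) + (\<Sum>i=j..<D. A i v * g v ^ i)"
        using less.prems by (simp add: lessThan_atLeast0 sum.atLeastLessThan_concat)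
      also have "(\<Sum>i<j. A i v * g v ^ i) = 0"
        using less by (intro sum.neutral) (auto simp: A_def simp del: fun_upd_apply)
      also have "(\<Sum>i=j..<D. A i v * g v ^ i) = (\<Sum>i<D - j. A (j + i) v * g v ^ (j + i))"
        by (subst sum.atLeastLessThan_shift_0) (simp add: lessThan_atLeast0)
      also have "\<dots> = Q v * g v ^ j"
        unfolding Q_def sum_distrib_right by (simp add: power_add mult_ac)
      finally show ?thesis using rel'[OF v] by simp
    qed
    then have "Q v = 0" if "v \<in> Z'" for v
      using zprimeD[OF prime Q polyfun_power[OF g(1), of j] _ u(1) _ that] u by simp
    then have "A j v = 0" if "v \<in> Z" for v
    proof -
      have "0 = Q v" using \<open>\<And>v. v \<in> Z' \<Longrightarrow> Q v = 0\<close> that sub by auto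
      \<comment> \<open>On \<open>Z\<close> the function \<open>g\<close> is zero, so only the
        summand with \<open>g ^ 0\<close> survives.\<close>
      also have "Q v = (\<Sum>i<D - j. if i = 0 then A j v else 0)"
        unfolding Q_def using g(2)[OF that] by (intro sum.cong) auto
      also have "\<dots> = A j v" using less.prems by simp
      finally show ?thesis by simp
    qed
    then show ?case
      using indep[unfolded alg_indep_on_def, THEN spec[of _ D], THEN spec[of _ "\<lambda>e. c (e(m := j))"]]
      unfolding A_def by blast
  qed
  show "\<forall>e\<in>?E'. c e = 0"
    unfolding E' using zero by (auto simp del: fun_upd_apply)
qed

text \<open>Each strict inclusion contributes one function: a defining equation of the smaller set
  that is nonzero somewhere on the larger one.\<close>

lemma alg_indep_of_chain:
  fixes Z :: "nat \<Rightarrow> ('a \<Rightarrow> 'k::idom) set"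
  assumes "\<forall>i\<le>m. zirreducible (Z i)" "\<forall>i<m. Z i \<subset> Z (Suc i)"
  shows "\<exists>f. (\<forall>i. f i \<in> polyfun) \<and> alg_indep_on (Z m) f m"
  using assms
proof (induction m)
  case 0
  then have "Z 0 \<noteq> {}" by (simp add: zirreducible_def)
  then have "alg_indep_on (Z 0) (\<lambda>_ _. 0) 0" by (auto simp: alg_indep_on_def)
  then show ?case by (intro exI[of _ "\<lambda>_ _. 0"]) (auto intro: polyfun_intros)
next
  case (Suc m)
  then obtain f where f: "\<And>i. f i \<in> polyfun" "alg_indep_on (Z m) f m" by auto
  obtain F where F: "F \<subseteq> polyfun" "Z m = {v. \<forall>p\<in>F. p v = 0}"
    using Suc.prems(1)[rule_format, of m] unfolding zirreducible_def zclosed_def by auto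
  have sub: "Z m \<subset> Z (Suc m)" using Suc.prems(2) by simp
  then obtain u where "u \<in> Z (Suc m)" "u \<notin> Z m" by blast
  then obtain g where g: "g \<in> F" "g u \<noteq> 0" using F by blast
  have "alg_indep_on (Z (Suc m)) (f(m := g)) (Suc m)"
    using F g sub f \<open>u \<in> Z (Suc m)\<close> Suc.prems(1)
    by (intro alg_indep_on_extend[where Z = "Z m" and u = u] zirreducible_zprime) auto
  moreover have "\<forall>i. (f(m := g)) i \<in> polyfun" using f(1) F g(1) by auto
  ultimately show ?case by blast
qed

section \<open>Dimension of rationally parametrised sets\<close>

lemma exponent_le_if_power_growth:
  fixes c m r :: nat
  assumes "\<And>D. D ^ m \<le> (c * D + 1) ^ r"
  shows "m \<le> r"
proof (rule ccontr)
  assume "\<not> m \<le> r"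
  then have m: "Suc r \<le> m" by simp
  \<comment> \<open>Just above \<open>(c + 1) ^ r\<close>, the bound on \<open>D\<close> that
    remains after cancelling \<open>D ^ r\<close>.\<close>
  define D where "D = (c + 1) ^ r + 1"
  have D: "0 < D" by (simp add: D_def)
  have "D * D ^ r \<le> D ^ m" using power_increasing[OF m, of D] D by simp
  also have "\<dots> \<le> (c * D + 1) ^ r" by (rule assms)
  also have "\<dots> \<le> ((c + 1) * D) ^ r" using D by (intro power_mono) auto
  also have "\<dots> = (c + 1) ^ r * D ^ r" by (rule power_mult_distrib)
  finally have "D \<le> (c + 1) ^ r" using D by simp
  then show False by (simp add: D_def)
qed

section \<open>Counting monomials of bounded degree in each variable\<close>

definition box_monomials :: "'b set \<Rightarrow> nat \<Rightarrow> (('b \<Rightarrow> 'k::field) \<Rightarrow> 'k) set" where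
  "box_monomials B c = (\<lambda>e s. \<Prod>b\<in>B. s b ^ e b) ` PiE B (\<lambda>_. {..c})"

text \<open>Bounding the degree in each variable separately leaves at most (c + 1)^|B| monomials and
  makes the bounds additive under products. Agreement is asked on \<open>csupp B\<close> only:
  coordinates outside \<open>B\<close> are zero there, so every polynomial function becomes one in
  the variables of \<open>B\<close>.\<close>

definition box_poly :: "'b set \<Rightarrow> nat \<Rightarrow> (('b \<Rightarrow> 'k::field) \<Rightarrow> 'k) \<Rightarrow> bool" where
  "box_poly B c p \<longleftrightarrow> (\<exists>p'\<in>fvs.span (box_monomials B c). \<forall>s\<in>csupp B. p s = p' s)"

lemma finite_box_monomials: "finite B \<Longrightarrow> finite (box_monomials B c)"
  by (simp add: box_monomials_def finite_PiE)

lemma card_box_monomials: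
  assumes "finite B"
  shows "card (box_monomials B c :: (('b \<Rightarrow> 'k::field) \<Rightarrow> 'k) set) \<le> (c + 1) ^ card B"
proof -
  have "card (box_monomials B c :: (('b \<Rightarrow> 'k) \<Rightarrow> 'k) set) \<le> card (PiE B (\<lambda>_. {..c}))"
    unfolding box_monomials_def using assms by (intro card_image_le finite_PiE) auto
  also have "\<dots> = (c + 1) ^ card B" using assms by (simp add: card_PiE)
  finally show ?thesis .
qed

lemma box_poly_mono:
  assumes "box_poly B c p" "c \<le> c'" shows "box_poly B c' p"
proof -
  have "box_monomials B c \<subseteq> (box_monomials B c' :: (('a \<Rightarrow> 'b) \<Rightarrow> 'b) set)"
    unfolding box_monomials_def using assms(2) by (intro image_mono PiE_mono) auto
  then show ?thesis using assms(1) fvs.span_mono unfolding box_poly_def by blast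
qed

lemma box_poly_const: "box_poly B c (\<lambda>_. a)"
proof -
  have "(\<lambda>s. \<Prod>b\<in>B. s b ^ (\<lambda>b\<in>B. 0) b) \<in> (box_monomials B c :: (('a \<Rightarrow> 'b) \<Rightarrow> 'b) set)"
    unfolding box_monomials_def by (intro imageI) auto
  also have "(\<lambda>s. \<Prod>b\<in>B. s b ^ (\<lambda>b\<in>B. 0) b) = (\<lambda>s :: 'a \<Rightarrow> 'b. 1)" by (auto simp: fun_eq_iff)
  finally have "fscale a (\<lambda>s. 1) \<in> fvs.span (box_monomials B c :: (('a \<Rightarrow> 'b) \<Rightarrow> 'b) set)"
    by (intro fvs.span_scale fvs.span_base)
  then show ?thesis unfolding box_poly_def by (intro bexI) (auto simp: fscale_def)
qed

lemma box_poly_coord: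
  assumes "finite B" shows "box_poly B 1 (\<lambda>s. s a)"
proof (cases "a \<in> B")
  case False
  then show ?thesis using box_poly_const[of B 1 0] by (auto simp: box_poly_def csupp_def)
next
  case True
  have "(\<lambda>s. \<Prod>b\<in>B. s b ^ (\<lambda>b\<in>B. if b = a then 1 else 0) b) \<in> (box_monomials B 1 :: (('a \<Rightarrow> 'b) \<Rightarrow> 'b) set)"
    unfolding box_monomials_def by (intro imageI) auto
  also have "(\<lambda>s. \<Prod>b\<in>B. s b ^ (\<lambda>b\<in>B. if b = a then 1 else 0) b) = (\<lambda>s :: 'a \<Rightarrow> 'b. s a)"
  proof
    fix s :: "'a \<Rightarrow> 'b"
    have "(\<Prod>b\<in>B. s b ^ (\<lambda>b\<in>B. if b = a then 1 else 0) b) = (\<Prod>b\<in>B. if b = a then s b else 1)"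
      by (intro prod.cong) auto
    then show "(\<Prod>b\<in>B. s b ^ (\<lambda>b\<in>B. if b = a then 1 else 0) b) = s a" using True assms by simp
  qed
  finally show ?thesis unfolding box_poly_def by (intro bexI fvs.span_base) auto
qed

lemma box_poly_add:
  assumes "box_poly B c p" "box_poly B c q" shows "box_poly B c (\<lambda>s. p s + q s)"
proof -
  obtain p' q' where "p' \<in> fvs.span (box_monomials B c)" "\<forall>s\<in>csupp B. p s = p' s"
    "q' \<in> fvs.span (box_monomials B c)" "\<forall>s\<in>csupp B. q s = q' s"
    using assms unfolding box_poly_def by (elim bexE) (rule that)
  then show ?thesis
    unfolding box_poly_def by (intro bexI[of _ "p' + q'"] fvs.span_add) auto
qed

text \<open>Allows span induction in one factor of a product while the other is fixed; using it for
  each factor in turn gives \<open>span_times_span\<close>.\<close>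

lemma subspace_times_in_span:
  "fvs.subspace {p :: 'a \<Rightarrow> 'k::field. (\<lambda>s. p s * q s) \<in> fvs.span T}"
proof (rule fvs.subspaceI)
  have "(\<lambda>s. (0::'a \<Rightarrow> 'k) s * q s) = 0" by auto
  then show "0 \<in> {p :: 'a \<Rightarrow> 'k. (\<lambda>s. p s * q s) \<in> fvs.span T}"
    by (simp only: mem_Collect_eq fvs.span_zero)
next
  fix x y :: "'a \<Rightarrow> 'k"
  assume xy: "x \<in> {p. (\<lambda>s. p s * q s) \<in> fvs.span T}" "y \<in> {p. (\<lambda>s. p s * q s) \<in> fvs.span T}"
  have "(\<lambda>s. (x + y) s * q s) = (\<lambda>s. x s * q s) + (\<lambda>s. y s * q s)"
    by (auto simp: algebra_simps)
  then show "x + y \<in> {p. (\<lambda>s. p s * q s) \<in> fvs.span T}" using xy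
    by (simp only: mem_Collect_eq fvs.span_add)
next
  fix c :: 'k and x :: "'a \<Rightarrow> 'k"
  assume x: "x \<in> {p. (\<lambda>s. p s * q s) \<in> fvs.span T}"
  have "(\<lambda>s. fscale c x s * q s) = fscale c (\<lambda>s. x s * q s)"
    by (auto simp: fscale_def)
  then show "fscale c x \<in> {p. (\<lambda>s. p s * q s) \<in> fvs.span T}" using x
    by (simp only: mem_Collect_eq fvs.span_scale)
qed

lemma span_times_span:
  fixes p q :: "'a \<Rightarrow> 'k::field"
  assumes p: "p \<in> fvs.span S" and q: "q \<in> fvs.span S'"
    and ST: "\<And>x y. x \<in> S \<Longrightarrow> y \<in> S' \<Longrightarrow> (\<lambda>s. x s * y s) \<in> fvs.span T"
  shows "(\<lambda>s. p s * q s) \<in> fvs.span T"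
proof -
  have 1: "(\<lambda>s. q s * x s) \<in> fvs.span T" if "x \<in> S" for x
    using q subspace_times_in_span
  proof (rule fvs.span_induct)
    fix y assume "y \<in> S'"
    moreover have "(\<lambda>s. y s * x s) = (\<lambda>s. x s * y s)" by (simp add: mult.commute)
    ultimately show "(\<lambda>s. y s * x s) \<in> fvs.span T" using ST[OF that] by metis
  qed
  show ?thesis
    using p subspace_times_in_span
  proof (rule fvs.span_induct)
    fix x assume "x \<in> S"
    moreover have "(\<lambda>s. x s * q s) = (\<lambda>s. q s * x s)" by (simp add: mult.commute)
    ultimately show "(\<lambda>s. x s * q s) \<in> fvs.span T" using 1 by metis
  qed
qed

lemma box_poly_mult:
  fixes p q :: "('b \<Rightarrow> 'k::field) \<Rightarrow> 'k"
  assumes "box_poly B c p" "box_poly B c' q" shows "box_poly B (c + c') (\<lambda>s. p s * q s)"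
proof -
  obtain p' q' where pq: "p' \<in> fvs.span (box_monomials B c)" "\<forall>s\<in>csupp B. p s = p' s"
    "q' \<in> fvs.span (box_monomials B c')" "\<forall>s\<in>csupp B. q s = q' s"
    using assms unfolding box_poly_def by (elim bexE) (rule that)
  have "(\<lambda>s. p' s * q' s) \<in> fvs.span (box_monomials B (c + c'))"
    using pq(1,3)
  proof (rule span_times_span)
    fix x y :: "('b \<Rightarrow> 'k) \<Rightarrow> 'k"
    assume "x \<in> box_monomials B c" "y \<in> box_monomials B c'"
    then obtain e e' where e: "e \<in> PiE B (\<lambda>_. {..c})" "x = (\<lambda>s. \<Prod>b\<in>B. s b ^ e b)"
      and e': "e' \<in> PiE B (\<lambda>_. {..c'})" "y = (\<lambda>s. \<Prod>b\<in>B. s b ^ e' b)"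
      unfolding box_monomials_def by (elim imageE) (rule that)
    have "(\<lambda>b\<in>B. e b + e' b) \<in> PiE B (\<lambda>_. {..c + c'})"
      using e(1) e'(1) by (auto simp: PiE_iff intro!: add_mono)
    moreover have "(\<lambda>s. x s * y s) = (\<lambda>s. \<Prod>b\<in>B. s b ^ (\<lambda>b\<in>B. e b + e' b) b)"
      unfolding e(2) e'(2) by (auto simp: fun_eq_iff power_add prod.distrib)
    ultimately show "(\<lambda>s. x s * y s) \<in> fvs.span (box_monomials B (c + c'))"
      unfolding box_monomials_def by (intro fvs.span_base image_eqI)
  qed
  then show ?thesis unfolding box_poly_def by (rule bexI[rotated]) (use pq in auto)
qed

lemma box_poly_power:
  assumes "box_poly B c p" shows "box_poly B (c * n) (\<lambda>s. p s ^ n)"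
proof (induction n)
  case 0
  show ?case using box_poly_const[of B 0 1] by simp
next
  case (Suc n)
  show ?case using box_poly_mult[OF assms Suc] by simp
qed

lemma box_poly_prod:
  assumes "finite I" "\<And>i. i \<in> I \<Longrightarrow> box_poly B c (p i)"
  shows "box_poly B (card I * c) (\<lambda>s. \<Prod>i\<in>I. p i s)"
  using assms
proof (induction I)
  case empty
  show ?case using box_poly_const[of B 0 1] by simp
next
  case (insert i I)
  have "box_poly B (c + card I * c) (\<lambda>s. p i s * (\<Prod>i\<in>I. p i s))"
    using insert by (intro box_poly_mult) auto
  then show ?case using insert.hyps by simp
qed

lemma polyfun_box_poly:
  assumes "p \<in> polyfun" "finite B" shows "\<exists>c. box_poly B c p"
  using assms(1)
proof induction
  case (pf_const c)
  show ?case using box_poly_const by blast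
next
  case (pf_coord a)
  show ?case using box_poly_coord[OF assms(2)] by blast
next
  case (pf_add p q)
  then obtain c c' where "box_poly B c p" "box_poly B c' q" by blast
  then have "box_poly B (c + c') p" "box_poly B (c + c') q"
    by (auto elim: box_poly_mono)
  then show ?case using box_poly_add by blast
next
  case (pf_mult p q)
  then show ?case using box_poly_mult by blast
qed

text \<open>An independent family is no larger than a spanning set of monomials. The hypothesis
  speaks of a family and \<open>fvs.independent\<close> of a set, so injectivity of the family is
  derived first.\<close>

lemma card_le_if_box_poly_indep:
  fixes H :: "'i \<Rightarrow> ('b \<Rightarrow> 'k::field) \<Rightarrow> 'k"
  assumes finB: "finite B" and finI: "finite I" and H: "\<And>i. i \<in> I \<Longrightarrow> box_poly B c (H i)"
    and indep: "\<And>u. (\<And>s. s \<in> csupp B \<Longrightarrow> (\<Sum>i\<in>I. u i * H i s) = 0) \<Longrightarrow> \<forall>i\<in>I. u i = 0"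
  shows "card I \<le> (c + 1) ^ card B"
proof -
  have "\<forall>i\<in>I. \<exists>p'\<in>fvs.span (box_monomials B c). \<forall>s\<in>csupp B. H i s = p' s"
    using H unfolding box_poly_def by blast
  then obtain G where G: "\<And>i. i \<in> I \<Longrightarrow> G i \<in> fvs.span (box_monomials B c)"
    "\<And>i s. i \<in> I \<Longrightarrow> s \<in> csupp B \<Longrightarrow> H i s = G i s"
    by (metis (no_types, lifting))
  have indep': "\<forall>i\<in>I. u i = 0" if "(\<Sum>i\<in>I. fscale (u i) (G i)) = 0" for u
  proof (rule indep)
    fix s :: "'b \<Rightarrow> 'k" assume "s \<in> csupp B"
    then have "(\<Sum>i\<in>I. u i * H i s) = (\<Sum>i\<in>I. fscale (u i) (G i)) s"
      by (simp add: sum_fun_eval fscale_def G(2))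
    then show "(\<Sum>i\<in>I. u i * H i s) = 0" using that by simp
  qed
  have inj: "inj_on G I"
  proof (rule inj_onI, rule ccontr)
    fix i j assume ij: "i \<in> I" "j \<in> I" "G i = G j" "i \<noteq> j"
    let ?u = "\<lambda>k. (if k = i then 1 else 0) - (if k = j then 1 else 0 :: 'k)"
    have "(\<Sum>k\<in>I. fscale (?u k) (G k)) =
        (\<Sum>k\<in>I. (if k = i then G i else 0) - (if k = j then G j else 0))"
      by (intro sum.cong) (auto simp: fscale_def fun_eq_iff)
    also have "\<dots> = 0" using ij finI by (simp add: sum_subtractf)
    finally have "?u i = 0" using indep'[of ?u] ij by blast
    then show False using ij by simp
  qed
  have "fvs.independent (G ` I)"
    unfolding fvs.dependent_finite[OF finite_imageI[OF finI]]
  proof (rule notI, elim exE conjE bexE)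
    fix u v assume v: "v \<in> G ` I" "u v \<noteq> 0" and "(\<Sum>v\<in>G ` I. fscale (u v) v) = 0"
    then have "(\<Sum>i\<in>I. fscale (u (G i)) (G i)) = 0" by (simp add: sum.reindex[OF inj])
    then have "\<forall>i\<in>I. u (G i) = 0" by (rule indep')
    then show False using v by auto
  qed
  then have "card (G ` I) \<le> card (box_monomials B c :: (('b \<Rightarrow> 'k) \<Rightarrow> 'k) set)"
    using G(1) finB by (intro fvs.independent_span_bound[THEN conjunct2] finite_box_monomials) auto
  also have "\<dots> \<le> (c + 1) ^ card B" by (rule card_box_monomials[OF finB])
  finally show ?thesis by (simp add: card_image[OF inj])
qed

text \<open>The D^m monomials in the \<open>f i\<close> with exponents below \<open>D\<close> are
  pulled back along \<open>P / q\<close> and cleared of denominators. They become linearly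
  independent polynomials in the variables of \<open>B\<close>, of degree at most
  \<open>m * (C * D)\<close> in each, and letting \<open>D\<close> grow forces
  \<open>m <= card B\<close>. The hypothesis \<open>dense\<close> carries a relation from the image
  over to \<open>Z\<close>.\<close>

lemma card_bound_if_alg_indep:
  fixes P :: "'a \<Rightarrow> ('b \<Rightarrow> 'k::field) \<Rightarrow> 'k"
  assumes finB: "finite B" and q: "q \<in> polyfun" and P: "\<And>a. P a \<in> polyfun"
    and f: "\<And>i. f i \<in> polyfun" and indep: "alg_indep_on Z f m"
    and dense: "\<And>p y. p \<in> polyfun \<Longrightarrow>
      (\<And>s. s \<in> csupp B \<Longrightarrow> q s \<noteq> 0 \<Longrightarrow> p (\<lambda>a. P a s / q s) = 0) \<Longrightarrow> y \<in> Z \<Longrightarrow> p y = 0"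
  shows "m \<le> card B"
proof -
  have "\<forall>i. \<exists>N. \<exists>f'\<in>polyfun. \<forall>s. q s \<noteq> 0 \<longrightarrow> f' s = q s ^ N * f i (\<lambda>a. P a s / q s)"
    by (intro allI polyfun_clear_denominators f q P)
  from choice[OF this] obtain N where
    N: "\<forall>i. \<exists>f'\<in>polyfun. \<forall>s. q s \<noteq> 0 \<longrightarrow> f' s = q s ^ N i * f i (\<lambda>a. P a s / q s)"
    by (elim exE) (rule that)
  from choice[OF this[unfolded Bex_def]] obtain f' where
    "\<forall>i. f' i \<in> polyfun \<and> (\<forall>s. q s \<noteq> 0 \<longrightarrow> f' i s = q s ^ N i * f i (\<lambda>a. P a s / q s))"
    by (elim exE) (rule that)
  then have f': "\<And>i. f' i \<in> polyfun"
    "\<And>i s. q s \<noteq> 0 \<Longrightarrow> f' i s = q s ^ N i * f i (\<lambda>a. P a s / q s)"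
    by auto
  define M where "M = (\<Sum>i<m. N i)"
  have NM: "N i \<le> M" if "i < m" for i
    unfolding M_def using that by (intro member_le_sum) auto
  \<comment> \<open>The extra power of \<open>q\<close> raises the individual exponents
    \<open>N i\<close> to the common exponent \<open>M\<close>.\<close>
  define G where "G i s = q s ^ (M - N i) * f' i s" for i s
  have G: "G i s = q s ^ M * f i (\<lambda>a. P a s / q s)" if "q s \<noteq> 0" "i < m" for i s
    using that NM[OF that(2)] by (simp add: G_def f'(2) mult.assoc[symmetric] power_add[symmetric])
  have "\<forall>i. \<exists>c. box_poly B c (G i)"
    unfolding G_def by (intro allI polyfun_box_poly[OF _ finB] polyfun_intros q f')
  then obtain c where c: "\<And>i. box_poly B (c i) (G i)" by metis
  obtain c' where c': "box_poly B c' (\<lambda>s. q s ^ M)"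
    using polyfun_box_poly[OF polyfun_power[OF q] finB] by blast
  define C where "C = c' + (\<Sum>i<m. c i)"
  have "c i \<le> C" if "i < m" for i
    unfolding C_def using that by (intro trans_le_add2 member_le_sum) auto
  then have cG: "box_poly B C (G i)" if "i < m" for i
    using that c box_poly_mono by blast
  have cq: "box_poly B C (\<lambda>s. q s ^ M)"
    using c' box_poly_mono[of B c' _ C] by (auto simp: C_def)
  show ?thesis
  proof (rule exponent_le_if_power_growth)
    fix D :: nat
    let ?E = "PiE {..<m} (\<lambda>_. {..<D})"
    \<comment> \<open>Padding with powers of \<open>q s ^ M\<close> gives every monomial the same
      denominator \<open>(q s ^ (M * D)) ^ m\<close>, so a relation between the \<open>H e\<close>
      is one between the monomials in the \<open>f i\<close>.\<close>
    define H where "H e s = (\<Prod>i<m. G i s ^ e i * (q s ^ M) ^ (D - e i))" for e s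
    have "card ?E \<le> (m * (C * D) + 1) ^ card B"
    proof (rule card_le_if_box_poly_indep[OF finB, where H = H])
      show "finite ?E" by (auto intro: finite_PiE)
    next
      fix e assume e: "e \<in> ?E"
      have "box_poly B (card {..<m} * (C * D)) (H e)"
        unfolding H_def
      proof (rule box_poly_prod)
        fix i assume i: "i \<in> {..<m}"
        then have "e i \<le> D" using PiE_mem[OF e i] by simp
        have "box_poly B (C * e i + C * (D - e i)) (\<lambda>s. G i s ^ e i * (q s ^ M) ^ (D - e i))"
          using i by (intro box_poly_mult box_poly_power cG cq) auto
        then show "box_poly B (C * D) (\<lambda>s. G i s ^ e i * (q s ^ M) ^ (D - e i))"
          using \<open>e i \<le> D\<close> by (simp add: distrib_left[symmetric])
      qed simp
      then show "box_poly B (m * (C * D)) (H e)" by simp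
    next
      fix u assume u: "\<And>s. s \<in> csupp B \<Longrightarrow> (\<Sum>e\<in>?E. u e * H e s) = 0"
      define p where "p v = (\<Sum>e\<in>?E. u e * (\<Prod>i<m. f i v ^ e i))" for v
      have "p \<in> polyfun" unfolding p_def by (auto intro!: polyfun_intros f)
      moreover have "p (\<lambda>a. P a s / q s) = 0" if s: "s \<in> csupp B" "q s \<noteq> 0" for s
      proof -
        have "H e s = (\<Prod>i<m. f i (\<lambda>a. P a s / q s) ^ e i) * (q s ^ (M * D)) ^ m" if e: "e \<in> ?E" for e
        proof -
          have "G i s ^ e i * (q s ^ M) ^ (D - e i) = f i (\<lambda>a. P a s / q s) ^ e i * q s ^ (M * D)"
            if i: "i < m" for i
          proof -
            have "e i \<le> D" using PiE_mem[OF e, of i] i by simp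
            then have "(q s ^ M) ^ e i * (q s ^ M) ^ (D - e i) = q s ^ (M * D)"
              by (simp add: power_add[symmetric] power_mult[symmetric] distrib_left[symmetric])
            then show ?thesis using G[OF s(2) i] by (simp add: power_mult_distrib)
          qed
          then show ?thesis by (simp add: H_def prod.distrib)
        qed
        then have "p (\<lambda>a. P a s / q s) * (q s ^ (M * D)) ^ m = (\<Sum>e\<in>?E. u e * H e s)"
          unfolding p_def sum_distrib_right by (intro sum.cong) auto
        then show ?thesis using u[OF s(1)] s(2) by simp
      qed
      ultimately have "\<forall>v\<in>Z. p v = 0" using dense by blast
      then show "\<forall>e\<in>?E. u e = 0"
        using indep[unfolded alg_indep_on_def, THEN spec[of _ D], THEN spec[of _ u]]
        unfolding p_def by blast
    qed
    then show "D ^ m \<le> (m * C * D + 1) ^ card B"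
      by (simp add: card_PiE mult.assoc)
  qed
qed

section \<open>Dimension through chains\<close>

lemma zdim_eqI:
  fixes X :: "('a \<Rightarrow> 'k::comm_ring_1) set"
  assumes "\<And>m Z. \<forall>i\<le>m. zirreducible (Z i) \<Longrightarrow> \<forall>i<m. Z i \<subset> Z (Suc i) \<Longrightarrow>
      Z m \<subseteq> zclosure X \<Longrightarrow> m \<le> r"
    and "\<forall>i\<le>r. zirreducible (Z i)" "\<forall>i<r. Z i \<subset> Z (Suc i)" "Z r \<subseteq> zclosure X"
  shows "zdim X = enat r"
  unfolding zdim_def
proof (rule antisym)
  show "Sup {enat m |m. \<exists>Z. (\<forall>i\<le>m. zirreducible (Z i)) \<and> (\<forall>i<m. Z i \<subset> Z (Suc i)) \<and> Z m \<subseteq> zclosure X} \<le> enat r"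
    using assms(1) by (intro Sup_least) auto
  show "enat r \<le> Sup {enat m |m. \<exists>Z. (\<forall>i\<le>m. zirreducible (Z i)) \<and> (\<forall>i<m. Z i \<subset> Z (Suc i)) \<and> Z m \<subseteq> zclosure X}"
    using assms(2-4) by (intro Sup_upper) auto
qed

text \<open>Any chain inside the closure of \<open>X\<close> can be prolonged by \<open>Y\<close>
  itself.\<close>

lemma zdim_less_if_not_dense:
  fixes X Y :: "('a \<Rightarrow> 'k::idom) set"
  assumes Y: "zirreducible Y" and X: "zprime X" "X \<subseteq> Y" and dim: "zdim Y = enat n"
    and nd: "\<not> Y \<subseteq> zclosure X"
  shows "zdim X < enat n"
proof -
  have sub: "zclosure X \<subset> Y"
    using zclosure_minimal[OF _ X(2)] Y nd by (auto simp: zirreducible_def)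
  have bound: "Suc m \<le> n" if Z: "\<forall>i\<le>m. zirreducible (Z i)" "\<forall>i<m. Z i \<subset> Z (Suc i)" "Z m \<subseteq> zclosure X" for m Z
  proof -
    let ?Z = "Z(Suc m := Y)"
    have "\<forall>i\<le>Suc m. zirreducible (?Z i)" using Z(1) Y by auto
    moreover have "\<forall>i<Suc m. ?Z i \<subset> ?Z (Suc i)" using Z(2,3) sub by (auto simp: less_Suc_eq)
    moreover have "?Z (Suc m) \<subseteq> zclosure Y" using zclosure_superset by simp
    ultimately have "enat (Suc m) \<le> zdim Y" unfolding zdim_def by (intro Sup_upper) blast
    then show ?thesis by (simp add: dim)
  qed
  \<comment> \<open>The one-member chain consisting of the closure of \<open>X\<close> forces
    \<open>n\<close> to be positive, so that \<open>n - 1\<close> below is not truncated.\<close>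
  have "Suc 0 \<le> n"
    using bound[of 0 "\<lambda>_. zclosure X"] zirreducible_zclosure[OF X(1)] by simp
  moreover have "zdim X \<le> enat (n - 1)"
    unfolding zdim_def
  proof (rule Sup_least, clarify)
    fix m Z assume "\<forall>i\<le>m. zirreducible (Z i)" "\<forall>i<m. Z i \<subset> Z (Suc i)" "Z m \<subseteq> zclosure X"
    from bound[OF this] show "enat m \<le> enat (n - 1)" by simp
  qed
  ultimately show ?thesis using le_less_trans[of "zdim X" "enat (n - 1)" "enat n"] by simp
qed

text \<open>\<open>P / q\<close> maps affine space on \<open>B\<close> densely into
  \<open>X\<close>, and \<open>R b / w\<close> recovers the coordinate \<open>s b\<close>. By
  \<open>base\<close> the denominators are nonzero at the origin; as the origin lies in every
  coordinate subspace, they can be cancelled on each of them.\<close>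

theorem zdim_rational:
  fixes X :: "('a \<Rightarrow> 'k::field) set" and B :: "'b set" and P :: "'a \<Rightarrow> ('b \<Rightarrow> 'k) \<Rightarrow> 'k"
    and q :: "('b \<Rightarrow> 'k) \<Rightarrow> 'k"
  defines "\<phi> \<equiv> (\<lambda>s a. P a s / q s)"
  assumes inf: "infinite (UNIV :: 'k set)" and finB: "finite B"
    and q: "q \<in> polyfun" and P: "\<And>a. P a \<in> polyfun"
    and w: "w \<in> polyfun" and R: "\<And>b. b \<in> B \<Longrightarrow> R b \<in> polyfun"
    and sub: "\<And>s. s \<in> csupp B \<Longrightarrow> q s \<noteq> 0 \<Longrightarrow> \<phi> s \<in> X"
    and dense: "\<And>p y. p \<in> polyfun \<Longrightarrow> (\<And>s. s \<in> csupp B \<Longrightarrow> q s \<noteq> 0 \<Longrightarrow> p (\<phi> s) = 0) \<Longrightarrow>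
       y \<in> X \<Longrightarrow> p y = 0"
    and inv: "\<And>s b. s \<in> csupp B \<Longrightarrow> q s \<noteq> 0 \<Longrightarrow> b \<in> B \<Longrightarrow> R b (\<phi> s) = w (\<phi> s) * s b"
    and base: "q (\<lambda>_. 0) \<noteq> 0" "w (\<phi> (\<lambda>_. 0)) \<noteq> 0"
  shows "zdim X = enat (card B)"
proof -
  obtain h where h: "bij_betw h {..<card B} B"
    using ex_bij_betw_nat_finite[OF finB] by (auto simp: lessThan_atLeast0)
  define C where "C i = h ` {..<i}" for i
  define U where "U i = {s \<in> csupp (C i). q s \<noteq> 0}" for i
  define Z where "Z i = zclosure (\<phi> ` U i)" for i
  have C: "C i \<subseteq> B" if "i \<le> card B" for i
    using h that unfolding C_def bij_betw_def by auto
  have 0: "(\<lambda>_. 0) \<in> csupp (C i)" for i by (simp add: csupp_def)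
  have U: "zprime (U i)" for i
    unfolding U_def using zprime_csupp[OF inf] q 0 base(1) by (rule zprime_open[where u = "\<lambda>_. 0"])
  have irr: "zirreducible (Z i)" for i
    unfolding Z_def \<phi>_def using q P
    by (intro zirreducible_zclosure zprime_rational_image[where P = P and q = q, OF U]) (auto simp: U_def)
  have mono: "Z i \<subseteq> Z (Suc i)" for i
  proof -
    have "csupp (C i) \<subseteq> (csupp (C (Suc i)) :: ('b \<Rightarrow> 'k) set)"
      by (rule csupp_mono) (auto simp: C_def)
    then have "U i \<subseteq> U (Suc i)" unfolding U_def by blast
    then show ?thesis unfolding Z_def zclosure_subset_iff using zclosure_superset by blast
  qed
  \<comment> \<open>\<open>R (h i)\<close> vanishes on the smaller image, where
    \<open>s (h i) = 0\<close>. If the closures agreed, it would vanish on the larger image too, and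
    \<open>inv\<close> would give \<open>w (\<phi> s) * s (h i) = 0\<close>; cancelling
    \<open>w\<close> and then \<open>q\<close> makes the coordinate \<open>h i\<close> zero on the
    larger coordinate subspace.\<close>
  have neq: "Z i \<noteq> Z (Suc i)" if i: "i < card B" for i
  proof
    assume eq: "Z i = Z (Suc i)"
    have hi: "h i \<in> B" "h i \<in> C (Suc i)"
      using h i by (auto simp: C_def bij_betw_def)
    have hi': "h i \<notin> C i"
    proof
      assume "h i \<in> C i"
      then obtain j where "j < i" "h i = h j" by (auto simp: C_def)
      then show False using h i by (auto simp: bij_betw_def dest: inj_onD)
    qed
    have CB: "csupp (C i) \<subseteq> csupp B" "csupp (C (Suc i)) \<subseteq> (csupp B :: ('b \<Rightarrow> 'k) set)"
      using C[of i] C[of "Suc i"] i by (auto simp: csupp_def)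
    have "R (h i) (\<phi> s) = 0" if "s \<in> U i" for s
      using that inv[of s "h i"] hi hi' CB(1) by (auto simp: U_def csupp_def)
    then have "R (h i) v = 0" if "v \<in> Z i" for v
      using that R[OF hi(1)] unfolding Z_def zclosure_iff by blast
    then have "R (h i) (\<phi> s) = 0" if "s \<in> U (Suc i)" for s
      using that zclosure_superset[of "\<phi> ` U (Suc i)"] eq unfolding Z_def by blast
    then have ws: "w (\<phi> s) * s (h i) = 0" if "s \<in> U (Suc i)" for s
      using that inv[of s "h i"] hi(1) CB(2) by (auto simp: U_def)
    obtain N w' where w': "w' \<in> polyfun" "\<forall>s. q s \<noteq> 0 \<longrightarrow> w' s = q s ^ N * w (\<lambda>a. P a s / q s)"
      using polyfun_clear_denominators[where P = P, OF w q P] by (elim exE bexE) (rule that)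
    have "s (h i) = 0" if "s \<in> U (Suc i)" for s
    proof (rule zprimeD[OF U, of "\<lambda>s. s (h i)" w' "Suc i" "\<lambda>_. 0"])
      fix v assume v: "v \<in> U (Suc i)"
      then show "v (h i) * w' v = 0" using ws[OF v] w'(2) by (auto simp: U_def \<phi>_def)
    next
      show "w' (\<lambda>_. 0) \<noteq> 0" using base w'(2) by (simp add: \<phi>_def)
      show "(\<lambda>_. 0) \<in> U (Suc i)" using base 0 by (auto simp: U_def)
    qed (use that w' in \<open>auto intro: polyfun_intros\<close>)
    then have z: "s (h i) * q s = 0" if "s \<in> csupp (C (Suc i))" for s
      using that by (auto simp: U_def)
    \<comment> \<open>The unit vector at \<open>h i\<close> lies in that subspace and has coordinate
      1.\<close>
    let ?e = "\<lambda>b. if b = h i then 1 else 0 :: 'k"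
    have "?e (h i) = 0"
      by (rule zprimeD[OF zprime_csupp[OF inf], of "\<lambda>s. s (h i)" q "C (Suc i)" "\<lambda>_. 0"])
         (use z 0 base q hi in \<open>auto intro: polyfun_intros simp: csupp_def\<close>)
    then show False by simp
  qed
  show ?thesis
  proof (rule zdim_eqI)
    show "\<forall>i\<le>card B. zirreducible (Z i)" using irr by blast
    show "\<forall>i<card B. Z i \<subset> Z (Suc i)" using mono neq by blast
    have "C (card B) = B" using h by (simp add: C_def bij_betw_def)
    then show "Z (card B) \<subseteq> zclosure X"
      unfolding Z_def zclosure_subset_iff using sub zclosure_superset[of X] by (auto simp: U_def)
  next
    fix m and Y :: "nat \<Rightarrow> ('a \<Rightarrow> 'k) set"
    assume Y: "\<forall>i\<le>m. zirreducible (Y i)" "\<forall>i<m. Y i \<subset> Y (Suc i)" "Y m \<subseteq> zclosure X"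
    obtain f where f: "\<And>i. f i \<in> polyfun" "alg_indep_on (Y m) f m"
      using alg_indep_of_chain[OF Y(1,2)] by blast
    show "m \<le> card B"
    proof (rule card_bound_if_alg_indep[OF finB q P f])
      fix p y assume p: "p \<in> polyfun" "y \<in> Y m"
        and "\<And>s. s \<in> csupp B \<Longrightarrow> q s \<noteq> 0 \<Longrightarrow> p (\<lambda>a. P a s / q s) = 0"
      then have "\<forall>v\<in>X. p v = 0" using dense[of p] unfolding \<phi>_def by blast
      then show "p y = 0" using p Y(3) by (auto simp: zclosure_iff)
    qed
  qed
qed

lemma zdim_csupp:
  fixes I :: "'a set"
  assumes "infinite (UNIV :: 'k::field set)" "finite I"
  shows "zdim (csupp I :: ('a \<Rightarrow> 'k) set) = enat (card I)"
  by (rule zdim_rational[where P = "\<lambda>a s. s a" and q = "\<lambda>_. 1" and w = "\<lambda>_. 1" and R = "\<lambda>b s. s b"])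
     (use assms in \<open>auto intro: polyfun_intros\<close>)

section \<open>Matrices, determinants and flags\<close>

lemma mmul_apply: "mmul r A B (i, j) = (\<Sum>s<r. A (i, s) * B (s, j))"
  by (simp add: mmul_def)

lemma mmul_assoc: "mmul r A (mmul s B C) = mmul s (mmul r A B) C"
proof (rule ext, clarify)
  fix i j
  have "mmul r A (mmul s B C) (i, j) = (\<Sum>k<r. \<Sum>m<s. A (i, k) * B (k, m) * C (m, j))"
    by (simp add: mmul_apply sum_distrib_left mult.assoc)
  also have "\<dots> = (\<Sum>m<s. \<Sum>k<r. A (i, k) * B (k, m) * C (m, j))" by (rule sum.swap)
  also have "\<dots> = mmul s (mmul r A B) C (i, j)" by (simp add: mmul_apply sum_distrib_right)
  finally show "mmul r A (mmul s B C) (i, j) = mmul s (mmul r A B) C (i, j)" .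
qed

lemma mmul_add_left: "mmul r (A + B) C = mmul r A C + mmul r B C"
  and mmul_add_right: "mmul r A (B + C) = mmul r A B + mmul r A C"
  and mmul_diff_left: "mmul r (A - B) C = mmul r A C - mmul r B C"
  and mmul_diff_right: "mmul r A (B - C) = mmul r A B - mmul r A C"
  by (auto simp: fun_eq_iff mmul_apply algebra_simps sum.distrib sum_subtractf)

lemma mmul_zero_left: "mmul r 0 C = 0"
  and mmul_zero_right: "mmul r A 0 = 0"
  by (auto simp: fun_eq_iff mmul_apply)

lemma mmul_fscale_left: "mmul r (fscale c A) B = fscale c (mmul r A B)"
  and mmul_fscale_right: "mmul r A (fscale c B) = fscale c (mmul r A B)"
  by (auto simp: fun_eq_iff mmul_apply fscale_def sum_distrib_left algebra_simps)

lemma mmul_sum_left: "mmul r (\<Sum>i\<in>I. A i) B = (\<Sum>i\<in>I. mmul r (A i) B)"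
  by (rule ext) (clarsimp simp: sum_fun_eval mmul_apply sum_distrib_right intro!: sum.swap)

lemma mmul_sum_right: "mmul r A (\<Sum>i\<in>I. B i) = (\<Sum>i\<in>I. mmul r A (B i))"
  by (rule ext) (clarsimp simp: sum_fun_eval mmul_apply sum_distrib_left intro!: sum.swap)

lemma mmul_idm_right:
  assumes "is_mat p n A" shows "mmul n A (idm n) = A"
proof (rule ext, clarify)
  fix i j
  have "mmul n A (idm n) (i, j) = (\<Sum>s<n. if s = j then A (i, s) else 0)"
    unfolding mmul_apply idm_def by (intro sum.cong) auto
  then show "mmul n A (idm n) (i, j) = A (i, j)"
    using assms by (simp add: is_mat_def)
qed

lemma mmul_idm_left:
  assumes "is_mat n p A" shows "mmul n (idm n) A = A"
proof (rule ext, clarify)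
  fix i j
  have "mmul n (idm n) A (i, j) = (\<Sum>s<n. if s = i then A (s, j) else 0)"
    unfolding mmul_apply idm_def by (intro sum.cong) auto
  then show "mmul n (idm n) A (i, j) = A (i, j)"
    using assms by (simp add: is_mat_def)
qed

lemma is_mat_mmul: "is_mat p m A \<Longrightarrow> is_mat m' q B \<Longrightarrow> is_mat p q (mmul r A B)"
  by (auto simp: is_mat_def mmul_apply)

lemma is_mat_idm: "is_mat n n (idm n)"
  by (auto simp: is_mat_def idm_def)

lemma is_mat_fscale: "is_mat p q A \<Longrightarrow> is_mat p q (fscale c A)"
  by (auto simp: is_mat_def fscale_def)

lemma is_mat_add: "is_mat p q A \<Longrightarrow> is_mat p q B \<Longrightarrow> is_mat p q (A + B)"
  for A :: "'k::comm_ring_1 mat"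
  by (auto simp: is_mat_def)

lemma is_mat_diff: "is_mat p q A \<Longrightarrow> is_mat p q B \<Longrightarrow> is_mat p q (A - B)"
  for A :: "'k::comm_ring_1 mat"
  by (auto simp: is_mat_def)

lemma is_mat_mono: "is_mat p q A \<Longrightarrow> p \<le> p' \<Longrightarrow> q \<le> q' \<Longrightarrow> is_mat p' q' A"
  by (auto simp: is_mat_def)

lemma mvec_mmul: "mvec r (mmul s A B) v = mvec s A (mvec r B v)"
proof
  fix i
  have "mvec r (mmul s A B) v i = (\<Sum>k<r. \<Sum>m<s. A (i, m) * B (m, k) * v k)"
    by (simp add: mvec_def mmul_apply sum_distrib_right)
  also have "\<dots> = (\<Sum>m<s. \<Sum>k<r. A (i, m) * B (m, k) * v k)" by (rule sum.swap)
  also have "\<dots> = mvec s A (mvec r B v) i" by (simp add: mvec_def sum_distrib_left mult.assoc)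
  finally show "mvec r (mmul s A B) v i = mvec s A (mvec r B v) i" .
qed

lemma mvec_unit: "c < n \<Longrightarrow> mvec n A (\<lambda>s. if s = c then 1 else 0) = (\<lambda>r. A (r, c))"
  by (auto simp: mvec_def fun_eq_iff if_distrib[of "\<lambda>z. _ * z"] cong: if_cong)

lemma mvec_idm:
  assumes "\<And>r. n \<le> r \<Longrightarrow> v r = 0" shows "mvec n (idm n) v = v"
proof
  fix i
  have "mvec n (idm n) v i = (\<Sum>s<n. if s = i then v s else 0)"
    unfolding mvec_def idm_def by (intro sum.cong) auto
  then show "mvec n (idm n) v i = v i" using assms by simp
qed

section \<open>Determinants and adjugates\<close>

definition detf :: "nat \<Rightarrow> 'k::field mat \<Rightarrow> 'k" where
  "detf n A = det (Matrix.mat n n A)"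

text \<open>The adjugate stands in for the inverse: its entries are polynomial in those of
  \<open>A\<close>, so conjugation becomes a rational map with denominator
  \<open>detf\<close>.\<close>

definition adjf :: "nat \<Rightarrow> 'k::field mat \<Rightarrow> 'k mat" where
  "adjf n A = (\<lambda>(i, j). if i < n \<and> j < n then adj_mat (Matrix.mat n n A) $$ (i, j) else 0)"

lemma is_mat_adjf: "is_mat n n (adjf n A)"
  by (auto simp: is_mat_def adjf_def)

lemma adjf_entries:
  assumes "i < n" "j < n"
  shows "(\<Sum>k<n. A (i, k) * adjf n A (k, j)) = (if i = j then detf n A else 0)"
    and "(\<Sum>k<n. adjf n A (i, k) * A (k, j)) = (if i = j then detf n A else 0)"
proof -
  let ?M = "Matrix.mat n n A"
  have M: "?M \<in> carrier_mat n n" by simp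
  note adj = adj_mat[OF M]
  have "(?M * adj_mat ?M) $$ (i, j) = (\<Sum>k<n. A (i, k) * adjf n A (k, j))"
    using assms adj(1) by (auto simp: scalar_prod_def adjf_def lessThan_atLeast0 intro!: sum.cong)
  then show "(\<Sum>k<n. A (i, k) * adjf n A (k, j)) = (if i = j then detf n A else 0)"
    using adj(2) assms by (auto simp: detf_def)
  have "(adj_mat ?M * ?M) $$ (i, j) = (\<Sum>k<n. adjf n A (i, k) * A (k, j))"
    using assms adj(1) by (auto simp: scalar_prod_def adjf_def lessThan_atLeast0 intro!: sum.cong)
  then show "(\<Sum>k<n. adjf n A (i, k) * A (k, j)) = (if i = j then detf n A else 0)"
    using adj(3) assms by (auto simp: detf_def)
qed

lemma mmul_adjf_right: "is_mat n n A \<Longrightarrow> mmul n A (adjf n A) = fscale (detf n A) (idm n)"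
proof (rule ext, clarify)
  fix i j assume A: "is_mat n n A"
  show "mmul n A (adjf n A) (i, j) = fscale (detf n A) (idm n) (i, j)"
  proof (cases "i < n \<and> j < n")
    case True
    then show ?thesis using adjf_entries(1)[of i n j A] by (auto simp: mmul_apply fscale_def idm_def)
  next
    case False
    then show ?thesis using A is_mat_adjf[of n A]
      by (auto simp: mmul_apply fscale_def idm_def is_mat_def not_less)
  qed
qed

lemma mmul_adjf_left: "is_mat n n A \<Longrightarrow> mmul n (adjf n A) A = fscale (detf n A) (idm n)"
proof (rule ext, clarify)
  fix i j assume A: "is_mat n n A"
  show "mmul n (adjf n A) A (i, j) = fscale (detf n A) (idm n) (i, j)"
  proof (cases "i < n \<and> j < n")
    case True
    then show ?thesis using adjf_entries(2)[of i n j A] by (auto simp: mmul_apply fscale_def idm_def)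
  next
    case False
    then show ?thesis using A is_mat_adjf[of n A]
      by (auto simp: mmul_apply fscale_def idm_def is_mat_def not_less)
  qed
qed

lemma detf_cong:
  "(\<And>i j. i < n \<Longrightarrow> j < n \<Longrightarrow> A (i, j) = B (i, j)) \<Longrightarrow> detf n A = detf n B"
  unfolding detf_def by (intro arg_cong[of _ _ det] eq_matI) auto

lemma detf_mmul: "detf n (mmul n A B) = detf n A * detf n B"
proof -
  have "Matrix.mat n n (mmul n A B) = Matrix.mat n n A * Matrix.mat n n B"
    by (intro eq_matI) (auto simp: mmul_apply scalar_prod_def lessThan_atLeast0 intro!: sum.cong)
  then show ?thesis unfolding detf_def by (simp add: det_mult[of _ n])
qed

lemma detf_idm: "detf n (idm n) = (1 :: 'k::field)"
proof -
  have "Matrix.mat n n (idm n :: 'k mat) = 1\<^sub>m n" by (intro eq_matI) (auto simp: idm_def)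
  then show ?thesis unfolding detf_def by (simp only: det_one)
qed

lemma detf_fscale: "detf n (fscale c A) = c ^ n * detf n A"
proof -
  have "Matrix.mat n n (fscale c A) = c \<cdot>\<^sub>m Matrix.mat n n A" by (intro eq_matI) (auto simp: fscale_def)
  then show ?thesis unfolding detf_def by (simp add: det_smult)
qed

text \<open>Cramer's rule without division, for both orders of a matrix and its adjugate.\<close>

lemma adjf_apply:
  assumes "i < n"
  shows "(\<Sum>j<n. A (i, j) * (\<Sum>k<n. adjf n A (j, k) * v k)) = detf n A * v i"
    and "(\<Sum>j<n. adjf n A (i, j) * (\<Sum>k<n. A (j, k) * v k)) = detf n A * v i"
proof -
  have *: "(\<Sum>j<n. X (i, j) * (\<Sum>k<n. Y (j, k) * v k)) = detf n A * v i"
    if "\<And>k. k < n \<Longrightarrow> (\<Sum>j<n. X (i, j) * Y (j, k)) = (if i = k then detf n A else 0)" for X Y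
  proof -
    have "(\<Sum>j<n. X (i, j) * (\<Sum>k<n. Y (j, k) * v k)) = (\<Sum>j<n. \<Sum>k<n. X (i, j) * Y (j, k) * v k)"
      by (simp add: sum_distrib_left mult.assoc)
    also have "\<dots> = (\<Sum>k<n. \<Sum>j<n. X (i, j) * Y (j, k) * v k)" by (rule sum.swap)
    also have "\<dots> = (\<Sum>k<n. (\<Sum>j<n. X (i, j) * Y (j, k)) * v k)" by (simp add: sum_distrib_right)
    also have "\<dots> = (\<Sum>k<n. if k = i then detf n A * v k else 0)"
      using that by (intro sum.cong) auto
    finally show ?thesis using assms by simp
  qed
  show "(\<Sum>j<n. A (i, j) * (\<Sum>k<n. adjf n A (j, k) * v k)) = detf n A * v i"
    by (rule *) (rule adjf_entries(1)[OF assms])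
  show "(\<Sum>j<n. adjf n A (i, j) * (\<Sum>k<n. A (j, k) * v k)) = detf n A * v i"
    by (rule *) (rule adjf_entries(2)[OF assms])
qed

lemma detf_nonzero_inj:
  assumes "detf n A \<noteq> 0" and "\<And>i. i < n \<Longrightarrow> (\<Sum>j<n. A (i, j) * v j) = 0" and "i < n"
  shows "v i = 0"
  using adjf_apply(2)[OF assms(3), of A v] assms(1,2) by simp

lemma polyfun_detf:
  assumes "\<And>i j. i < n \<Longrightarrow> j < n \<Longrightarrow> (\<lambda>s. A s (i, j)) \<in> polyfun"
  shows "(\<lambda>s. detf n (A s)) \<in> polyfun"
proof -
  have "(\<lambda>s. \<Sum>p | p permutes {0..<n}. of_int (sign p) * (\<Prod>i=0..<n. A s (i, p i))) \<in> polyfun"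
    by (intro polyfun_intros assms) (auto dest: permutes_in_image)
  moreover have "detf n (A s) = (\<Sum>p | p permutes {0..<n}. of_int (sign p) * (\<Prod>i=0..<n. A s (i, p i)))" for s
    unfolding detf_def det_def
    by (auto intro!: sum.cong prod.cong dest: permutes_in_image)
  ultimately show ?thesis by simp
qed

lemma polyfun_adjf:
  assumes A: "\<And>i j. i < n \<Longrightarrow> j < n \<Longrightarrow> (\<lambda>s. A s (i, j)) \<in> polyfun"
  shows "(\<lambda>s. adjf n (A s) p) \<in> polyfun"
proof (cases p)
  case (Pair i j)
  show ?thesis
  proof (cases "i < n \<and> j < n")
    case False
    then show ?thesis by (auto simp: Pair adjf_def intro: polyfun_intros)
  next
    case True
    \<comment> \<open>The minor without row \<open>j\<close> and column \<open>i\<close>; later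
      indices are shifted by one. The order is swapped because the adjugate transposes the
      cofactors.\<close>
    define A' where "A' s = (\<lambda>(i', j'). A s (if i' < j then i' else Suc i', if j' < i then j' else Suc j'))" for s
    have "mat_delete (Matrix.mat n n (A s)) j i = Matrix.mat (n - 1) (n - 1) (A' s)" for s
      unfolding mat_delete_def A'_def by (intro eq_matI) auto
    then have "adjf n (A s) p = (- 1) ^ (j + i) * detf (n - 1) (A' s)" for s
      using True by (simp add: Pair adjf_def adj_mat_def cofactor_def detf_def)
    moreover have "(\<lambda>s. (- 1) ^ (j + i) * detf (n - 1) (A' s)) \<in> polyfun"
      by (intro polyfun_intros polyfun_detf) (auto simp: A'_def intro!: A)
    ultimately show ?thesis by simp
  qed
qed

lemma polyfun_mmul:
  assumes "\<And>p. (\<lambda>s. A s p) \<in> polyfun" "\<And>p. (\<lambda>s. B s p) \<in> polyfun"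
  shows "(\<lambda>s. mmul n (A s) (B s) p) \<in> polyfun"
  by (cases p) (auto simp: mmul_apply intro!: polyfun_intros assms)

section \<open>Dual bases in coordinate subspaces\<close>

lemma subspace_csupp: "fvs.subspace (csupp I)"
  by (rule fvs.subspaceI) (auto simp: csupp_def fscale_def)

text \<open>\<open>K\<close> is a smallest set of positions whose entries determine the elements of
  \<open>F\<close>. By minimality, dropping \<open>k\<close> admits a nonzero vector vanishing on
  the rest of \<open>K\<close>, and rescaling it gives \<open>f k\<close>: a reduced echelon form
  without ordering the coordinates.\<close>

lemma dual_basis_exists:
  fixes F :: "('a \<Rightarrow> 'k::field) set"
  assumes F: "fvs.subspace F" "F \<subseteq> csupp U" and U: "finite U"
  obtains K f where "K \<subseteq> U" "\<And>k. k \<in> K \<Longrightarrow> f k \<in> F"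
    "\<And>k k'. k \<in> K \<Longrightarrow> k' \<in> K \<Longrightarrow> f k k' = (if k' = k then 1 else 0)"
    "\<And>v. v \<in> F \<Longrightarrow> v = (\<Sum>k\<in>K. fscale (v k) (f k))"
proof -
  define good where "good K \<longleftrightarrow> K \<subseteq> U \<and> (\<forall>v\<in>F. (\<forall>k\<in>K. v k = 0) \<longrightarrow> v = 0)" for K
  have "good U" using F(2) by (auto simp: good_def csupp_def fun_eq_iff)
  then obtain K where K: "good K" "\<And>K'. good K' \<Longrightarrow> card K \<le> card K'"
    using ex_has_least_nat[of good U card] by blast
  have finK: "finite K" using K(1) U by (auto simp: good_def intro: finite_subset)
  have "\<exists>f\<in>F. \<forall>k'\<in>K. f k' = (if k' = k then 1 else 0)" if k: "k \<in> K" for k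
  proof -
    have "card (K - {k}) < card K" using k finK by (intro psubset_card_mono) auto
    then have "\<not> good (K - {k})" using K(2) by (meson not_less)
    then obtain v where v: "v \<in> F" "\<forall>k'\<in>K - {k}. v k' = 0" "v \<noteq> 0"
      using K(1) by (auto simp: good_def)
    have "v k \<noteq> 0" using v K(1) k unfolding good_def by blast
    then show ?thesis using v fvs.subspace_scale[OF F(1) v(1), of "1 / v k"]
      by (intro bexI[of _ "fscale (1 / v k) v"]) (auto simp: fscale_def)
  qed
  then obtain f where f: "\<And>k. k \<in> K \<Longrightarrow> f k \<in> F"
    "\<And>k k'. k \<in> K \<Longrightarrow> k' \<in> K \<Longrightarrow> f k k' = (if k' = k then 1 else 0)"
    by metis
  show thesis
  proof (rule that[OF _ f])
    show "K \<subseteq> U" using K(1) by (simp add: good_def)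
    fix v assume v: "v \<in> F"
    define z where "z = v - (\<Sum>k\<in>K. fscale (v k) (f k))"
    have "z \<in> F" unfolding z_def
      by (intro fvs.subspace_diff[OF F(1)] fvs.subspace_sum[OF F(1)] fvs.subspace_scale[OF F(1)] f v)
    moreover have "z k' = 0" if "k' \<in> K" for k'
    proof -
      have "(\<Sum>k\<in>K. fscale (v k) (f k)) k' = (\<Sum>k\<in>K. if k = k' then v k else 0)"
        unfolding sum_fun_eval using f(2) that by (intro sum.cong) (auto simp: fscale_def)
      then show ?thesis using finK that by (simp add: z_def)
    qed
    ultimately have "z = 0" using K(1) by (auto simp: good_def)
    then show "v = (\<Sum>k\<in>K. fscale (v k) (f k))" by (simp add: z_def)
  qed auto
qed

section \<open>The standard flag and matrices compatible with it\<close>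

lemma Sig_mono: "i \<le> j \<Longrightarrow> Sig d i \<le> Sig d j"
proof -
  assume "i \<le> j"
  then have "take j d = take i d @ take (j - i) (drop i d)"
    by (metis le_add_diff_inverse take_add)
  then show ?thesis by (simp add: Sig_def)
qed

lemma Sig_0: "Sig d 0 = 0"
  by (simp add: Sig_def)

lemma Sig_ge: "length d \<le> i \<Longrightarrow> Sig d i = ntot d"
  by (simp add: Sig_def ntot_def)

lemma Sig_le: "Sig d i \<le> ntot d"
  using Sig_mono[of i "max i (length d)" d] by (simp add: Sig_ge)

text \<open>Because the flag is spanned by standard basis vectors, the matrices mapping each V_i
  into V_{\<tau> i} form a coordinate subspace; these are its free positions. The identity gives the
  matrices preserving the flag, \<open>i - l - 1\<close> gives p_u.\<close>

definition flagidx :: "nat list \<Rightarrow> (nat \<Rightarrow> nat) \<Rightarrow> (nat \<times> nat) set" where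
  "flagidx d \<tau> = {(r, c). c < ntot d \<and> (\<forall>i\<le>length d. c < Sig d i \<longrightarrow> r < Sig d (\<tau> i))}"

lemma flagidx_subset: "flagidx d \<tau> \<subseteq> {..<ntot d} \<times> {..<ntot d}"
proof -
  have "r < ntot d" if "(r, c) \<in> flagidx d \<tau>" for r c
    using that Sig_le[of d "\<tau> (length d)"] by (auto simp: flagidx_def Sig_ge dest!: spec[of _ "length d"])
  then show ?thesis by (auto simp: flagidx_def)
qed

lemma finite_flagidx: "finite (flagidx d \<tau>)"
  using flagidx_subset by (rule finite_subset) simp

lemma is_mat_flagidx: "A \<in> csupp (flagidx d \<tau>) \<Longrightarrow> is_mat (ntot d) (ntot d) A"
  using flagidx_subset[of d \<tau>] by (fastforce simp: csupp_def is_mat_def)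

lemma flagidx_entry:
  "A \<in> csupp (flagidx d \<tau>) \<Longrightarrow> i \<le> length d \<Longrightarrow> c < Sig d i \<Longrightarrow> Sig d (\<tau> i) \<le> r \<Longrightarrow> A (r, c) = 0"
  by (auto simp: csupp_def flagidx_def not_less[symmetric])

lemma csupp_flagidx:
  "csupp (flagidx d \<tau>) = {f :: 'k::comm_ring_1 mat. is_mat (ntot d) (ntot d) f \<and>
     (\<forall>i\<le>length d. \<forall>v\<in>flagV d i. mvec (ntot d) f v \<in> flagV d (\<tau> i))}"
proof (rule equalityI; rule subsetI)
  fix f :: "'k mat" assume f: "f \<in> csupp (flagidx d \<tau>)"
  have "f (r, s) * v s = 0" if "i \<le> length d" "v \<in> flagV d i" "Sig d (\<tau> i) \<le> r" for i v r s
    using flagidx_entry[OF f that(1) _ that(3), of s] that(2) by (cases "s < Sig d i") (auto simp: flagV_def)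
  then show "f \<in> {f. is_mat (ntot d) (ntot d) f \<and>
     (\<forall>i\<le>length d. \<forall>v\<in>flagV d i. mvec (ntot d) f v \<in> flagV d (\<tau> i))}"
    using is_mat_flagidx[OF f] by (auto simp: flagV_def[of _ "\<tau> _"] mvec_def intro!: sum.neutral)
next
  fix f :: "'k mat" assume "f \<in> {f. is_mat (ntot d) (ntot d) f \<and>
     (\<forall>i\<le>length d. \<forall>v\<in>flagV d i. mvec (ntot d) f v \<in> flagV d (\<tau> i))}"
  then have f: "is_mat (ntot d) (ntot d) f"
    "\<And>i v. i \<le> length d \<Longrightarrow> v \<in> flagV d i \<Longrightarrow> mvec (ntot d) f v \<in> flagV d (\<tau> i)" by auto
  show "f \<in> csupp (flagidx d \<tau>)"
    unfolding csupp_def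
  proof (clarify)
    fix r c assume rc: "(r, c) \<notin> flagidx d \<tau>"
    show "f (r, c) = 0"
    proof (cases "c < ntot d")
      case False
      then show ?thesis using f(1) by (simp add: is_mat_def)
    next
      case True
      then obtain i where i: "i \<le> length d" "c < Sig d i" "Sig d (\<tau> i) \<le> r"
        using rc by (auto simp: flagidx_def not_less)
      \<comment> \<open>Column \<open>c\<close> is the image of the c-th unit vector, which lies in
        V_i.\<close>
      have "mvec (ntot d) f (\<lambda>s. if s = c then 1 else 0) \<in> flagV d (\<tau> i)"
        using i by (intro f(2)) (auto simp: flagV_def)
      then show ?thesis using i(3) by (auto simp: mvec_unit[OF True] flagV_def)
    qed
  qed
qed

lemma mmul_flagidx:
  assumes A: "A \<in> csupp (flagidx d \<sigma>)" and B: "B \<in> csupp (flagidx d \<tau>)"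
    and \<tau>: "\<And>i. i \<le> length d \<Longrightarrow> \<tau> i \<le> length d"
  shows "mmul n A B \<in> csupp (flagidx d (\<lambda>i. \<sigma> (\<tau> i)))"
  unfolding csupp_def
proof clarify
  fix r c assume rc: "(r, c) \<notin> flagidx d (\<lambda>i. \<sigma> (\<tau> i))"
  have "A (r, s) * B (s, c) = 0" for s
  proof (cases "c < ntot d")
    case False
    then show ?thesis using is_mat_flagidx[OF B] by (simp add: is_mat_def)
  next
    case True
    then obtain i where i: "i \<le> length d" "c < Sig d i" "Sig d (\<sigma> (\<tau> i)) \<le> r"
      using rc by (auto simp: flagidx_def not_less)
    show ?thesis
      using flagidx_entry[OF B i(1,2), of s] flagidx_entry[OF A \<tau>[OF i(1)] _ i(3), of s]
      by (cases "s < Sig d (\<tau> i)") auto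
  qed
  then show "mmul n A B (r, c) = 0" by (simp add: mmul_apply)
qed

lemma idm_flagidx: "idm (ntot d) \<in> csupp (flagidx d (\<lambda>i. i))"
  by (auto simp: csupp_def idm_def flagidx_def)

lemma pu_eq: "pu d l = csupp (flagidx d (\<lambda>i. i - l - 1))"
  unfolding pu_def csupp_flagidx ..

lemma Pgrp_eq: "Pgrp d = {g \<in> csupp (flagidx d (\<lambda>i. i)). invertible_mat (ntot d) g}"
  unfolding Pgrp_def csupp_flagidx by (auto simp: invertible_mat_def)

section \<open>Orbits of the parabolic group\<close>

text \<open>\<open>orbit\<close> asks for a right inverse only; the determinant shows that it is the
  scaled adjugate and hence two-sided.\<close>

lemma right_inverse_detf:
  assumes g: "is_mat n n g" and h: "is_mat n n h" and gh: "mmul n g h = idm n"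
  shows "detf n g \<noteq> 0" and "h = fscale (1 / detf n g) (adjf n g)" and "mmul n h g = idm n"
proof -
  have "detf n g * detf n h = 1" using detf_mmul[of n g h] gh by (simp add: detf_idm)
  then show det: "detf n g \<noteq> 0" by auto
  have "adjf n g = mmul n (mmul n (adjf n g) g) h"
    using gh mmul_idm_right[OF is_mat_adjf, of n g] by (simp add: mmul_assoc[symmetric])
  also have "\<dots> = fscale (detf n g) h"
    by (simp add: mmul_adjf_left[OF g] mmul_fscale_left mmul_idm_left[OF h])
  finally show h: "h = fscale (1 / detf n g) (adjf n g)"
    using det by (simp add: fscale_def fun_eq_iff)
  show "mmul n h g = idm n"
    unfolding h mmul_fscale_left mmul_adjf_left[OF g] using det by (auto simp: fscale_def fun_eq_iff)
qed

lemma scaled_adjf_inverse: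
  assumes g: "is_mat n n g" and "detf n g \<noteq> 0"
  shows "mmul n g (fscale (1 / detf n g) (adjf n g)) = idm n"
    and "mmul n (fscale (1 / detf n g) (adjf n g)) g = idm n"
  unfolding mmul_fscale_left mmul_fscale_right mmul_adjf_left[OF g] mmul_adjf_right[OF g]
  using assms(2) by (auto simp: fscale_def fun_eq_iff)

lemma invertible_mat_iff: "invertible_mat n g \<longleftrightarrow> is_mat n n g \<and> detf n g \<noteq> 0"
proof
  assume "invertible_mat n g"
  then obtain h where "is_mat n n g" "is_mat n n h" "mmul n g h = idm n"
    unfolding invertible_mat_def by auto
  then show "is_mat n n g \<and> detf n g \<noteq> 0" using right_inverse_detf(1) by blast
next
  assume g: "is_mat n n g \<and> detf n g \<noteq> 0"
  show "invertible_mat n g"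
    unfolding invertible_mat_def
    using g scaled_adjf_inverse[of n g] is_mat_fscale[OF is_mat_adjf]
    by (intro conjI exI[of _ "fscale (1 / detf n g) (adjf n g)"]) auto
qed

text \<open>An invertible \<open>g\<close> with g(V_i) inside V_i satisfies g(V_i) = V_i, by finite
  dimension of V_i.\<close>

lemma inverse_flagidx:
  fixes g h :: "'k::field mat"
  assumes g: "g \<in> csupp (flagidx d (\<lambda>i. i))" and h: "is_mat (ntot d) (ntot d) h"
    and hg: "mmul (ntot d) h g = idm (ntot d)"
  shows "h \<in> csupp (flagidx d (\<lambda>i. i))"
  unfolding csupp_flagidx
proof (intro CollectI conjI allI impI ballI)
  show "is_mat (ntot d) (ntot d) h" by fact
  fix i and v :: "nat \<Rightarrow> 'k" assume i: "i \<le> length d" and v: "v \<in> flagV d i"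
  define n where "n = ntot d"
  define s where "s = Sig d i"
  have sn: "s \<le> n" by (simp add: s_def n_def Sig_le)
  have gz: "g (r, c) = 0" if "c < s" "s \<le> r" for r c
    using flagidx_entry[OF g i] that by (simp add: s_def)
  have gu: "mvec n g u r = (if r < s then \<Sum>c<s. g (r, c) * u c else 0)"
    if "\<And>c. s \<le> c \<Longrightarrow> u c = 0" for u r
  proof -
    have "mvec n g u r = (\<Sum>c<s. g (r, c) * u c)"
      unfolding mvec_def using sn that by (intro sum.mono_neutral_right) auto
    then show ?thesis using gz by auto
  qed
  have hg': "u = mvec n h (mvec n g u)" if "\<And>c. s \<le> c \<Longrightarrow> u c = 0" for u
    using that sn hg by (simp add: mvec_mmul[symmetric] n_def[symmetric] mvec_idm)
  \<comment> \<open>This is the determinant of the leading block of size \<open>s\<close>, the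
    matrix of \<open>g\<close> on V_i. A kernel vector of the block, padded by zeros, would be
    killed by \<open>g\<close>.\<close>
  have "detf s g \<noteq> 0"
  proof
    assume "detf s g = 0"
    then obtain w where w: "w \<in> carrier_vec s" "w \<noteq> 0\<^sub>v s" "Matrix.mat s s g *\<^sub>v w = 0\<^sub>v s"
      unfolding detf_def using det_0_iff_vec_prod_zero_field[of "Matrix.mat s s g" s] by auto
    define u where "u c = (if c < s then w $ c else 0)" for c
    have "(\<Sum>c<s. g (r, c) * u c) = 0" if "r < s" for r
    proof -
      have "(\<Sum>c<s. g (r, c) * u c) = (Matrix.mat s s g *\<^sub>v w) $ r"
        using that w(1) by (auto simp: scalar_prod_def u_def lessThan_atLeast0 intro!: sum.cong)
      then show ?thesis using w(3) that by simp
    qed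
    then have "mvec n g u = (\<lambda>_. 0)" using gu[of u] by (auto simp: u_def)
    then have "u = (\<lambda>_. 0)" using hg'[of u] by (simp add: u_def mvec_def)
    then have "w = 0\<^sub>v s" using w(1) by (intro eq_vecI) (auto simp: u_def fun_eq_iff split: if_splits)
    then show False using w(2) by simp
  qed
  \<comment> \<open>The preimage of \<open>v\<close> inside V_i, obtained by Cramer's rule in the
    leading block.\<close>
  define u where "u c = (if c < s then (\<Sum>k<s. adjf s g (c, k) * v k) / detf s g else 0)" for c
  have "(\<Sum>c<s. g (r, c) * u c) = v r" if r: "r < s" for r
  proof -
    have "u c * detf s g = (\<Sum>k<s. adjf s g (c, k) * v k)" if "c < s" for c
      using \<open>detf s g \<noteq> 0\<close> that by (simp add: u_def)
    then have "(\<Sum>c<s. g (r, c) * u c) * detf s g = detf s g * v r"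
      using adjf_apply(1)[OF r, of g v] by (simp add: sum_distrib_right mult.assoc)
    then show ?thesis using \<open>detf s g \<noteq> 0\<close> by simp
  qed
  then have "mvec n g u = v" using gu[of u] v by (auto simp: u_def flagV_def s_def fun_eq_iff)
  then have "mvec n h v = u" using hg'[of u] by (simp add: u_def)
  then show "mvec (ntot d) h v \<in> flagV d i" by (auto simp: n_def flagV_def u_def s_def)
qed

text \<open>With the inverse written as adjugate over determinant, the orbit is the image of a
  principal open subset of a linear space under a rational map; its primality follows from this
  form.\<close>

lemma orbit_eq:
  fixes x :: "'k::field mat"
  shows "orbit d x = (\<lambda>g p. mmul (ntot d) (mmul (ntot d) g x) (adjf (ntot d) g) p / detf (ntot d) g) `
    {g \<in> csupp (flagidx d (\<lambda>i. i)). detf (ntot d) g \<noteq> 0}" (is "_ = ?\<phi> ` ?S")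
proof -
  let ?n = "ntot d"
  have P: "g \<in> Pgrp d \<longleftrightarrow> g \<in> ?S" for g :: "'k mat"
    by (auto simp: Pgrp_eq invertible_mat_iff is_mat_flagidx)
  have \<phi>: "?\<phi> g = mmul ?n (mmul ?n g x) (fscale (1 / detf ?n g) (adjf ?n g))" for g
    unfolding mmul_fscale_right by (simp add: fscale_def)
  show ?thesis
  proof (rule equalityI; rule subsetI)
    fix y assume "y \<in> orbit d x"
    then obtain g h where g: "g \<in> ?S" "is_mat ?n ?n h" "mmul ?n g h = idm ?n"
      and y: "y = mmul ?n (mmul ?n g x) h"
      unfolding orbit_def using P by blast
    have "y = ?\<phi> g"
      using right_inverse_detf(2)[OF is_mat_flagidx g(2,3)] g(1) unfolding \<phi> y by auto
    then show "y \<in> ?\<phi> ` ?S" using g(1) by (rule image_eqI)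
  next
    fix y assume "y \<in> ?\<phi> ` ?S"
    then obtain g where g: "g \<in> ?S" and y: "y = ?\<phi> g" by (elim imageE) (rule that)
    have "mmul ?n g (fscale (1 / detf ?n g) (adjf ?n g)) = idm ?n"
      using g by (intro scaled_adjf_inverse) (auto simp: is_mat_flagidx)
    then show "y \<in> orbit d x"
      unfolding orbit_def y \<phi> using g P is_mat_fscale[OF is_mat_adjf]
      by (intro CollectI exI conjI refl) auto
  qed
qed

lemma zprime_orbit:
  fixes x :: "'k::field mat"
  assumes "infinite (UNIV :: 'k set)"
  shows "zprime (orbit d x)"
  unfolding orbit_eq
proof (rule zprime_rational_image)
  show "(\<lambda>g. detf (ntot d) g) \<in> polyfun" by (intro polyfun_detf polyfun_intros)
  then show "zprime {g \<in> csupp (flagidx d (\<lambda>i. i)). detf (ntot d) g \<noteq> (0::'k)}"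
    by (rule zprime_open[OF zprime_csupp[OF assms] _ idm_flagidx]) (simp add: detf_idm)
  show "(\<lambda>g. mmul (ntot d) (mmul (ntot d) g x) (adjf (ntot d) g) p) \<in> polyfun" for p
    by (intro polyfun_mmul polyfun_adjf polyfun_intros)
qed simp

lemma orbit_subset_pu:
  fixes x :: "'k::field mat"
  assumes x: "x \<in> pu d l"
  shows "orbit d x \<subseteq> pu d l"
proof
  fix y assume "y \<in> orbit d x"
  then obtain g h where g: "g \<in> Pgrp d" and h: "is_mat (ntot d) (ntot d) h"
      "mmul (ntot d) g h = idm (ntot d)" and y: "y = mmul (ntot d) (mmul (ntot d) g x) h"
    unfolding orbit_def by blast
  have g': "g \<in> csupp (flagidx d (\<lambda>i. i))" using g by (simp add: Pgrp_eq)
  have "h \<in> csupp (flagidx d (\<lambda>i. i))"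
    using right_inverse_detf(3)[OF is_mat_flagidx[OF g'] h] by (rule inverse_flagidx[OF g' h(1)])
  then show "y \<in> pu d l"
    unfolding y pu_eq using x[unfolded pu_eq] g' by (intro mmul_flagidx) auto
qed

lemma self_in_orbit:
  fixes x :: "'k::field mat"
  assumes "is_mat (ntot d) (ntot d) x"
  shows "x \<in> orbit d x"
proof -
  have "idm (ntot d) \<in> (Pgrp d :: 'k mat set)"
    by (simp add: Pgrp_eq idm_flagidx invertible_mat_iff is_mat_idm detf_idm)
  moreover have "x = mmul (ntot d) (mmul (ntot d) (idm (ntot d)) x) (idm (ntot d))"
    using assms by (simp add: mmul_idm_left mmul_idm_right)
  ultimately show ?thesis unfolding orbit_def using is_mat_idm mmul_idm_left[OF is_mat_idm] by blast
qed

section \<open>Tangent space and dimension of the orbit\<close>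

definition tangent :: "nat list \<Rightarrow> 'k::field mat \<Rightarrow> 'k mat set" where
  "tangent d x = (\<lambda>a. mmul (ntot d) a x - mmul (ntot d) x a) ` csupp (flagidx d (\<lambda>i. i))"

lemma subspace_tangent: "fvs.subspace (tangent d x)"
proof (rule fvs.subspaceI)
  show "0 \<in> tangent d x"
    unfolding tangent_def
    by (rule image_eqI[of _ _ 0]) (auto simp: mmul_def csupp_def fun_eq_iff)
next
  fix u v assume "u \<in> tangent d x" "v \<in> tangent d x"
  then obtain a b where ab: "a \<in> csupp (flagidx d (\<lambda>i. i))" "b \<in> csupp (flagidx d (\<lambda>i. i))"
    "u = mmul (ntot d) a x - mmul (ntot d) x a" "v = mmul (ntot d) b x - mmul (ntot d) x b"
    unfolding tangent_def by (elim imageE) (rule that)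
  show "u + v \<in> tangent d x"
    unfolding tangent_def
  proof (rule image_eqI)
    show "a + b \<in> csupp (flagidx d (\<lambda>i. i))" using ab fvs.subspace_add[OF subspace_csupp] by blast
    show "u + v = mmul (ntot d) (a + b) x - mmul (ntot d) x (a + b)"
      unfolding ab mmul_add_left mmul_add_right by (simp add: fun_eq_iff)
  qed
next
  fix c u assume "u \<in> tangent d x"
  then obtain a where a: "a \<in> csupp (flagidx d (\<lambda>i. i))" "u = mmul (ntot d) a x - mmul (ntot d) x a"
    unfolding tangent_def by (elim imageE) (rule that)
  show "fscale c u \<in> tangent d x"
    unfolding tangent_def
  proof (rule image_eqI)
    show "fscale c a \<in> csupp (flagidx d (\<lambda>i. i))" using a fvs.subspace_scale[OF subspace_csupp] by blast
    show "fscale c u = mmul (ntot d) (fscale c a) x - mmul (ntot d) x (fscale c a)"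
      unfolding a mmul_fscale_left mmul_fscale_right by (rule fvs.scale_right_diff_distrib)
  qed
qed

lemma tangent_subset_pu:
  fixes x :: "'k::field mat"
  assumes "x \<in> pu d l" shows "tangent d x \<subseteq> pu d l"
  unfolding tangent_def pu_eq
proof (rule image_subsetI, rule fvs.subspace_diff[OF subspace_csupp])
  fix a :: "'k mat" assume a: "a \<in> csupp (flagidx d (\<lambda>i. i))"
  show "mmul (ntot d) a x \<in> csupp (flagidx d (\<lambda>i. i - l - 1))"
    by (rule mmul_flagidx[OF a assms[unfolded pu_eq]]) simp
  show "mmul (ntot d) x a \<in> csupp (flagidx d (\<lambda>i. i - l - 1))"
    by (rule mmul_flagidx[OF assms[unfolded pu_eq] a]) simp
qed

text \<open>An instance of \<open>zdim_rational\<close> with the slice \<open>A s\<close> as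
  parameter space. Of its hypotheses, \<open>inv\<close> is Cramer's rule, and \<open>dense\<close>
  holds because every orbit point at which \<open>w\<close> and \<open>D\<close> are nonzero comes
  from the slice.\<close>

theorem zdim_orbit:
  fixes x :: "'k::field mat"
  assumes inf: "infinite (UNIV :: 'k set)" and x: "x \<in> pu d l"
    and finK: "finite K" and f: "\<And>k. k \<in> K \<Longrightarrow> f k \<in> tangent d x"
    and dual: "\<And>k k'. k \<in> K \<Longrightarrow> k' \<in> K \<Longrightarrow> f k k' = (if k' = k then 1 else 0)"
    and expand: "\<And>v. v \<in> tangent d x \<Longrightarrow> v = (\<Sum>k\<in>K. fscale (v k) (f k))"
  shows "zdim (orbit d x) = enat (card K)"
proof -
  define n where "n = ntot d"
  let ?P = "csupp (flagidx d (\<lambda>i. i)) :: 'k mat set"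
  \<comment> \<open>For invertible \<open>b\<close>, vanishing of \<open>T y b\<close> means that
    \<open>b\<close> conjugates \<open>x\<close> to \<open>y\<close>. The condition is linear in
    \<open>b\<close>, and \<open>T x\<close> maps onto the tangent space.\<close>
  define T where "T y b = mmul n b x - mmul n y b" for y b
  have x_mat: "is_mat n n x" using x is_mat_flagidx unfolding pu_eq n_def by blast
  have tangentI: "T x b \<in> tangent d x" if "b \<in> ?P" for b
    using that by (auto simp: tangent_def T_def n_def)
  have "\<forall>k\<in>K. \<exists>a\<in>?P. f k = T x a" using f by (auto simp: tangent_def T_def n_def)
  then obtain a where a: "\<And>k. k \<in> K \<Longrightarrow> a k \<in> ?P" "\<And>k. k \<in> K \<Longrightarrow> f k = T x (a k)" by metis
  define A where "A s = idm n + (\<Sum>k\<in>K. fscale (s k) (a k))" for s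
  have A: "A s \<in> ?P" for s
    unfolding A_def n_def
    by (intro fvs.subspace_add[OF subspace_csupp] fvs.subspace_sum[OF subspace_csupp]
        fvs.subspace_scale[OF subspace_csupp] idm_flagidx a)
  then have A_mat: "is_mat n n (A s)" for s using is_mat_flagidx unfolding n_def by blast
  have A_entry: "A s p = idm n p + (\<Sum>k\<in>K. s k * a k p)" for s p
    by (simp add: A_def sum_fun_eval fscale_def)
  have A_poly: "(\<lambda>s. A s p) \<in> polyfun" for p
    unfolding A_entry by (intro polyfun_intros)

  \<comment> \<open>Determinants are taken over an initial segment of the naturals, hence an
    enumeration \<open>h\<close> of \<open>K\<close> with inverse \<open>h'\<close>.\<close>
  obtain h where h: "bij_betw h {..<card K} K"
    using ex_bij_betw_nat_finite[OF finK] by (auto simp: lessThan_atLeast0)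
  define r where "r = card K"
  define h' where "h' = inv_into {..<r} h"
  have hK: "h i \<in> K" if "i < r" for i using h that by (auto simp: bij_betw_def r_def)
  have h'r: "h' k < r" "h (h' k) = k" if "k \<in> K" for k
    using h that inv_into_into[of k h "{..<r}"] f_inv_into_f[of k h "{..<r}"]
    by (auto simp: bij_betw_def r_def h'_def)
  have sumK: "(\<Sum>k\<in>K. u k) = (\<Sum>i<r. u (h i))" for u :: "nat \<times> nat \<Rightarrow> 'k"
    using sum.reindex_bij_betw[OF h, of u] by (simp add: r_def)

  \<comment> \<open>At the positions in \<open>K\<close>, the equation \<open>T y (A s) = 0\<close>
    is a square linear system for \<open>s\<close> with matrix \<open>N y\<close> and right-hand
    side \<open>y - x\<close>. Its determinant is \<open>w\<close>, its Cramer numerators are the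
    \<open>R k\<close>, and duality makes \<open>N x\<close> the identity.\<close>
  define N where "N y = (\<lambda>(i, j). T y (a (h j)) (h i))" for y
  define w where "w y = detf r (N y)" for y
  define R where "R k y = (\<Sum>j<r. adjf r (N y) (h' k, j) * (y (h j) - x (h j)))" for k y
  have TA: "T y (A s) k = x k - y k + (\<Sum>j<r. T y (a (h j)) k * s (h j))" if "is_mat n n y" for y s k
  proof -
    have "T y (A s) = x - y + (\<Sum>k'\<in>K. fscale (s k') (T y (a k')))"
      unfolding T_def A_def mmul_add_left mmul_add_right mmul_sum_left mmul_sum_right
        mmul_fscale_left mmul_fscale_right mmul_idm_left[OF x_mat] mmul_idm_right[OF that]
      by (simp add: fun_eq_iff sum_fun_eval fscale_def sum_subtractf right_diff_distrib)
    then show ?thesis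
      by (simp add: sum_fun_eval fscale_def sumK mult.commute)
  qed
  have T_poly: "(\<lambda>y. T y b p) \<in> polyfun" for b p
    unfolding T_def by (simp, intro polyfun_intros polyfun_mmul)
  have N_poly: "(\<lambda>y. N y (i, j)) \<in> polyfun" for i j
    by (simp add: N_def T_poly)
  have w_poly: "w \<in> polyfun" unfolding w_def by (intro polyfun_detf N_poly)
  have R_poly: "R k \<in> polyfun" for k
    unfolding R_def by (intro polyfun_intros polyfun_adjf N_poly)
  have "w x = detf r (idm r)"
    unfolding w_def
  proof (rule detf_cong)
    fix i j assume ij: "i < r" "j < r"
    have "h i = h j \<longleftrightarrow> i = j" using h ij by (auto simp: bij_betw_def r_def inj_on_def)
    then show "N x (i, j) = idm r (i, j)"
      using dual[OF hK hK, OF ij(2,1)] a(2)[OF hK[OF ij(2)]] ij by (simp add: N_def idm_def)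
  qed
  then have wx: "w x = 1" by (simp add: detf_idm)
  have Rx: "R k x = 0" for k by (simp add: R_def)

  let ?\<phi> = "\<lambda>s p. mmul n (mmul n (A s) x) (adjf n (A s)) p / detf n (A s)"
  have conj: "?\<phi> s = mmul n (mmul n (A s) x) (fscale (1 / detf n (A s)) (adjf n (A s)))" for s
    unfolding mmul_fscale_right by (simp add: fscale_def)
  have \<phi>_orbit: "?\<phi> s \<in> orbit d x" if "detf n (A s) \<noteq> 0" for s
    unfolding orbit_eq n_def[symmetric] using that A by (intro image_eqI[OF refl]) auto
  have \<phi>0: "?\<phi> (\<lambda>_. 0) = x"
  proof -
    have A0: "A (\<lambda>_. 0) = idm n" by (simp add: fun_eq_iff A_entry)
    have "mmul n (idm n) (adjf n (idm n)) = (idm n :: 'k mat)"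
      using mmul_adjf_right[OF is_mat_idm, of n] by (simp add: detf_idm fscale_def)
    then have "adjf n (idm n) = (idm n :: 'k mat)"
      using mmul_idm_left[OF is_mat_adjf, of n "idm n :: 'k mat"] by simp
    then show ?thesis
      by (simp add: A0 detf_idm mmul_idm_left[OF x_mat] mmul_idm_right[OF x_mat])
  qed
  show ?thesis
  proof (rule zdim_rational[where P = "\<lambda>p s. mmul n (mmul n (A s) x) (adjf n (A s)) p"
        and q = "\<lambda>s. detf n (A s)" and w = w and R = R])
    show "(\<lambda>s. detf n (A s)) \<in> polyfun" by (intro polyfun_detf A_poly)
    show "(\<lambda>s. mmul n (mmul n (A s) x) (adjf n (A s)) p) \<in> polyfun" for p
      by (intro polyfun_mmul polyfun_adjf A_poly polyfun_intros)
    show "detf n (A (\<lambda>_. 0)) \<noteq> 0"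
    proof -
      have "A (\<lambda>_. 0) = idm n" by (simp add: fun_eq_iff A_entry)
      then show ?thesis by (simp add: detf_idm)
    qed
    show "w (?\<phi> (\<lambda>_. 0)) \<noteq> 0" unfolding \<phi>0 wx by simp
  next
    fix s k assume s: "s \<in> csupp K" "detf n (A s) \<noteq> 0" "k \<in> K"
    define y where "y = ?\<phi> s"
    have y: "y = mmul n (mmul n (A s) x) (fscale (1 / detf n (A s)) (adjf n (A s)))"
      unfolding y_def by (rule conj)
    have y_mat: "is_mat n n y"
      unfolding y by (rule is_mat_mmul[OF is_mat_mmul[OF A_mat x_mat] is_mat_fscale[OF is_mat_adjf]])
    have "mmul n y (A s) = mmul n (A s) x"
      unfolding y mmul_assoc[symmetric] scaled_adjf_inverse(2)[OF A_mat s(2)]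
      by (simp add: mmul_idm_right[OF x_mat])
    then have "T y (A s) = 0" by (simp add: T_def)
    then have "(\<Sum>j<r. N y (i, j) * s (h j)) = y (h i) - x (h i)" for i
      using TA[OF y_mat, of s "h i"] by (simp add: N_def algebra_simps)
    then have "R k y = (\<Sum>i<r. adjf r (N y) (h' k, i) * (\<Sum>j<r. N y (i, j) * s (h j)))"
      by (simp add: R_def)
    also have "\<dots> = w y * s k"
      using adjf_apply(2)[OF h'r(1)[OF s(3)], of "N y" "\<lambda>j. s (h j)"] h'r(2)[OF s(3)] by (simp add: w_def)
    finally show "R k (?\<phi> s) = w (?\<phi> s) * s k" unfolding y_def .
  next
    fix p y assume p: "p \<in> polyfun" and y: "y \<in> orbit d x"
      and van: "\<And>s. s \<in> csupp K \<Longrightarrow> detf n (A s) \<noteq> 0 \<Longrightarrow> p (?\<phi> s) = 0"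
    \<comment> \<open>Up to the factor \<open>w v ^ n\<close>, the determinant of the slice element
      with parameters \<open>R k v / w v\<close>. It is polynomial in \<open>v\<close>, and
      \<open>D v \<noteq> 0\<close> makes that element invertible.\<close>
    define D where "D v = detf n (fscale (w v) (idm n) + (\<Sum>k\<in>K. fscale (R k v) (a k)))" for v
    have D_poly: "D \<in> polyfun"
      unfolding D_def by (intro polyfun_detf) (simp add: sum_fun_eval fscale_def, intro polyfun_intros w_poly R_poly)
    have Dx: "D x = 1"
    proof -
      have "fscale (w x) (idm n) + (\<Sum>k\<in>K. fscale (R k x) (a k)) = idm n"
        by (simp add: wx Rx fun_eq_iff sum_fun_eval fscale_def)
      then show ?thesis by (simp add: D_def detf_idm)
    qed
    have generic: "\<exists>s\<in>csupp K. detf n (A s) \<noteq> 0 \<and> v = ?\<phi> s"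
      if v: "v \<in> orbit d x" and wv: "w v \<noteq> 0" and Dv: "D v \<noteq> 0" for v
    proof -
      obtain g b where g: "g \<in> Pgrp d" and b: "is_mat n n b" "mmul n g b = idm n"
        and v_eq: "v = mmul n (mmul n g x) b"
        using v unfolding orbit_def n_def by blast
      have gP: "g \<in> ?P" using g by (simp add: Pgrp_eq)
      then have g_mat: "is_mat n n g" using is_mat_flagidx unfolding n_def by blast
      have bP: "b \<in> ?P"
        using right_inverse_detf(3)[OF g_mat b] b(1) unfolding n_def by (intro inverse_flagidx[OF gP])
      have v_mat: "is_mat n n v" unfolding v_eq by (intro is_mat_mmul[OF is_mat_mmul[OF g_mat x_mat] b(1)])
      have Tv: "T v u = (\<Sum>k\<in>K. fscale (T x (mmul n b u) k) (mmul n g (f k)))" if u: "u \<in> ?P" for u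
      proof -
        have u_mat: "is_mat n n u" using u is_mat_flagidx unfolding n_def by blast
        have bu: "mmul n b u \<in> ?P" using mmul_flagidx[OF bP u] by simp
        \<comment> \<open>Multiplying \<open>b u x - x b u\<close> by \<open>g\<close> from the left
          gives \<open>u x - (g x b) u\<close>.\<close>
        have "mmul n g (T x (mmul n b u)) = T v u"
          unfolding T_def mmul_diff_right v_eq mmul_assoc b(2)
          by (simp add: mmul_idm_left[OF u_mat])
        moreover have "mmul n g (T x (mmul n b u)) = mmul n g (\<Sum>k\<in>K. fscale (T x (mmul n b u) k) (f k))"
          using expand[OF tangentI[OF bu]] by simp
        ultimately show ?thesis by (simp only: mmul_sum_right mmul_fscale_right)
      qed
      \<comment> \<open>\<open>T v\<close> takes values in \<open>g \<cdot> tangent d x\<close>. As \<open>N v = G C\<close> is invertible, so is \<open>G\<close>, hence an element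
        of that space vanishing on \<open>K\<close> is zero.\<close>
      define G where "G = (\<lambda>(i, j). mmul n g (f (h j)) (h i))"
      define C where "C = (\<lambda>(i, j). T x (mmul n b (a (h j))) (h i))"
      have Tv': "T v u (h i) = (\<Sum>m<r. G (i, m) * T x (mmul n b u) (h m))" if "u \<in> ?P" for u i
        unfolding Tv[OF that] by (simp add: sum_fun_eval fscale_def sumK G_def mult.commute)
      have "detf r (N v) = detf r (mmul r G C)"
        by (rule detf_cong) (simp add: N_def mmul_apply Tv' a hK C_def)
      then have detG: "detf r G \<noteq> 0" using wv by (auto simp: w_def detf_mmul)
      \<comment> \<open>The Cramer solution of the system at \<open>v\<close>, extended by zero
        outside \<open>K\<close>.\<close>
      define s where "s k = (if k \<in> K then R k v / w v else 0)" for k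
      have Ns: "(\<Sum>j<r. T v (a (h j)) (h i) * s (h j)) = v (h i) - x (h i)" if "i < r" for i
      proof -
        have s_h: "w v * s (h j) = (\<Sum>m<r. adjf r (N v) (j, m) * (v (h m) - x (h m)))" if "j < r" for j
        proof -
          have "h' (h j) = j" using h that by (simp add: h'_def bij_betw_def r_def)
          then show ?thesis using wv hK[OF that] by (simp add: s_def R_def)
        qed
        have "w v * (\<Sum>j<r. N v (i, j) * s (h j)) = (\<Sum>j<r. N v (i, j) * (w v * s (h j)))"
          by (simp add: sum_distrib_left mult_ac)
        also have "\<dots> = w v * (v (h i) - x (h i))"
          using adjf_apply(1)[OF that, of "N v" "\<lambda>m. v (h m) - x (h m)"] s_h by (simp add: w_def)
        finally show ?thesis using wv by (simp add: N_def)
      qed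
      have "T v (A s) (h i) = 0" if "i < r" for i
        using TA[OF v_mat, of s "h i"] Ns[OF that] by simp
      then have c0: "T x (mmul n b (A s)) (h m) = 0" if "m < r" for m
        using detf_nonzero_inj[OF detG, of "\<lambda>m. T x (mmul n b (A s)) (h m)"] Tv'[OF A] that by simp
      have "T x (mmul n b (A s)) k = 0" if "k \<in> K" for k
        using c0[OF h'r(1)[OF that]] h'r(2)[OF that] by simp
      then have "T v (A s) = 0" unfolding Tv[OF A] by (auto simp: fun_eq_iff sum_fun_eval fscale_def)
      then have comm: "mmul n (A s) x = mmul n v (A s)" by (simp add: T_def)
      have "fscale (w v) (idm n) + (\<Sum>k\<in>K. fscale (R k v) (a k)) = fscale (w v) (A s)"
        using wv by (auto simp: fun_eq_iff A_entry sum_fun_eval fscale_def distrib_left sum_distrib_left s_def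
            intro!: sum.cong)
      then have det: "detf n (A s) \<noteq> 0" using Dv by (auto simp: D_def detf_fscale)
      have "?\<phi> s = mmul n (mmul n v (A s)) (fscale (1 / detf n (A s)) (adjf n (A s)))"
        using conj[of s] unfolding comm .
      also have "\<dots> = v"
        unfolding mmul_assoc[symmetric] scaled_adjf_inverse(1)[OF A_mat det]
        by (rule mmul_idm_right[OF v_mat])
      finally have "?\<phi> s = v" .
      then show ?thesis using det by (intro bexI[of _ s]) (auto simp: s_def csupp_def)
    qed
    show "p y = 0"
    \<comment> \<open>The product of \<open>p\<close> with \<open>w\<close> and \<open>D\<close>
      vanishes on the whole orbit; as \<open>w * D\<close> is nonzero at \<open>x\<close>, primality
      of the orbit cancels it.\<close>
    proof (rule zprimeD[OF zprime_orbit[OF inf] p _ _ self_in_orbit _ y])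
      show "(\<lambda>v. w v * D v) \<in> polyfun" by (intro polyfun_intros w_poly D_poly)
      show "w x * D x \<noteq> 0" by (simp add: wx Dx)
      show "is_mat (ntot d) (ntot d) x" using x_mat by (simp add: n_def)
      fix v assume "v \<in> orbit d x"
      then show "p v * (w v * D v) = 0" using generic[of v] van by auto
    qed
  qed (use inf finK w_poly R_poly \<phi>_orbit in auto)
qed

section \<open>Extensions of the module of a nilpotent map\<close>

lemma csupp_eq_unit_sum:
  fixes u :: "'a \<Rightarrow> 'k::field"
  assumes "finite I" "u \<in> csupp I"
  shows "u = (\<Sum>i\<in>I. fscale (u i) (\<lambda>j. if j = i then 1 else 0))"
proof
  fix j
  have "(\<Sum>i\<in>I. fscale (u i) (\<lambda>j. if j = i then 1 else 0)) j = (\<Sum>i\<in>I. if i = j then u i else 0)"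
    unfolding sum_fun_eval by (intro sum.cong) (auto simp: fscale_def)
  then show "u j = (\<Sum>i\<in>I. fscale (u i) (\<lambda>j. if j = i then 1 else 0)) j"
    using assms by (simp add: csupp_def)
qed

lemma finite_if_independent_csupp:
  fixes S :: "('a \<Rightarrow> 'k::field) set"
  assumes "finite W" "S \<subseteq> csupp W" "fvs.independent S"
  shows "finite S"
proof -
  let ?E = "(\<lambda>i j. if j = i then 1 else 0 :: 'k) ` W"
  have "S \<subseteq> fvs.span ?E"
  proof
    fix u assume "u \<in> S"
    then have u: "u = (\<Sum>i\<in>W. fscale (u i) (\<lambda>j. if j = i then 1 else 0))"
      using assms csupp_eq_unit_sum by blast
    have "(\<Sum>i\<in>W. fscale (u i) (\<lambda>j. if j = i then 1 else 0)) \<in> fvs.span ?E"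
      by (intro fvs.span_sum fvs.span_scale fvs.span_base) auto
    then show "u \<in> fvs.span ?E" using u by metis
  qed
  then show ?thesis using fvs.independent_span_bound[OF _ assms(3)] assms(1) by blast
qed

text \<open>Since 0 lies in \<open>B\<close>, the hypothesis \<open>inj\<close> contains both
  injectivity of the linear map \<open>\<Theta>\<close> on \<open>csupp I\<close> and triviality of
  the intersection of its image with \<open>B\<close>.\<close>

lemma dim_direct_sum:
  fixes \<Theta> :: "('a \<Rightarrow> 'k::field) \<Rightarrow> ('b \<Rightarrow> 'k)"
  assumes B: "fvs.subspace B" "B \<subseteq> csupp W" "finite W" and I: "finite I"
    and add: "\<And>u v. \<Theta> (u + v) = \<Theta> u + \<Theta> v" and scale: "\<And>c u. \<Theta> (fscale c u) = fscale c (\<Theta> u)"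
    and inj: "\<And>u. u \<in> csupp I \<Longrightarrow> \<Theta> u \<in> B \<Longrightarrow> u = 0"
    and Z: "Z = {\<Theta> u + b | u b. u \<in> csupp I \<and> b \<in> B}"
  shows "fvs.dim Z = card I + fvs.dim B"
proof -
  define e where "e i = (\<lambda>j. if j = i then 1 else 0 :: 'k)" for i :: 'a
  have e: "e i \<in> csupp I" if "i \<in> I" for i using that by (auto simp: e_def csupp_def)
  have \<Theta>0: "\<Theta> 0 = 0" using add[of 0 0] by simp
  have sum: "\<Theta> (\<Sum>i\<in>J. g i) = (\<Sum>i\<in>J. \<Theta> (g i))" for J :: "'a set" and g
    by (induction J rule: infinite_finite_induct) (simp_all only: sum.infinite sum.empty sum.insert not_False_eq_True add \<Theta>0)
  obtain S where S: "S \<subseteq> B" "fvs.independent S" "B \<subseteq> fvs.span S" "card S = fvs.dim B"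
    using fvs.basis_exists by blast
  have finS: "finite S" using finite_if_independent_csupp[OF B(3) _ S(2)] S(1) B(2) by blast
  have inj_e: "inj_on (\<lambda>i. \<Theta> (e i)) I"
  proof (rule inj_onI)
    fix i j assume ij: "i \<in> I" "j \<in> I" "\<Theta> (e i) = \<Theta> (e j)"
    have "\<Theta> (e i + fscale (- 1) (e j)) = \<Theta> (e i) + fscale (- 1) (\<Theta> (e j))" by (simp only: add scale)
    also have "\<dots> = 0" using ij(3) by (simp add: fscale_def fun_eq_iff)
    finally have "e i + fscale (- 1) (e j) = 0"
      using ij B(1) fvs.subspace_0
      by (intro inj fvs.subspace_add[OF subspace_csupp] fvs.subspace_scale[OF subspace_csupp] e) auto
    then have "(e i + fscale (- 1) (e j)) i = 0" by simp
    then show "i = j" by (simp add: e_def fscale_def split: if_splits)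
  qed
  let ?E = "(\<lambda>i. \<Theta> (e i)) ` I"
  have disj: "?E \<inter> S = {}"
  proof (rule ccontr)
    assume "?E \<inter> S \<noteq> {}"
    then obtain i where i: "i \<in> I" "\<Theta> (e i) \<in> B" using S(1) by blast
    then have "e i = 0" using inj[OF e] by blast
    then have "e i i = 0" by simp
    then show False by (simp add: e_def)
  qed
  have "fvs.independent (?E \<union> S)"
    unfolding fvs.dependent_finite[OF finite_UnI[OF finite_imageI[OF I] finS]]
  proof (rule notI, elim exE conjE bexE)
    fix c v assume v: "v \<in> ?E \<union> S" "c v \<noteq> 0" and "(\<Sum>v\<in>?E \<union> S. fscale (c v) v) = 0"
    then have "(\<Sum>v\<in>?E. fscale (c v) v) + (\<Sum>v\<in>S. fscale (c v) v) = 0"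
      using I finS disj by (simp only: sum.union_disjoint finite_imageI)
    then have eq: "\<Theta> (\<Sum>i\<in>I. fscale (c (\<Theta> (e i))) (e i)) + (\<Sum>v\<in>S. fscale (c v) v) = 0"
      by (simp only: sum.reindex[OF inj_e] o_def sum scale)
    have "(\<Sum>v\<in>S. fscale (c v) v) \<in> B"
      using S(1) by (intro fvs.subspace_sum[OF B(1)] fvs.subspace_scale[OF B(1)]) auto
    then have "\<Theta> (\<Sum>i\<in>I. fscale (c (\<Theta> (e i))) (e i)) \<in> B"
      using fvs.subspace_neg[OF B(1)] eq[folded eq_neg_iff_add_eq_0] by simp
    then have z: "(\<Sum>i\<in>I. fscale (c (\<Theta> (e i))) (e i)) = 0"
      by (intro inj fvs.subspace_sum[OF subspace_csupp] fvs.subspace_scale[OF subspace_csupp] e)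
    then have "(\<Sum>v\<in>S. fscale (c v) v) = 0" using eq by (simp only: \<Theta>0 add_0_left)
    then have "\<forall>v\<in>S. c v = 0"
      using S(2) unfolding fvs.dependent_finite[OF finS] by blast
    moreover have "c (\<Theta> (e i)) = 0" if "i \<in> I" for i
    proof -
      have "(\<Sum>k\<in>I. fscale (c (\<Theta> (e k))) (e k)) i = (\<Sum>k\<in>I. if k = i then c (\<Theta> (e k)) else 0)"
        unfolding sum_fun_eval by (intro sum.cong) (auto simp: fscale_def e_def)
      then show ?thesis using z that I by simp
    qed
    ultimately show False using v by auto
  qed
  moreover have "?E \<union> S \<subseteq> Z"
  proof -
    have "\<Theta> (e i) + 0 \<in> Z" if "i \<in> I" for i
      unfolding Z using e[OF that] fvs.subspace_0[OF B(1)] by blast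
    moreover have "\<Theta> 0 + b \<in> Z" if "b \<in> B" for b
      unfolding Z using that fvs.subspace_0[OF subspace_csupp] by blast
    ultimately show ?thesis using S(1) unfolding \<Theta>0 add_0_left add_0_right by blast
  qed
  moreover have "Z \<subseteq> fvs.span (?E \<union> S)"
  proof
    fix z assume "z \<in> Z"
    then obtain u b where ub: "u \<in> csupp I" "b \<in> B" "z = \<Theta> u + b" unfolding Z by blast
    have "u = (\<Sum>i\<in>I. fscale (u i) (e i))"
      unfolding e_def by (rule csupp_eq_unit_sum[OF I ub(1)])
    from arg_cong[OF this, of \<Theta>] have "\<Theta> u = (\<Sum>i\<in>I. fscale (u i) (\<Theta> (e i)))"
      by (simp only: sum scale)
    moreover have "(\<Sum>i\<in>I. fscale (u i) (\<Theta> (e i))) \<in> fvs.span (?E \<union> S)"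
      by (intro fvs.span_sum fvs.span_scale fvs.span_base) auto
    moreover have "b \<in> fvs.span (?E \<union> S)"
      using ub(2) S(3) fvs.span_mono[of S "?E \<union> S"] by blast
    ultimately show "z \<in> fvs.span (?E \<union> S)"
      unfolding ub(3) by (simp only: fvs.span_add)
  qed
  ultimately have "fvs.dim Z = card (?E \<union> S)" by (intro fvs.dim_unique[OF _ _ _ refl])
  also have "\<dots> = card I + fvs.dim B"
    using I finS disj S(4) by (simp add: card_Un_disjoint card_image[OF inj_e])
  finally show ?thesis .
qed

section \<open>Block matrices and the relations of M(x)\<close>

definition block :: "nat \<Rightarrow> nat \<Rightarrow> 'k::zero mat \<Rightarrow> 'k mat \<Rightarrow> 'k mat \<Rightarrow> 'k mat" where
  "block p q A H D = (\<lambda>(r, c). if r < p then (if c < q then A (r, c) else H (r, c - q))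
     else (if c < q then 0 else D (r - p, c - q)))"

lemma sum_lessThan_add: "(\<Sum>s<p + q. f s) = (\<Sum>s<p. f s) + (\<Sum>s<q. f (p + s))"
  for p q :: nat and f :: "nat \<Rightarrow> 'a::comm_monoid_add"
  by (induction q) (auto simp: add.assoc)

lemma mmul_block:
  "mmul (m + m') (block p m A H D) (block m q A' H' D')
    = block p q (mmul m A A') (mmul m A H' + mmul m' H D') (mmul m' D D')"
  by (auto simp: fun_eq_iff mmul_apply block_def sum_lessThan_add)

lemma block_eq_iff:
  assumes "is_mat p q' H" "is_mat p q' H'"
  shows "block p q A H D = block p q A H' D \<longleftrightarrow> H = H'"
proof
  assume eq: "block p q A H D = block p q A H' D"
  show "H = H'"
  proof (rule ext, clarify)
    fix r c
    show "H (r, c) = H' (r, c)"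
    proof (cases "r < p")
      case True
      then show ?thesis using fun_cong[OF eq, of "(r, q + c)"] by (simp add: block_def)
    qed (use assms in \<open>auto simp: is_mat_def\<close>)
  qed
qed simp

lemma block_zero: "block p q (\<lambda>_. 0) (\<lambda>_. 0) (\<lambda>_. 0) = (\<lambda>_. 0)"
  by (auto simp: block_def fun_eq_iff)

lemma mmul_extend:
  assumes "r' \<le> r" "\<And>s c. r' \<le> s \<Longrightarrow> B (s, c) = 0"
  shows "mmul r A B = mmul r' A B"
proof (rule ext, clarify)
  fix i j
  show "mmul r A B (i, j) = mmul r' A B (i, j)"
    unfolding mmul_apply using assms by (intro sum.mono_neutral_right) auto
qed

lemma mmul_idm_truncate: "p \<le> n \<Longrightarrow> mmul n B (idm p) = (\<lambda>(r, c). if c < p then B (r, c) else 0)"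
proof (rule ext, clarify)
  fix r c assume "p \<le> n"
  have "mmul n B (idm p) (r, c) = (\<Sum>s<n. if s = c then (if c < p then B (r, c) else 0) else 0)"
    unfolding mmul_apply by (intro sum.cong) (auto simp: idm_def)
  then show "mmul n B (idm p) (r, c) = (if c < p then B (r, c) else 0)"
    using \<open>p \<le> n\<close> by simp
qed

definition restr :: "nat \<Rightarrow> nat \<Rightarrow> 'k::zero mat \<Rightarrow> 'k mat" where
  "restr p q u = (\<lambda>(r, c). if r < p \<and> c < q then u (r, c) else 0)"

lemma is_mat_restr: "is_mat p q (restr p q u)"
  by (auto simp: is_mat_def restr_def)

lemma restr_id: "is_mat p q u \<Longrightarrow> restr p q u = u"
  by (auto simp: is_mat_def restr_def fun_eq_iff not_less)

lemma Mx_simps: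
  "valid_arrow (length d) l (Alpha i) \<Longrightarrow> snd (Mx d l x) (Alpha i) = idm (Sig d i)"
  "valid_arrow (length d) l (Beta j) \<Longrightarrow> snd (Mx d l x) (Beta j) = restr (Sig d j) (Sig d (j + l + 1)) x"
  "fst (Mx d l x) = Sig d"
  by (auto simp: Mx_def idm_def restr_def fun_eq_iff)

text \<open>\<open>u\<close> maps V_{l+1} into V_0 = 0. For \<open>u = x\<close> this is the first
  relation of M(x); the general form also serves for the \<beta> components of normalised
  cocycles.\<close>

lemma restr_pu_first:
  fixes u :: "'k::comm_ring_1 mat"
  assumes "u \<in> pu d l" "l + 2 \<le> length d"
  shows "mmul (Sig d (l + 2)) (restr (Sig d 1) (Sig d (l + 2)) u) (idm (Sig d (l + 1))) = 0"
  using assms flagidx_entry[of u d "\<lambda>i. i - l - 1" "l + 1"] unfolding pu_eq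
  by (subst mmul_idm_truncate) (auto simp: Sig_mono Sig_0 fun_eq_iff restr_def)

text \<open>The restriction of \<open>u\<close> to V_{i+l+1} already has its image in V_i. The
  inclusion \<alpha>_i leaves no trace on the right, since zero-padded matrices do not record their
  target.\<close>

lemma restr_pu_next:
  fixes u :: "'k::comm_ring_1 mat"
  assumes u: "u \<in> pu d l" and i: "1 \<le> i" "i + l + 2 \<le> length d"
  shows "mmul (Sig d (i + l + 2)) (restr (Sig d (i + 1)) (Sig d (i + l + 2)) u) (idm (Sig d (i + l + 1)))
    = restr (Sig d i) (Sig d (i + l + 1)) u"
proof (rule ext, clarify)
  fix r c
  have m: "Sig d i \<le> Sig d (i + 1)" "Sig d (i + l + 1) \<le> Sig d (i + l + 2)" by (auto intro: Sig_mono)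
  have "u (r, c) = 0" if "c < Sig d (i + l + 1)" "Sig d i \<le> r"
    using flagidx_entry[OF u[unfolded pu_eq], of "i + l + 1" c r] that i by simp
  then show "mmul (Sig d (i + l + 2)) (restr (Sig d (i + 1)) (Sig d (i + l + 2)) u) (idm (Sig d (i + l + 1))) (r, c)
    = restr (Sig d i) (Sig d (i + l + 1)) u (r, c)"
    unfolding mmul_idm_truncate[OF m(2)] using m by (auto simp: restr_def not_less)
qed

section \<open>Cocycles as solutions of the linearised relations\<close>

lemma ext_rep_block:
  "ext_rep l M N H = (\<lambda>i. fst N i + fst M i,
     \<lambda>a. block (fst N (tgt l a)) (fst N (src l a)) (snd N a) (H a) (snd M a))"
  by (simp add: ext_rep_def block_def case_prod_unfold Let_def)

abbreviation acomp :: "(arrow \<times> nat \<times> nat \<Rightarrow> 'k) \<Rightarrow> arrow \<Rightarrow> 'k mat" where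
  "acomp z a \<equiv> (\<lambda>p. z (a, p))"

definition arrow_idx :: "nat list \<Rightarrow> nat \<Rightarrow> (arrow \<times> nat \<times> nat) set" where
  "arrow_idx d l = {(a, r, c). valid_arrow (length d) l a \<and> r < Sig d (tgt l a) \<and> c < Sig d (src l a)}"

lemma csupp_arrow_idx:
  "z \<in> csupp (arrow_idx d l) \<longleftrightarrow> (\<forall>a. if valid_arrow (length d) l a
     then is_mat (Sig d (tgt l a)) (Sig d (src l a)) (acomp z a) else acomp z a = (\<lambda>_. 0))"
proof -
  have "(if valid_arrow (length d) l a
      then is_mat (Sig d (tgt l a)) (Sig d (src l a)) (acomp z a) else acomp z a = (\<lambda>_. 0)) \<longleftrightarrow>
    (\<forall>r c. (a, r, c) \<notin> arrow_idx d l \<longrightarrow> z (a, r, c) = 0)" for a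
    by (auto simp: arrow_idx_def is_mat_def fun_eq_iff not_less)
  then show ?thesis by (simp add: csupp_def)
qed

lemma finite_arrow_idx: "finite (arrow_idx d l)"
proof (rule finite_subset)
  let ?t = "length d"
  show "arrow_idx d l \<subseteq> (Alpha ` {..?t} \<union> Beta ` {..?t}) \<times> {..<ntot d} \<times> {..<ntot d}"
    by (auto simp: arrow_idx_def valid_arrow_def split: arrow.splits
        intro: less_le_trans[OF _ Sig_le])
qed simp

lemma arrow_idx_alpha:
  "z \<in> csupp (arrow_idx d l) \<Longrightarrow> 1 \<le> i \<Longrightarrow> i + 1 \<le> length d \<Longrightarrow>
    is_mat (Sig d (i + 1)) (Sig d i) (acomp z (Alpha i))"
  unfolding csupp_arrow_idx by (drule spec[of _ "Alpha i"]) (simp add: valid_arrow_def src_def tgt_def)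

lemma arrow_idx_beta:
  "z \<in> csupp (arrow_idx d l) \<Longrightarrow> 1 \<le> j \<Longrightarrow> j + l + 1 \<le> length d \<Longrightarrow>
    is_mat (Sig d j) (Sig d (j + l + 1)) (acomp z (Beta j))"
  unfolding csupp_arrow_idx by (drule spec[of _ "Beta j"]) (simp add: valid_arrow_def src_def tgt_def)

text \<open>Product rule for \<open>Beta 1\<close> after \<open>Alpha (l + 1)\<close>: each summand
  replaces one arrow of M(x) by its component of \<open>z\<close>, and \<open>idm\<close> is the
  inclusion.\<close>

definition rel_first :: "nat list \<Rightarrow> nat \<Rightarrow> 'k::comm_ring_1 mat \<Rightarrow> (arrow \<times> nat \<times> nat \<Rightarrow> 'k) \<Rightarrow> 'k mat" where
  "rel_first d l x z =
     mmul (Sig d (l + 2)) (restr (Sig d 1) (Sig d (l + 2)) x) (acomp z (Alpha (l + 1)))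
     + mmul (Sig d (l + 2)) (acomp z (Beta 1)) (idm (Sig d (l + 1)))"

definition rel_next :: "nat list \<Rightarrow> nat \<Rightarrow> 'k::comm_ring_1 mat \<Rightarrow> (arrow \<times> nat \<times> nat \<Rightarrow> 'k) \<Rightarrow> nat \<Rightarrow> 'k mat" where
  "rel_next d l x z i =
     (mmul (Sig d (i + l + 2)) (restr (Sig d (i + 1)) (Sig d (i + l + 2)) x) (acomp z (Alpha (i + l + 1)))
       + mmul (Sig d (i + l + 2)) (acomp z (Beta (i + 1))) (idm (Sig d (i + l + 1))))
     - (acomp z (Beta i) + mmul (Sig d i) (acomp z (Alpha i)) (restr (Sig d i) (Sig d (i + l + 1)) x))"

text \<open>The upper right blocks of the relations of the extension are the linearised relations.\<close>

lemma ext_cocycles_Mx: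
  fixes x :: "'k::field mat"
  assumes x: "x \<in> pu d l"
  shows "z \<in> ext_cocycles (length d) l (Mx d l x) (Mx d l x) \<longleftrightarrow>
    z \<in> csupp (arrow_idx d l) \<and> (l + 2 \<le> length d \<longrightarrow> rel_first d l x z = 0) \<and>
    (\<forall>i. 1 \<le> i \<and> i + l + 2 \<le> length d \<longrightarrow> rel_next d l x z i = 0)"
proof -
  let ?t = "length d" and ?s = "Sig d" and ?M = "Mx d l x"
  have H: "(\<lambda>(r, c). z (a, r, c)) = acomp z a" for a by (auto simp: fun_eq_iff)
  let ?E = "snd (ext_rep l ?M ?M (acomp z))"
  have E: "?E a = block (?s (tgt l a)) (?s (src l a)) (snd ?M a) (acomp z a) (snd ?M a)" for a
    by (simp add: ext_rep_block Mx_simps)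
  have first: "mmul (?s (l + 2) + ?s (l + 2)) (?E (Beta 1)) (?E (Alpha (l + 1))) = (\<lambda>_. 0) \<longleftrightarrow>
      rel_first d l x z = 0" if z: "z \<in> csupp (arrow_idx d l)" and t: "l + 2 \<le> ?t"
  proof -
    have v: "valid_arrow ?t l (Beta 1)" "valid_arrow ?t l (Alpha (l + 1))"
      using t by (auto simp: valid_arrow_def)
    have "is_mat (?s 1) (?s (l + 1)) (rel_first d l x z)"
      using arrow_idx_beta[OF z, of 1] arrow_idx_alpha[OF z, of "l + 1"] t
      unfolding rel_first_def
      by (intro is_mat_add is_mat_mmul[OF is_mat_restr] is_mat_mmul[OF _ is_mat_idm]) auto
    moreover have "is_mat (?s 1) (?s (l + 1)) (0 :: 'k mat)" by (simp add: is_mat_def)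
    ultimately have "block (?s 1) (?s (l + 1)) 0 (rel_first d l x z) 0 = block (?s 1) (?s (l + 1)) 0 0 0
        \<longleftrightarrow> rel_first d l x z = 0"
      by (rule block_eq_iff)
    moreover have "mmul (?s (l + 2) + ?s (l + 2)) (?E (Beta 1)) (?E (Alpha (l + 1)))
        = block (?s 1) (?s (l + 1)) 0 (rel_first d l x z) 0"
      using restr_pu_first[OF x t] v
      by (simp add: E src_def tgt_def mmul_block Mx_simps rel_first_def del: plus_fun_apply)
    ultimately show ?thesis using block_zero[of "?s 1" "?s (l + 1)", where 'a = 'k] by (simp add: zero_fun_def)
  qed
  have "next": "mmul (?s (i + l + 2) + ?s (i + l + 2)) (?E (Beta (i + 1))) (?E (Alpha (i + l + 1)))
      = mmul (?s (i + 1) + ?s (i + 1)) (?E (Alpha i)) (?E (Beta i)) \<longleftrightarrow> rel_next d l x z i = 0"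
    if z: "z \<in> csupp (arrow_idx d l)" and i: "1 \<le> i" "i + l + 2 \<le> ?t" for i
  proof -
    have v: "valid_arrow ?t l (Beta (i + 1))" "valid_arrow ?t l (Alpha (i + l + 1))"
      "valid_arrow ?t l (Beta i)" "valid_arrow ?t l (Alpha i)"
      using i by (auto simp: valid_arrow_def)
    have m: "?s i \<le> ?s (i + 1)" by (rule Sig_mono) simp
    note zb = arrow_idx_beta[OF z, of "i + 1"] arrow_idx_beta[OF z, of i]
      and za = arrow_idx_alpha[OF z, of "i + l + 1"] arrow_idx_alpha[OF z, of i]
    define L where "L = mmul (?s (i + l + 2)) (restr (?s (i + 1)) (?s (i + l + 2)) x) (acomp z (Alpha (i + l + 1)))
       + mmul (?s (i + l + 2)) (acomp z (Beta (i + 1))) (idm (?s (i + l + 1)))"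
    define R where "R = acomp z (Beta i) + mmul (?s i) (acomp z (Alpha i)) (restr (?s i) (?s (i + l + 1)) x)"
    let ?x = "restr (?s i) (?s (i + l + 1)) x"
    have L: "is_mat (?s (i + 1)) (?s (i + l + 1)) L"
      using zb(1) za(1) i unfolding L_def
      by (intro is_mat_add is_mat_mmul[OF is_mat_restr] is_mat_mmul[OF _ is_mat_idm]) auto
    have R: "is_mat (?s (i + 1)) (?s (i + l + 1)) R"
      using zb(2) za(2) i m unfolding R_def
      by (intro is_mat_add is_mat_mmul[OF _ is_mat_restr]) (auto elim: is_mat_mono)
    have x_mat: "is_mat (?s i) (?s (i + l + 1)) ?x" by (rule is_mat_restr)
    have "mmul (?s (i + l + 2) + ?s (i + l + 2)) (?E (Beta (i + 1))) (?E (Alpha (i + l + 1)))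
        = block (?s (i + 1)) (?s (i + l + 1)) ?x L ?x"
      using restr_pu_next[OF x i] v
      by (simp add: E src_def tgt_def mmul_block Mx_simps L_def del: plus_fun_apply)
    \<comment> \<open>\<open>rel_ok\<close> sums the product at vertex \<open>i + 1\<close> instead of \<open>i\<close>; the surplus rows of \<open>Beta i\<close> vanish.\<close>
    moreover have "mmul (?s (i + 1) + ?s (i + 1)) (?E (Alpha i)) (?E (Beta i))
        = mmul (?s i + ?s i) (?E (Alpha i)) (?E (Beta i))"
    proof (rule mmul_extend)
      show "?s i + ?s i \<le> ?s (i + 1) + ?s (i + 1)" using m by simp
      show "?E (Beta i) (r, c) = 0" if "?s i + ?s i \<le> r" for r c
        using that v by (auto simp: E tgt_def src_def block_def Mx_simps restr_def)
    qed
    moreover have "mmul (?s i + ?s i) (?E (Alpha i)) (?E (Beta i)) = block (?s (i + 1)) (?s (i + l + 1)) ?x R ?x"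
      using zb(2) i v mmul_idm_left[OF x_mat]
      by (simp add: E src_def tgt_def mmul_block Mx_simps R_def mmul_idm_left del: plus_fun_apply)
    ultimately have "mmul (?s (i + l + 2) + ?s (i + l + 2)) (?E (Beta (i + 1))) (?E (Alpha (i + l + 1)))
      = mmul (?s (i + 1) + ?s (i + 1)) (?E (Alpha i)) (?E (Beta i)) \<longleftrightarrow> L = R"
      using block_eq_iff[OF L R] by metis
    then show ?thesis by (simp add: rel_next_def L_def R_def del: plus_fun_apply)
  qed
  have fstE: "fst (ext_rep l ?M ?M (acomp z)) = (\<lambda>i. ?s i + ?s i)"
    by (simp add: ext_rep_block Mx_simps)
  have rel: "rel_ok ?t l (ext_rep l ?M ?M (acomp z)) \<longleftrightarrow>
    (l + 2 \<le> ?t \<longrightarrow> mmul (?s (l + 2) + ?s (l + 2)) (?E (Beta 1)) (?E (Alpha (l + 1))) = (\<lambda>_. 0)) \<and>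
    (\<forall>i. 1 \<le> i \<and> i + l + 2 \<le> ?t \<longrightarrow>
      mmul (?s (i + l + 2) + ?s (i + l + 2)) (?E (Beta (i + 1))) (?E (Alpha (i + l + 1)))
      = mmul (?s (i + 1) + ?s (i + 1)) (?E (Alpha i)) (?E (Beta i)))"
    by (simp only: rel_ok_def Let_def case_prod_unfold fstE)
  have "z \<in> ext_cocycles ?t l ?M ?M \<longleftrightarrow> z \<in> csupp (arrow_idx d l) \<and> rel_ok ?t l (ext_rep l ?M ?M (acomp z))"
    unfolding ext_cocycles_def csupp_arrow_idx by (simp only: Let_def mem_Collect_eq H Mx_simps(3))
  also have "\<dots> \<longleftrightarrow> z \<in> csupp (arrow_idx d l) \<and> (l + 2 \<le> length d \<longrightarrow> rel_first d l x z = 0) \<and>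
    (\<forall>i. 1 \<le> i \<and> i + l + 2 \<le> length d \<longrightarrow> rel_next d l x z i = 0)"
    unfolding rel by (intro conj_cong imp_cong iff_allI refl first "next") simp_all
  finally show ?thesis .
qed

lemma rel_first_diff: "rel_first d l x (z - z') = rel_first d l x z - rel_first d l x z'"
  and rel_next_diff: "rel_next d l x (z - z') i = rel_next d l x z i - rel_next d l x z' i"
proof -
  have c: "acomp (z - z') a = acomp z a - acomp z' a" for a by (simp add: fun_eq_iff)
  show "rel_first d l x (z - z') = rel_first d l x z - rel_first d l x z'"
    unfolding rel_first_def c mmul_diff_left mmul_diff_right by (simp add: fun_eq_iff)
  show "rel_next d l x (z - z') i = rel_next d l x z i - rel_next d l x z' i"
    unfolding rel_next_def c mmul_diff_left mmul_diff_right by (simp add: fun_eq_iff)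
qed

lemma ext_cocycles_diff:
  fixes x :: "'k::field mat"
  assumes x: "x \<in> pu d l" and z: "z \<in> ext_cocycles (length d) l (Mx d l x) (Mx d l x)"
    "z' \<in> ext_cocycles (length d) l (Mx d l x) (Mx d l x)"
  shows "z - z' \<in> ext_cocycles (length d) l (Mx d l x) (Mx d l x)"
proof -
  have "z - z' \<in> csupp (arrow_idx d l)"
    using z fvs.subspace_diff[OF subspace_csupp] unfolding ext_cocycles_Mx[OF x] by blast
  then show ?thesis using z unfolding ext_cocycles_Mx[OF x] rel_first_diff rel_next_diff by simp
qed

section \<open>Coboundaries\<close>

definition coboundary :: "nat list \<Rightarrow> nat \<Rightarrow> 'k::comm_ring_1 mat \<Rightarrow> (nat \<Rightarrow> 'k mat) \<Rightarrow> (arrow \<times> nat \<times> nat \<Rightarrow> 'k)" where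
  "coboundary d l x \<phi> = (\<lambda>(a, p). if valid_arrow (length d) l a then
     (case a of
        Alpha i \<Rightarrow> (\<phi> i - mmul (Sig d (i + 1)) (\<phi> (i + 1)) (idm (Sig d i))) p
      | Beta j \<Rightarrow> (mmul (Sig d (j + l + 1)) (restr (Sig d j) (Sig d (j + l + 1)) x) (\<phi> (j + l + 1))
          - mmul (Sig d j) (\<phi> j) (restr (Sig d j) (Sig d (j + l + 1)) x)) p)
     else 0)"

text \<open>Composing with the inclusion \<alpha>_i on the left does not change a zero-padded
  matrix, so \<open>\<phi> i\<close> stands without a factor.\<close>

lemma coboundary_alpha:
  "1 \<le> i \<Longrightarrow> i + 1 \<le> length d \<Longrightarrow> acomp (coboundary d l x \<phi>) (Alpha i)
    = \<phi> i - mmul (Sig d (i + 1)) (\<phi> (i + 1)) (idm (Sig d i))"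
  by (simp add: coboundary_def valid_arrow_def fun_eq_iff)

lemma coboundary_beta:
  "1 \<le> j \<Longrightarrow> j + l + 1 \<le> length d \<Longrightarrow> acomp (coboundary d l x \<phi>) (Beta j)
    = mmul (Sig d (j + l + 1)) (restr (Sig d j) (Sig d (j + l + 1)) x) (\<phi> (j + l + 1))
      - mmul (Sig d j) (\<phi> j) (restr (Sig d j) (Sig d (j + l + 1)) x)"
  by (simp add: coboundary_def valid_arrow_def fun_eq_iff)

abbreviation vertex_families :: "nat list \<Rightarrow> (nat \<Rightarrow> 'k::zero mat) set" where
  "vertex_families d \<equiv> {\<phi>. \<forall>i. is_mat (Sig d i) (Sig d i) (\<phi> i)}"

lemma ext_coboundaries_Mx:
  fixes x :: "'k::field mat"
  shows "ext_coboundaries (length d) l (Mx d l x) (Mx d l x) = coboundary d l x ` vertex_families d"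
proof -
  let ?M = "Mx d l x"
  have *: "(\<forall>a r c. z (a, r, c) = (if valid_arrow (length d) l a then
        mmul (Sig d (src l a)) (snd ?M a) (\<phi> (src l a)) (r, c)
        - mmul (Sig d (tgt l a)) (\<phi> (tgt l a)) (snd ?M a) (r, c) else 0)) \<longleftrightarrow> z = coboundary d l x \<phi>"
    if \<phi>: "\<phi> \<in> vertex_families d" for z and \<phi> :: "nat \<Rightarrow> 'k mat"
  proof -
    have "(if valid_arrow (length d) l a then
        mmul (Sig d (src l a)) (snd ?M a) (\<phi> (src l a)) (r, c)
        - mmul (Sig d (tgt l a)) (\<phi> (tgt l a)) (snd ?M a) (r, c) else 0) = coboundary d l x \<phi> (a, r, c)" for a r c
    proof (cases a)
      case (Alpha i)
      then show ?thesis using \<phi> mmul_idm_left[of "Sig d i" "Sig d i" "\<phi> i"]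
        by (auto simp: coboundary_def Mx_simps src_def tgt_def)
    next
      case (Beta j)
      then show ?thesis by (auto simp: coboundary_def Mx_simps src_def tgt_def)
    qed
    then show ?thesis by (auto simp: fun_eq_iff)
  qed
  show ?thesis
  proof (rule equalityI; rule subsetI)
    fix z assume "z \<in> ext_coboundaries (length d) l ?M ?M"
    then obtain Hc \<phi> where Hc: "z = Hc \<and> (\<forall>i. is_mat (Sig d i) (Sig d i) (\<phi> i)) \<and>
      (\<forall>a r c. Hc (a, r, c) = (if valid_arrow (length d) l a then
        mmul (Sig d (src l a)) (snd ?M a) (\<phi> (src l a)) (r, c)
        - mmul (Sig d (tgt l a)) (\<phi> (tgt l a)) (snd ?M a) (r, c) else 0))"
      unfolding ext_coboundaries_def Mx_simps(3) mem_Collect_eq by (elim exE) (rule that)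
    then have \<phi>: "\<phi> \<in> vertex_families d" by simp
    have z: "\<forall>a r c. z (a, r, c) = (if valid_arrow (length d) l a then
        mmul (Sig d (src l a)) (snd ?M a) (\<phi> (src l a)) (r, c)
        - mmul (Sig d (tgt l a)) (\<phi> (tgt l a)) (snd ?M a) (r, c) else 0)"
      unfolding Hc[THEN conjunct1] using Hc by (elim conjE)
    show "z \<in> coboundary d l x ` vertex_families d"
      using *[OF \<phi>, THEN iffD1, OF z] \<phi> by (rule image_eqI)
  next
    fix z assume "z \<in> coboundary d l x ` vertex_families d"
    then obtain \<phi> where \<phi>: "\<phi> \<in> vertex_families d" and z: "z = coboundary d l x \<phi>"
      by (elim imageE) (rule that)
    show "z \<in> ext_coboundaries (length d) l ?M ?M"
      unfolding ext_coboundaries_def Mx_simps(3) mem_Collect_eq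
      using *[OF \<phi>, THEN iffD2, OF z] \<phi> by (intro exI[of _ z] exI[of _ \<phi>] conjI refl) simp_all
  qed
qed

lemma coboundary_add: "coboundary d l x (\<lambda>i. \<phi> i + \<psi> i) = coboundary d l x \<phi> + coboundary d l x \<psi>"
  unfolding coboundary_def mmul_add_left mmul_add_right
  by (auto simp: fun_eq_iff split: arrow.split)

lemma coboundary_fscale: "coboundary d l x (\<lambda>i. fscale c (\<phi> i)) = fscale c (coboundary d l x \<phi>)"
  unfolding coboundary_def mmul_fscale_left mmul_fscale_right
  by (auto simp: fun_eq_iff fscale_def right_diff_distrib split: arrow.split)

lemma subspace_coboundaries:
  fixes x :: "'k::field mat"
  shows "fvs.subspace (ext_coboundaries (length d) l (Mx d l x) (Mx d l x))"
  unfolding ext_coboundaries_Mx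
proof (rule fvs.subspaceI)
  have "fscale 0 (coboundary d l x (\<lambda>_. 0)) = coboundary d l x (\<lambda>_. fscale 0 0)"
    by (rule coboundary_fscale[symmetric])
  moreover have "(\<lambda>_. fscale 0 0) \<in> vertex_families d" by (auto simp: is_mat_def fscale_def)
  ultimately show "0 \<in> coboundary d l x ` vertex_families d"
    by (intro image_eqI[of _ _ "\<lambda>_. fscale 0 0"]) (simp_all only: fvs.scale_zero_left)
next
  fix u v assume "u \<in> coboundary d l x ` vertex_families d" "v \<in> coboundary d l x ` vertex_families d"
  then obtain \<phi> \<psi> where "\<phi> \<in> vertex_families d" "\<psi> \<in> vertex_families d"
    and uv: "u = coboundary d l x \<phi>" "v = coboundary d l x \<psi>" by (elim imageE) (rule that)
  then have "(\<lambda>i. \<phi> i + \<psi> i) \<in> vertex_families d" by (auto intro: is_mat_add)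
  then show "u + v \<in> coboundary d l x ` vertex_families d"
    unfolding uv coboundary_add[symmetric] by (rule imageI)
next
  fix c u assume "u \<in> coboundary d l x ` vertex_families d"
  then obtain \<phi> where "\<phi> \<in> vertex_families d" and u: "u = coboundary d l x \<phi>" by (elim imageE) (rule that)
  then have "(\<lambda>i. fscale c (\<phi> i)) \<in> vertex_families d" by (auto intro: is_mat_fscale)
  then show "fscale c u \<in> coboundary d l x ` vertex_families d"
    unfolding u coboundary_fscale[symmetric] by (rule imageI)
qed

text \<open>Inserted into the linearised relations, the terms of a coboundary cancel in pairs or
  vanish by the relations of M(x).\<close>

lemma coboundaries_subset_cocycles:
  fixes x :: "'k::field mat"
  assumes x: "x \<in> pu d l"
  shows "ext_coboundaries (length d) l (Mx d l x) (Mx d l x) \<subseteq> ext_cocycles (length d) l (Mx d l x) (Mx d l x)"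
  unfolding ext_coboundaries_Mx
proof (rule image_subsetI)
  let ?s = "Sig d" and ?t = "length d"
  fix \<phi> :: "nat \<Rightarrow> 'k mat" assume "\<phi> \<in> vertex_families d"
  then have \<phi>: "is_mat (?s i) (?s i) (\<phi> i)" for i by auto
  let ?z = "coboundary d l x \<phi>"
  have "?z \<in> csupp (arrow_idx d l)"
    unfolding csupp_arrow_idx
  proof
    fix a
    show "if valid_arrow ?t l a then is_mat (?s (tgt l a)) (?s (src l a)) (acomp ?z a)
      else acomp ?z a = (\<lambda>_. 0)"
    proof (cases "valid_arrow ?t l a")
      case False
      then show ?thesis by (simp add: coboundary_def)
    next
      case True
      then show ?thesis
      proof (cases a)
        case (Alpha i)
        have "is_mat (?s (i + 1)) (?s i) (\<phi> i - mmul (?s (i + 1)) (\<phi> (i + 1)) (idm (?s i)))"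
          by (intro is_mat_diff is_mat_mmul[OF \<phi> is_mat_idm] is_mat_mono[OF \<phi>]) (auto simp: Sig_mono)
        then show ?thesis using True Alpha coboundary_alpha[of i d l x \<phi>]
          by (simp add: src_def tgt_def valid_arrow_def)
      next
        case (Beta j)
        have "is_mat (?s j) (?s (j + l + 1))
            (mmul (?s (j + l + 1)) (restr (?s j) (?s (j + l + 1)) x) (\<phi> (j + l + 1))
              - mmul (?s j) (\<phi> j) (restr (?s j) (?s (j + l + 1)) x))"
          by (rule is_mat_diff[OF is_mat_mmul[OF is_mat_restr \<phi>] is_mat_mmul[OF \<phi> is_mat_restr]])
        then show ?thesis using True Beta coboundary_beta[of j l d x \<phi>]
          by (simp add: src_def tgt_def valid_arrow_def)
      qed
    qed
  qed
  moreover have "rel_first d l x ?z = 0" if t: "l + 2 \<le> ?t"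
  proof -
    let ?x = "restr (?s 1) (?s (l + 2)) x"
    have z: "acomp ?z (Alpha (l + 1)) = \<phi> (l + 1) - mmul (?s (l + 2)) (\<phi> (l + 2)) (idm (?s (l + 1)))"
      "acomp ?z (Beta 1) = mmul (?s (l + 2)) ?x (\<phi> (l + 2)) - mmul (?s 1) (\<phi> 1) ?x"
      using coboundary_alpha[of "l + 1" d l x \<phi>] coboundary_beta[of 1 l d x \<phi>] t by simp_all
    \<comment> \<open>The inserted identity of V_{l+1} is also the matrix of
      \<open>Alpha (l + 1)\<close>; regrouping exposes the product killed by the relation.\<close>
    have "mmul (?s (l + 2)) ?x (\<phi> (l + 1)) = mmul (?s (l + 2)) ?x (mmul (?s (l + 1)) (idm (?s (l + 1))) (\<phi> (l + 1)))"
      by (simp only: mmul_idm_left[OF \<phi>])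
    also have "\<dots> = 0" unfolding mmul_assoc restr_pu_first[OF x t] by (rule mmul_zero_left)
    finally have 1: "mmul (?s (l + 2)) ?x (\<phi> (l + 1)) = 0" .
    have 2: "mmul (?s (l + 2)) (mmul (?s 1) (\<phi> 1) ?x) (idm (?s (l + 1))) = 0"
      unfolding mmul_assoc[symmetric] restr_pu_first[OF x t] by (rule mmul_zero_right)
    show ?thesis
      unfolding rel_first_def z mmul_diff_left mmul_diff_right 1 2 mmul_assoc by (simp add: fun_eq_iff)
  qed
  moreover have "rel_next d l x ?z i = 0" if i: "1 \<le> i" "i + l + 2 \<le> ?t" for i
  proof -
    let ?x = "restr (?s (i + 1)) (?s (i + l + 2)) x" and ?y = "restr (?s i) (?s (i + l + 1)) x"
    have z: "acomp ?z (Alpha (i + l + 1)) = \<phi> (i + l + 1) - mmul (?s (i + l + 2)) (\<phi> (i + l + 2)) (idm (?s (i + l + 1)))"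
      "acomp ?z (Beta (i + 1)) = mmul (?s (i + l + 2)) ?x (\<phi> (i + l + 2)) - mmul (?s (i + 1)) (\<phi> (i + 1)) ?x"
      "acomp ?z (Alpha i) = \<phi> i - mmul (?s (i + 1)) (\<phi> (i + 1)) (idm (?s i))"
      "acomp ?z (Beta i) = mmul (?s (i + l + 1)) ?y (\<phi> (i + l + 1)) - mmul (?s i) (\<phi> i) ?y"
      using coboundary_alpha[of "i + l + 1" d l x \<phi>] coboundary_beta[of "i + 1" l d x \<phi>]
        coboundary_alpha[of i d l x \<phi>] coboundary_beta[of i l d x \<phi>] i by simp_all
    have "mmul (?s (i + l + 2)) ?x (\<phi> (i + l + 1))
        = mmul (?s (i + l + 2)) ?x (mmul (?s (i + l + 1)) (idm (?s (i + l + 1))) (\<phi> (i + l + 1)))"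
      by (simp only: mmul_idm_left[OF \<phi>])
    also have "\<dots> = mmul (?s (i + l + 1)) ?y (\<phi> (i + l + 1))"
      unfolding mmul_assoc restr_pu_next[OF x i] ..
    finally have 1: "mmul (?s (i + l + 2)) ?x (\<phi> (i + l + 1)) = mmul (?s (i + l + 1)) ?y (\<phi> (i + l + 1))" .
    have 2: "mmul (?s (i + l + 2)) (mmul (?s (i + 1)) (\<phi> (i + 1)) ?x) (idm (?s (i + l + 1)))
        = mmul (?s (i + 1)) (\<phi> (i + 1)) ?y"
      unfolding mmul_assoc[symmetric] restr_pu_next[OF x i] ..
    have 3: "mmul (?s i) (mmul (?s (i + 1)) (\<phi> (i + 1)) (idm (?s i))) ?y = mmul (?s (i + 1)) (\<phi> (i + 1)) ?y"
      unfolding mmul_assoc[symmetric] mmul_idm_left[OF is_mat_restr] ..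
    show ?thesis
      unfolding rel_next_def z mmul_diff_left mmul_diff_right 1 2 3 mmul_assoc by (simp add: fun_eq_iff)
  qed
  ultimately show "?z \<in> ext_cocycles ?t l (Mx d l x) (Mx d l x)"
    unfolding ext_cocycles_Mx[OF x] by blast
qed

section \<open>Normalised cocycles and the comparison with the tangent space\<close>

definition beta_family :: "nat list \<Rightarrow> nat \<Rightarrow> 'k::comm_ring_1 mat \<Rightarrow> (arrow \<times> nat \<times> nat \<Rightarrow> 'k)" where
  "beta_family d l u = (\<lambda>(a, p). if valid_arrow (length d) l a then
     (case a of Alpha i \<Rightarrow> 0 | Beta j \<Rightarrow> restr (Sig d j) (Sig d (j + l + 1)) u p) else 0)"

lemma beta_family_add: "beta_family d l (u + v) = beta_family d l u + beta_family d l v"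
  and beta_family_fscale: "beta_family d l (fscale c u) = fscale c (beta_family d l u)"
  by (auto simp: beta_family_def fun_eq_iff restr_def fscale_def split: arrow.split)

lemma beta_family_simps:
  "acomp (beta_family d l u) (Alpha i) = 0"
  "1 \<le> j \<Longrightarrow> j + l + 1 \<le> length d \<Longrightarrow>
     acomp (beta_family d l u) (Beta j) = restr (Sig d j) (Sig d (j + l + 1)) u"
  by (auto simp: beta_family_def fun_eq_iff valid_arrow_def)

text \<open>With zero \<alpha> components the linearised relations at \<open>x\<close> become the
  relations of M(u).\<close>

lemma beta_family_cocycle:
  fixes x u :: "'k::field mat"
  assumes x: "x \<in> pu d l" and u: "u \<in> pu d l"
  shows "beta_family d l u \<in> ext_cocycles (length d) l (Mx d l x) (Mx d l x)"
  unfolding ext_cocycles_Mx[OF x]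
proof (intro conjI impI allI)
  show "beta_family d l u \<in> csupp (arrow_idx d l)"
    by (auto simp: csupp_def arrow_idx_def beta_family_def restr_def src_def tgt_def valid_arrow_def
        split: arrow.splits)
  show "rel_first d l x (beta_family d l u) = 0" if "l + 2 \<le> length d"
    using restr_pu_first[OF u that] beta_family_simps(2)[of 1 l d u] that
    unfolding rel_first_def beta_family_simps(1) mmul_zero_right by simp
  show "rel_next d l x (beta_family d l u) i = 0" if "1 \<le> i \<and> i + l + 2 \<le> length d" for i
    using restr_pu_next[OF u, of i] beta_family_simps(2)[of "i + 1" l d u] beta_family_simps(2)[of i l d u] that
    unfolding rel_next_def beta_family_simps(1) mmul_zero_right mmul_zero_left by simp
qed

lemma sum_mono_neutral_lessThan:
  fixes f g :: "nat \<Rightarrow> 'k::comm_monoid_add"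
  assumes "p \<le> n" "\<And>k. k < p \<Longrightarrow> f k = g k" "\<And>k. p \<le> k \<Longrightarrow> k < n \<Longrightarrow> g k = 0"
  shows "(\<Sum>k<p. f k) = (\<Sum>k<n. g k)"
  by (rule sum.mono_neutral_cong_left) (use assms in auto)

text \<open>Subtracting a suitable coboundary kills the components of a cocycle at all \<open>\<alpha>\<close>; the cocycle condition then says
  that the components at the \<open>\<beta>\<close> are restrictions of a single map.\<close>

lemma cocycle_decomposition:
  fixes x :: "'k::field mat"
  assumes x: "x \<in> pu d l" and z: "z \<in> ext_cocycles (length d) l (Mx d l x) (Mx d l x)"
  shows "\<exists>u\<in>pu d l. \<exists>b\<in>ext_coboundaries (length d) l (Mx d l x) (Mx d l x). z = beta_family d l u + b"
proof -
  let ?s = "Sig d" and ?t = "length d"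
  \<comment> \<open>Solves \<open>\<phi> i - \<phi> (i + 1) \<alpha>_i = z (Alpha i)\<close>
    recursively: the equation prescribes \<open>\<phi> (i + 1)\<close> on V_i, and the remaining
    basis vectors of V_{i+1} are sent to 0.\<close>
  define \<phi> where "\<phi> = rec_nat (\<lambda>_. 0) (\<lambda>i \<phi>i (r, c). if r < ?s (i + 1) \<and> c < ?s i then \<phi>i (r, c) - z (Alpha i, r, c) else 0)"
  have \<phi>_Suc: "\<phi> (Suc i) (r, c) = (if r < ?s (i + 1) \<and> c < ?s i then \<phi> i (r, c) - z (Alpha i, r, c) else 0)" for i r c
    by (simp add: \<phi>_def)
  have \<phi>_mat: "is_mat (?s i) (?s i) (\<phi> i)" for i
  proof (cases i)
    case 0
    then show ?thesis by (simp add: \<phi>_def is_mat_def)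
  next
    case (Suc j)
    then show ?thesis using Sig_mono[of j "Suc j" d] by (auto simp: is_mat_def \<phi>_Suc)
  qed
  let ?b = "coboundary d l x \<phi>"
  have b: "?b \<in> ext_coboundaries ?t l (Mx d l x) (Mx d l x)"
    unfolding ext_coboundaries_Mx using \<phi>_mat by blast
  define y where "y = z - ?b"
  have y: "y \<in> ext_cocycles ?t l (Mx d l x) (Mx d l x)"
    unfolding y_def using ext_cocycles_diff[OF x z] coboundaries_subset_cocycles[OF x] b by blast
  have z_supp: "z \<in> csupp (arrow_idx d l)" and y_supp: "y \<in> csupp (arrow_idx d l)"
    using z y by (auto simp: ext_cocycles_Mx[OF x])
  have alpha: "acomp y (Alpha i) = 0" if i: "1 \<le> i" "i + 1 \<le> ?t" for i
  proof (rule ext, clarify)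
    fix r c
    have m: "?s i \<le> ?s (i + 1)" by (rule Sig_mono) simp
    have "acomp ?b (Alpha i) (r, c) = \<phi> i (r, c) - (if c < ?s i then \<phi> (i + 1) (r, c) else 0)"
      using fun_cong[OF coboundary_alpha[OF i, of l x \<phi>], of "(r, c)"]
      unfolding mmul_idm_truncate[OF m] by simp
    also have "\<dots> = z (Alpha i, r, c)"
      using \<phi>_Suc[of i r c] \<phi>_mat[of i] arrow_idx_alpha[OF z_supp i] m by (auto simp: is_mat_def not_less)
    finally show "acomp y (Alpha i) (r, c) = 0 (r, c)" by (simp add: y_def)
  qed
  have y_first: "y (Beta 1, r, c) = 0" if t: "l + 2 \<le> ?t" and c: "c < ?s (l + 1)" for r c
  proof -
    have m: "?s (l + 1) \<le> ?s (l + 2)" by (rule Sig_mono) simp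
    have "rel_first d l x y = 0" using y t by (simp add: ext_cocycles_Mx[OF x])
    then have "rel_first d l x y (r, c) = 0" by simp
    then show ?thesis
      using alpha[of "l + 1"] t c
      unfolding rel_first_def mmul_idm_truncate[OF m] by (simp add: mmul_apply fun_eq_iff)
  qed
  have y_next: "y (Beta (i + 1), r, c) = y (Beta i, r, c)"
    if i: "1 \<le> i" "i + l + 2 \<le> ?t" and c: "c < ?s (i + l + 1)" for i r c
  proof -
    have m: "?s (i + l + 1) \<le> ?s (i + l + 2)" by (rule Sig_mono) simp
    have "rel_next d l x y i = 0" using y i by (simp add: ext_cocycles_Mx[OF x])
    then have "rel_next d l x y i (r, c) = 0" by simp
    then show ?thesis
      using alpha[of "i + l + 1"] alpha[of i] i c
      unfolding rel_next_def mmul_idm_truncate[OF m] by (simp add: mmul_apply fun_eq_iff)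
  qed
  define u where "u p = (if l + 2 \<le> ?t then y (Beta (?t - l - 1), p) else 0)" for p
  \<comment> \<open>Downward induction from the last \<beta>: \<open>y_next\<close> makes each
    component the restriction of the following one.\<close>
  have yu: "y (Beta j, r, c) = u (r, c)" if j: "1 \<le> j" "j + l + 1 \<le> ?t" and c: "c < ?s (j + l + 1)" for j r c
  proof -
    have "j \<le> ?t - l - 1" using j by simp
    then have "\<forall>c < ?s (j + l + 1). y (Beta j, r, c) = u (r, c)"
    proof (induction rule: inc_induct)
      case base
      then show ?case using j by (simp add: u_def)
    next
      case (step k)
      show ?case
      proof (intro allI impI)
        fix c assume c: "c < ?s (k + l + 1)"
        then have "c < ?s (Suc k + l + 1)" using Sig_mono[of "k + l + 1" "Suc k + l + 1" d] by simp
        then have "y (Beta (Suc k), r, c) = u (r, c)" using step.IH by blast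
        then show "y (Beta k, r, c) = u (r, c)" using y_next[of k c r] step.hyps j c by simp
      qed
    qed
    then show ?thesis using c by blast
  qed
  have y_row: "y (Beta j, r, c) = 0" if "1 \<le> j" "j + l + 1 \<le> ?t" "?s j \<le> r \<or> ?s (j + l + 1) \<le> c" for j r c
    using arrow_idx_beta[OF y_supp that(1,2)] that(3) by (auto simp: is_mat_def)
  have u: "u \<in> pu d l"
    unfolding pu_eq csupp_def
  proof (clarify, rule ccontr)
    fix r c assume rc: "(r, c) \<notin> flagidx d (\<lambda>i. i - l - 1)" and nz: "u (r, c) \<noteq> 0"
    have t: "l + 2 \<le> ?t" using nz by (auto simp: u_def split: if_splits)
    then have nz': "y (Beta (?t - l - 1), r, c) \<noteq> 0" using nz by (simp add: u_def)
    have "c < ntot d"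
    proof (rule ccontr)
      assume "\<not> c < ntot d"
      moreover have "?t - l - 1 + l + 1 = ?t" using t by simp
      ultimately show False using y_row[of "?t - l - 1" r c] nz' t by (simp add: Sig_ge)
    qed
    then obtain i where i: "i \<le> ?t" "c < ?s i" "?s (i - l - 1) \<le> r"
      using rc by (auto simp: flagidx_def not_less)
    show False
    \<comment> \<open>For \<open>i <= l + 1\<close> the column belongs to V_{l+1}, where
      \<open>y_first\<close> applies. Otherwise \<open>Beta (i - l - 1)\<close> has source V_i, and
      its rows end at \<open>Sig d (i - l - 1)\<close>.\<close>
    proof (cases "i \<le> l + 1")
      case True
      then have c: "c < ?s (l + 1)" using i(2) Sig_mono[of i "l + 1" d] by simp
      then have "c < ?s (1 + l + 1)" using Sig_mono[of "l + 1" "1 + l + 1" d] by simp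
      then show False using y_first[OF t c, of r] yu[of 1 c r] nz t by simp
    next
      case False
      then have "1 \<le> i - l - 1" by simp
      then show False using y_row[of "i - l - 1" r c] yu[of "i - l - 1" c r] i nz by simp
    qed
  qed
  have "y = beta_family d l u"
  proof (rule ext, clarify)
    fix a r c
    show "y (a, r, c) = beta_family d l u (a, r, c)"
    proof (cases "valid_arrow ?t l a")
      case False
      then show ?thesis using y_supp by (auto simp: beta_family_def csupp_def arrow_idx_def)
    next
      case True
      show ?thesis
      proof (cases a)
        case (Alpha i)
        then show ?thesis using True fun_cong[OF alpha[of i], of "(r, c)"]
          by (simp add: beta_family_def valid_arrow_def)
      next
        case (Beta j)
        then show ?thesis using True yu[of j c r] y_row[of j r c]
          by (auto simp: beta_family_def valid_arrow_def restr_def not_less)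
      qed
    qed
  qed
  then have "z = beta_family d l u + ?b" unfolding y_def by (simp only: diff_eq_eq)
  then show ?thesis using u b by blast
qed

text \<open>Vanishing of the \<alpha> components of a coboundary means that each
  \<open>\<phi> i\<close> is the restriction of the last one, which therefore preserves the flag.
  The \<beta> components are then restrictions of its commutator with \<open>x\<close>.\<close>

lemma beta_family_coboundary_iff:
  fixes x u :: "'k::field mat"
  assumes x: "x \<in> pu d l" and u: "u \<in> pu d l" and l: "l < length d"
  shows "beta_family d l u \<in> ext_coboundaries (length d) l (Mx d l x) (Mx d l x) \<longleftrightarrow> u \<in> tangent d x"
proof
  let ?s = "Sig d" and ?t = "length d"
  assume "beta_family d l u \<in> ext_coboundaries ?t l (Mx d l x) (Mx d l x)"
  then obtain \<phi> where \<phi>: "\<And>i. is_mat (?s i) (?s i) (\<phi> i)" and eq: "beta_family d l u = coboundary d l x \<phi>"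
    unfolding ext_coboundaries_Mx by blast
  have step: "\<phi> i (r, c) = \<phi> (i + 1) (r, c)" if i: "1 \<le> i" "i + 1 \<le> ?t" and c: "c < ?s i" for i r c
  proof -
    have m: "?s i \<le> ?s (i + 1)" by (rule Sig_mono) simp
    have "(\<phi> i - mmul (?s (i + 1)) (\<phi> (i + 1)) (idm (?s i))) (r, c) = 0"
      using coboundary_alpha[OF i, of l x \<phi>] beta_family_simps(1)[of d l u i]
      unfolding eq by simp
    then show ?thesis unfolding mmul_idm_truncate[OF m] using c by simp
  qed
  have last: "\<phi> i (r, c) = \<phi> ?t (r, c)" if i: "1 \<le> i" "i \<le> ?t" and c: "c < ?s i" for i r c
  proof -
    have "\<forall>c < ?s i. \<phi> i (r, c) = \<phi> ?t (r, c)"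
      using i(2)
    proof (induction rule: inc_induct)
      case base
      show ?case by simp
    next
      case (step k)
      show ?case
      proof (intro allI impI)
        fix c assume c: "c < ?s k"
        then have "c < ?s (Suc k)" using Sig_mono[of k "Suc k" d] by simp
        then show "\<phi> k (r, c) = \<phi> ?t (r, c)"
          using step.IH step.hyps \<open>\<And>i r c. 1 \<le> i \<Longrightarrow> i + 1 \<le> ?t \<Longrightarrow> c < ?s i \<Longrightarrow> \<phi> i (r, c) = \<phi> (i + 1) (r, c)\<close>[of k c r] i(1) c
          by simp
      qed
    qed
    then show ?thesis using c by blast
  qed
  show "u \<in> tangent d x"
  proof (cases "l + 2 \<le> ?t")
    \<comment> \<open>Here t = l + 1: there are no \<beta> arrows, and p_u is zero because it maps
      V_t into V_0.\<close>
    case False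
    then have "u = 0"
      using flagidx_entry[OF u[unfolded pu_eq], of ?t] is_mat_flagidx[OF u[unfolded pu_eq]] l
      by (auto simp: fun_eq_iff Sig_ge Sig_0 is_mat_def not_less) (metis not_less)
    then show ?thesis using fvs.subspace_0[OF subspace_tangent] by blast
  next
    case True
    \<comment> \<open>The last \<beta> arrow, whose component retains the whole of
      \<open>u\<close>.\<close>
    define j where "j = ?t - l - 1"
    have j: "1 \<le> j" "j + l + 1 \<le> ?t" "j + l + 1 = ?t" using True by (auto simp: j_def)
    have st: "?s ?t = ntot d" by (simp add: Sig_ge)
    have restr: "restr (?s j) (?s (j + l + 1)) v = v" if v: "v \<in> pu d l" for v :: "'k mat"
    proof (rule restr_id)
      show "is_mat (?s j) (?s (j + l + 1)) v"
        using flagidx_entry[OF v[unfolded pu_eq], of ?t] is_mat_flagidx[OF v[unfolded pu_eq]]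
        unfolding j(3) st by (auto simp: is_mat_def j_def st not_less) (metis not_less)
    qed
    have u_eq: "u = mmul (ntot d) x (\<phi> ?t) - mmul (?s j) (\<phi> j) x"
      using coboundary_beta[OF j(1,2), of x \<phi>] beta_family_simps(2)[OF j(1,2), of u]
      unfolding eq restr[OF x] restr[OF u] unfolding j(3) st by simp
    have g: "\<phi> ?t \<in> csupp (flagidx d (\<lambda>i. i))"
      unfolding csupp_def
    proof clarify
      fix r c assume rc: "(r, c) \<notin> flagidx d (\<lambda>i. i)"
      show "\<phi> ?t (r, c) = 0"
      proof (cases "c < ntot d")
        case False
        then show ?thesis using \<phi>[of ?t] by (auto simp: is_mat_def st)
      next
        case True
        then obtain i where i: "i \<le> ?t" "c < ?s i" "?s i \<le> r" using rc by (auto simp: flagidx_def not_less)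
        have "1 \<le> i" using i(2) by (cases i) (auto simp: Sig_0)
        then show ?thesis using last[of i c r] i \<phi>[of i] by (simp add: is_mat_def)
      qed
    qed
    \<comment> \<open>The image of \<open>x\<close> lies in V_j, so the further columns of the last
      \<open>\<phi>\<close> only meet zero rows of \<open>x\<close>.\<close>
    have "mmul (?s j) (\<phi> j) x = mmul (ntot d) (\<phi> ?t) x"
    proof (rule ext, clarify)
      fix r c
      show "mmul (?s j) (\<phi> j) x (r, c) = mmul (ntot d) (\<phi> ?t) x (r, c)"
        unfolding mmul_apply
      proof (rule sum_mono_neutral_lessThan)
        show "?s j \<le> ntot d" by (rule Sig_le)
        show "\<phi> j (r, k) * x (k, c) = \<phi> ?t (r, k) * x (k, c)" if "k < ?s j" for k
          using last[of j k r] j that by simp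
        show "\<phi> ?t (r, k) * x (k, c) = 0" if "?s j \<le> k" for k
          using arg_cong[OF restr[OF x], of "\<lambda>v. v (k, c)"] that by (simp add: restr_def)
      qed
    qed
    \<comment> \<open>Coboundaries give \<open>x \<phi> - \<phi> x\<close>, whereas
      \<open>tangent\<close> is written with \<open>a x - x a\<close>.\<close>
    then have "u = mmul (ntot d) (fscale (- 1) (\<phi> ?t)) x - mmul (ntot d) x (fscale (- 1) (\<phi> ?t))"
      unfolding u_eq mmul_fscale_left mmul_fscale_right by (simp add: fun_eq_iff fscale_def)
    then show ?thesis
      unfolding tangent_def using fvs.subspace_scale[OF subspace_csupp g] by (rule image_eqI)
  qed
next
  let ?s = "Sig d" and ?t = "length d"
  assume "u \<in> tangent d x"
  then obtain a where a: "a \<in> csupp (flagidx d (\<lambda>i. i))" and u_eq: "u = mmul (ntot d) a x - mmul (ntot d) x a"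
    unfolding tangent_def by (elim imageE) (rule that)
  have a0: "a (r, c) = 0" if "i \<le> ?t" "c < ?s i" "?s i \<le> r" for i r c
    using flagidx_entry[OF a that] .
  have x0: "x (r, c) = 0" if "j + l + 1 \<le> ?t" "c < ?s (j + l + 1)" "?s j \<le> r" for j r c
    using flagidx_entry[OF x[unfolded pu_eq], of "j + l + 1" c r] that by simp
  \<comment> \<open>The sign again matches the two commutator conventions; the restrictions are
    compatible with the inclusions because \<open>a\<close> preserves the flag.\<close>
  define \<phi> where "\<phi> i = restr (?s i) (?s i) (fscale (- 1) a)" for i
  have "beta_family d l u = coboundary d l x \<phi>"
  proof (rule ext, clarify)
    fix b r c
    show "beta_family d l u (b, r, c) = coboundary d l x \<phi> (b, r, c)"
    proof (cases "valid_arrow ?t l b")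
      case False
      then show ?thesis by (simp add: beta_family_def coboundary_def)
    next
      case True
      show ?thesis
      proof (cases b)
        case (Alpha i)
        have m: "?s i \<le> ?s (i + 1)" by (rule Sig_mono) simp
        have "\<phi> i (r, c) = (if c < ?s i then \<phi> (i + 1) (r, c) else 0)"
          using a0[of i c r] m True Alpha by (auto simp: \<phi>_def restr_def fscale_def valid_arrow_def not_less)
        then have "(\<phi> i - mmul (?s (i + 1)) (\<phi> (i + 1)) (idm (?s i))) (r, c) = 0"
          unfolding mmul_idm_truncate[OF m] by simp
        then show ?thesis using Alpha True by (simp add: beta_family_def coboundary_def)
      next
        case (Beta j)
        then have j: "1 \<le> j" "j + l + 1 \<le> ?t" using True by (auto simp: valid_arrow_def)
        let ?x = "restr (?s j) (?s (j + l + 1)) x"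
        have "restr (?s j) (?s (j + l + 1)) u (r, c)
          = mmul (?s (j + l + 1)) ?x (\<phi> (j + l + 1)) (r, c) - mmul (?s j) (\<phi> j) ?x (r, c)"
        proof (cases "r < ?s j \<and> c < ?s (j + l + 1)")
          case False
          then show ?thesis by (auto simp: mmul_apply restr_def \<phi>_def)
        next
          case True
          have 1: "mmul (?s (j + l + 1)) ?x (\<phi> (j + l + 1)) (r, c) = (\<Sum>k<ntot d. - (x (r, k) * a (k, c)))"
            unfolding mmul_apply
            by (rule sum_mono_neutral_lessThan[OF Sig_le])
               (use True a0[OF j(2)] in \<open>auto simp: restr_def \<phi>_def fscale_def\<close>)
          have 2: "mmul (?s j) (\<phi> j) ?x (r, c) = (\<Sum>k<ntot d. - (a (r, k) * x (k, c)))"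
            unfolding mmul_apply
            by (rule sum_mono_neutral_lessThan[OF Sig_le])
               (use True x0[OF j(2)] in \<open>auto simp: restr_def \<phi>_def fscale_def\<close>)
          show ?thesis unfolding 1 2 using True by (simp add: restr_def u_eq mmul_apply sum_negf)
        qed
        then show ?thesis using Beta True by (simp add: beta_family_def coboundary_def)
      qed
    qed
  qed
  moreover have "\<phi> \<in> vertex_families d" by (simp add: \<phi>_def is_mat_restr)
  ultimately show "beta_family d l u \<in> ext_coboundaries ?t l (Mx d l x) (Mx d l x)"
    unfolding ext_coboundaries_Mx by (rule image_eqI)
qed

text \<open>The entries in \<open>K\<close> determine a tangent vector and can be prescribed freely,
  so the matrices of p_u vanishing on \<open>K\<close> form a complement of the tangent space.
  Through \<open>beta_family\<close> this complement is also one of the coboundaries inside the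
  cocycles.\<close>

theorem ext1_dim_Mx:
  fixes x :: "'k::field mat"
  assumes x: "x \<in> pu d l" and l: "l < length d"
    and K: "K \<subseteq> flagidx d (\<lambda>i. i - l - 1)" and f: "\<And>k. k \<in> K \<Longrightarrow> f k \<in> tangent d x"
    and dual: "\<And>k k'. k \<in> K \<Longrightarrow> k' \<in> K \<Longrightarrow> f k k' = (if k' = k then 1 else 0)"
    and expand: "\<And>v. v \<in> tangent d x \<Longrightarrow> v = (\<Sum>k\<in>K. fscale (v k) (f k))"
  shows "ext1_dim (length d) l (Mx d l x) (Mx d l x) = card (flagidx d (\<lambda>i. i - l - 1) - K)"
proof -
  let ?U = "flagidx d (\<lambda>i. i - l - 1)"
  let ?Z = "ext_cocycles (length d) l (Mx d l x) (Mx d l x)"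
  let ?B = "ext_coboundaries (length d) l (Mx d l x) (Mx d l x)"
  have finK: "finite K" using K finite_flagidx by (rule finite_subset)
  have sub: "csupp (?U - K) \<subseteq> (pu d l :: 'k mat set)" unfolding pu_eq by (rule csupp_mono) auto
  have "fvs.dim ?Z = card (?U - K) + fvs.dim ?B"
  proof (rule dim_direct_sum)
    show "fvs.subspace ?B" by (rule subspace_coboundaries)
    show "?B \<subseteq> csupp (arrow_idx d l)"
      using coboundaries_subset_cocycles[OF x] ext_cocycles_Mx[OF x] by blast
    show "finite (arrow_idx d l)" by (rule finite_arrow_idx)
    show "finite (?U - K)" by (simp add: finite_flagidx)
    show "u = 0" if u: "u \<in> csupp (?U - K)" "beta_family d l u \<in> ?B" for u :: "'k mat"
    proof -
      have "u \<in> tangent d x" using beta_family_coboundary_iff[OF x _ l] u sub by blast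
      then have "u = (\<Sum>k\<in>K. fscale (u k) (f k))" by (rule expand)
      also have "\<dots> = 0" using u(1) by (intro sum.neutral) (auto simp: csupp_def fscale_def)
      finally show ?thesis .
    qed
    show "?Z = {beta_family d l u + b |u b. u \<in> csupp (?U - K) \<and> b \<in> ?B}"
    proof (rule equalityI; rule subsetI)
      fix z assume "z \<in> ?Z"
      then obtain u b where u: "u \<in> pu d l" and b: "b \<in> ?B" and z: "z = beta_family d l u + b"
        using cocycle_decomposition[OF x] by blast
      \<comment> \<open>The tangent vector agreeing with \<open>u\<close> on \<open>K\<close>. It
        contributes a coboundary, and \<open>u - v\<close> is supported outside
        \<open>K\<close>.\<close>
      define v where "v = (\<Sum>k\<in>K. fscale (u k) (f k))"
      have v: "v \<in> tangent d x"
        unfolding v_def by (intro fvs.subspace_sum[OF subspace_tangent] fvs.subspace_scale[OF subspace_tangent] f)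
      have vk: "v k' = u k'" if "k' \<in> K" for k'
      proof -
        have "v k' = (\<Sum>k\<in>K. if k = k' then u k else 0)"
          unfolding v_def sum_fun_eval using dual that by (intro sum.cong) (auto simp: fscale_def)
        then show ?thesis using finK that by simp
      qed
      have v': "v \<in> pu d l" using v tangent_subset_pu[OF x] by blast
      have w: "u - v \<in> csupp (?U - K)"
        using fvs.subspace_diff[OF subspace_csupp u[unfolded pu_eq] v'[unfolded pu_eq]] vk
        by (auto simp: csupp_def)
      have "beta_family d l v + b \<in> ?B"
        using v b beta_family_coboundary_iff[OF x v' l] fvs.subspace_add[OF subspace_coboundaries] by blast
      moreover have "z = beta_family d l (u - v) + (beta_family d l v + b)"
        unfolding z add.assoc[symmetric] beta_family_add[symmetric] by simp
      ultimately show "z \<in> {beta_family d l u + b |u b. u \<in> csupp (?U - K) \<and> b \<in> ?B}"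
        using w by blast
    next
      fix z assume "z \<in> {beta_family d l u + b |u b. u \<in> csupp (?U - K) \<and> b \<in> ?B}"
      then obtain u b where u: "u \<in> csupp (?U - K)" and b: "b \<in> ?B" and z: "z = beta_family d l u + b"
        by blast
      have "- b \<in> ?B" using fvs.subspace_neg[OF subspace_coboundaries b] .
      then have "- b \<in> ?Z" using coboundaries_subset_cocycles[OF x] by blast
      moreover have "beta_family d l u \<in> ?Z" using beta_family_cocycle[OF x] u sub by blast
      ultimately have "beta_family d l u - - b \<in> ?Z" using ext_cocycles_diff[OF x] by blast
      then show "z \<in> ?Z" unfolding z by simp
    qed
  qed (rule beta_family_add beta_family_fscale)+
  \<comment> \<open>The dimension formula makes the natural-number subtraction in
    \<open>ext1_dim\<close> exact.\<close>
  then show ?thesis unfolding ext1_dim_def by simp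
qed

theorem theorem3p1:
  fixes d :: "nat list" and l :: nat and x :: "'k::field mat"
  assumes "alg_closed TYPE('k)"
    and "l < length d"
    and "x \<in> pu d l"
  shows "zdim (pu d l :: 'k mat set) - zdim (orbit d x)
           = enat (ext1_dim (length d) l (Mx d l x) (Mx d l x)) \<and>
         ((pu d l \<subseteq> zclosure (orbit d x))
           \<longleftrightarrow> ext1_dim (length d) l (Mx d l x) (Mx d l x) = 0)"
proof -
  let ?U = "flagidx d (\<lambda>i. i - l - 1)"
  have inf: "infinite (UNIV :: 'k set)" by (rule infinite_if_alg_closed[OF assms(1)])
  obtain K f where K: "K \<subseteq> ?U" and f: "\<And>k. k \<in> K \<Longrightarrow> f k \<in> tangent d x"
    "\<And>k k'. k \<in> K \<Longrightarrow> k' \<in> K \<Longrightarrow> f k k' = (if k' = k then 1 else 0)"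
    "\<And>v. v \<in> tangent d x \<Longrightarrow> v = (\<Sum>k\<in>K. fscale (v k) (f k))"
    using dual_basis_exists[OF subspace_tangent tangent_subset_pu[OF assms(3), unfolded pu_eq] finite_flagidx]
    by blast
  have finK: "finite K" using K finite_flagidx by (rule finite_subset)
  have pu: "zdim (pu d l :: 'k mat set) = enat (card ?U)"
    unfolding pu_eq by (rule zdim_csupp[OF inf finite_flagidx])
  have "zclosure (pu d l) = (pu d l :: 'k mat set)"
    unfolding pu_eq using zclosure_minimal[OF zclosed_csupp order_refl] zclosure_superset by blast
  then have irr: "zirreducible (pu d l :: 'k mat set)"
    using zirreducible_zclosure[OF zprime_csupp[OF inf]] unfolding pu_eq by metis
  have orb: "zdim (orbit d x) = enat (card K)" by (rule zdim_orbit[OF inf assms(3) finK f])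
  have ext: "ext1_dim (length d) l (Mx d l x) (Mx d l x) = card (?U - K)"
    by (rule ext1_dim_Mx[OF assms(3,2) K f])
  have card: "card (?U - K) = card ?U - card K" using finK K by (rule card_Diff_subset)
  have "pu d l \<subseteq> zclosure (orbit d x) \<longleftrightarrow> card (?U - K) = 0"
  proof
    assume "pu d l \<subseteq> zclosure (orbit d x)"
    then have "zclosure (pu d l) \<subseteq> zclosure (orbit d x)" by (simp add: zclosure_subset_iff)
    then have "zdim (pu d l :: 'k mat set) \<le> zdim (orbit d x)"
      unfolding zdim_def by (intro Sup_subset_mono) blast
    then show "card (?U - K) = 0" using pu orb card by simp
  next
    assume 0: "card (?U - K) = 0"
    have "card K \<le> card ?U" using card_mono[OF finite_flagidx K] .
    then have "zdim (orbit d x) = enat (card ?U)" using orb card 0 by simp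
    \<comment> \<open>p_u is irreducible, so an orbit that is not dense would have strictly smaller
      dimension.\<close>
    then show "pu d l \<subseteq> zclosure (orbit d x)"
      using zdim_less_if_not_dense[OF irr zprime_orbit[OF inf] orbit_subset_pu[OF assms(3)] pu] by auto
  qed
  then show ?thesis using pu orb ext card by simp
qed

end
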